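(* Let $\alpha,\kappa>0$, let $p\in\mathcal{P}(\mathbb{R}^n)$ and $r\in\mathcal{P}^{\log}(\mathbb{R}^n)$ be such that $r_\infty=r^-\le p^-$. Then there is a constant $C>0$ such that for every $t>0$ and every $\varphi\in L^{r(\cdot)}(\mathbb{R}^n)$: (1) $\displaystyle\|g_{\alpha,t}*\varphi\|_{L^{p(\cdot)}(\mathbb{R}^n)}\le C\,t^{-\frac{n\psi(t)}{2\alpha}}\|\varphi\|_{L^{r(\cdot)}(\mathbb{R}^n)}$; (2) $\displaystyle\|(-\Delta)^{\kappa/2}g_{\alpha,t}*\varphi\|_{L^{p(\cdot)}(\mathbb{R}^n)}\le C\,t^{-\frac{\kappa}{2\alpha}-\frac{n\psi(t)}{2\alpha}}\|\varphi\|_{L^{r(\cdot)}(\mathbb{R}^n)}$; where $$\psi(t)=\begin{cases}\frac1{r^-}\left(1-\frac{r^-}{p^+}\right), & 0<t\le1,\\ \frac1{r^+}\left(1-\frac{r^-}{p^-}\right), & t>1.\end{cases}$$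
   Context: $g_{\alpha,t}=\mathcal{F}^{-1}[e^{-t|\xi|^{2\alpha}}]$ is the fractional heat kernel on $\mathbb{R}^n$, so that $g_{\alpha,t}*\varphi=e^{-t(-\Delta)^\alpha}\varphi$ (the multiplicative normalisation of the Fourier transform only affects constants); $(-\Delta)^{\kappa/2}$ is the Fourier multiplier with symbol $|\xi|^\kappa$. $\mathcal{P}(\mathbb{R}^n)$ is the set of measurable functions $p:\mathbb{R}^n\to[1,\infty]$; $p^-$ and $p^+$ are the essential infimum and supremum of $p$; $\frac{a}{\infty}:=0$ for $a\in[1,\infty]$. The modular is $\varrho_{p(\cdot)}(f)=\int_{\mathbb{R}^n}\omega_{p(x)}(|f(x)|)\,dx$, with $\omega_p(t)=t^p$ if $p<\infty$, and $\omega_\infty(t)=0$ for $t\le1$, $\omega_\infty(t)=\infty$ for $t>1$. $L^{p(\cdot)}(\mathbb{R}^n)$ is the space of measurable $f$ with $\varrho_{p(\cdot)}(\lambda f)<\infty$ for some $\lambda>0$, normed by $\|f\|_{L^{p(\cdot)}}=\inf\{\lambda>0:\varrho_{p(\cdot)}(f/\lambda)\le1\}$. A real function $g$ on $\mathbb{R}^n$ is globally log-Hölder continuous if there are $c>0$ and $g_\infty\in\mathbb{R}$ with $|g(x)-g(y)|\le \frac{c}{\log(e+1/|x-y|)}$ and $|g(x)-g_\infty|\le\frac{c}{\log(e+|x|)}$ for all $x,y$. $\mathcal{P}^{\log}(\mathbb{R}^n)$ is the set of $r\in\mathcal{P}(\mathbb{R}^n)$ with $1/r$ globally log-Hölder continuous,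 and $r_\infty\in[1,\infty]$ is defined by $\frac1{r_\infty}=\lim_{|x|\to\infty}\frac1{r(x)}$. *)

theory Defs
  imports "HOL-Analysis.Analysis" "HOL-Probability.Essential_Supremum"
begin

section \<open>Fourier transform, fractional heat kernel, convolution\<close>

text \<open>The Fourier transform is normalised without a factor in the forward direction, which makes
  convolution with \<open>inv_fourier m\<close> the Fourier multiplier operator with symbol \<open>m\<close>.\<close>

definition fourier :: "(real^'n \<Rightarrow> complex) \<Rightarrow> real^'n \<Rightarrow> complex" where
  "fourier f \<xi> = (LINT x|lebesgue. cis (- (x \<bullet> \<xi>)) * f x)"

definition inv_fourier :: "(real^'n \<Rightarrow> complex) \<Rightarrow> real^'n \<Rightarrow> complex" where
  "inv_fourier h x =
     complex_of_real ((2 * pi) powr (- real CARD('n))) * (LINT \<xi>|lebesgue. cis (x \<bullet> \<xi>) * h \<xi>)"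

definition frac_heat_kernel :: "real \<Rightarrow> real \<Rightarrow> real^'n \<Rightarrow> complex" where
  "frac_heat_kernel \<alpha> t = inv_fourier (\<lambda>\<xi>. complex_of_real (exp (- t * norm \<xi> powr (2 * \<alpha>))))"

text \<open>\<open>frac_laplacian s f\<close> is \<open>(-\<Delta>)\<^sup>s f\<close>, so \<open>(-\<Delta>)\<^bsup>\<kappa>/2\<^esup>\<close> has the symbol \<open>\<bar>\<xi>\<bar>\<^sup>\<kappa>\<close>.  The transforms are
  Lebesgue integrals, so this is meaningful for integrable \<open>f\<close> for which \<open>\<bar>\<xi>\<bar>\<^bsup>2s\<^esup>\<close> times the Fourier
  transform of \<open>f\<close> is integrable; the fractional heat kernel is of this kind.\<close>

definition frac_laplacian :: "real \<Rightarrow> (real^'n \<Rightarrow> complex) \<Rightarrow> real^'n \<Rightarrow> complex" where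
  "frac_laplacian s f =
     inv_fourier (\<lambda>\<xi>. complex_of_real (norm \<xi> powr (2 * s)) * fourier f \<xi>)"

definition conv_fun :: "(real^'n \<Rightarrow> complex) \<Rightarrow> (real^'n \<Rightarrow> complex) \<Rightarrow> real^'n \<Rightarrow> complex" where
  "conv_fun f g x = (LINT y|lebesgue. f (x - y) * g y)"

text \<open>A Bochner integral that does not exist has the value 0, so the existence of a convolution
  has to be stated separately.\<close>

definition conv_exists :: "(real^'n \<Rightarrow> complex) \<Rightarrow> (real^'n \<Rightarrow> complex) \<Rightarrow> bool" where
  "conv_exists f g \<longleftrightarrow> (AE x in lebesgue. integrable lebesgue (\<lambda>y. f (x - y) * g y))"


section \<open>Variable exponents and variable Lebesgue spaces\<close>

text \<open>Exponents are \<open>ennreal\<close>-valued.  In \<open>ennreal\<close> one has \<open>a / \<infinity> = 0\<close> for every \<open>a\<close>, including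
  \<open>a = \<infinity>\<close>, and \<open>1 / 0 = \<infinity>\<close>.\<close>

definition var_exponents :: "(real^'n \<Rightarrow> ennreal) set" where
  "var_exponents = {p. p \<in> borel_measurable lebesgue \<and> (\<forall>x. 1 \<le> p x)}"

definition exp_minus :: "(real^'n \<Rightarrow> ennreal) \<Rightarrow> ennreal" where
  "exp_minus p = Sup {z. AE x in lebesgue. z \<le> p x}"

definition exp_plus :: "(real^'n \<Rightarrow> ennreal) \<Rightarrow> ennreal" where
  "exp_plus p = esssup lebesgue p"

text \<open>\<open>\<omega>\<^sub>p(s)\<close> for \<open>1 \<le> p \<le> \<infinity>\<close> and \<open>s \<ge> 0\<close>.\<close>

definition omega :: "ennreal \<Rightarrow> real \<Rightarrow> ennreal" where
  "omega p s = (if p = \<infinity> then (if s \<le> 1 then 0 else \<infinity>) else ennreal (s powr enn2real p))"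

definition modular :: "(real^'n \<Rightarrow> ennreal) \<Rightarrow> (real^'n \<Rightarrow> complex) \<Rightarrow> ennreal" where
  "modular p f = (\<integral>\<^sup>+x. omega (p x) (cmod (f x)) \<partial>lebesgue)"

definition var_Lp :: "(real^'n \<Rightarrow> ennreal) \<Rightarrow> (real^'n \<Rightarrow> complex) set" where
  "var_Lp p = {f. f \<in> borel_measurable lebesgue \<and>
                  (\<exists>l::real>0. modular p (\<lambda>x. complex_of_real l * f x) < \<infinity>)}"

text \<open>Only meaningful for \<open>f\<close> in \<open>var_Lp p\<close>, where the set is nonempty.\<close>

definition var_norm :: "(real^'n \<Rightarrow> ennreal) \<Rightarrow> (real^'n \<Rightarrow> complex) \<Rightarrow> real" where
  "var_norm p f = Inf {l::real. l > 0 \<and> modular p (\<lambda>x. f x / complex_of_real l) \<le> 1}"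

text \<open>In the first bound the case \<open>x = y\<close> is trivial, whatever the value of \<open>1 / 0\<close>.\<close>

definition globally_log_Hoelder :: "(real^'n \<Rightarrow> real) \<Rightarrow> bool" where
  "globally_log_Hoelder g \<longleftrightarrow>
     (\<exists>c>0. \<exists>g_inf::real.
        (\<forall>x y. \<bar>g x - g y\<bar> \<le> c / ln (exp 1 + 1 / norm (x - y))) \<and>
        (\<forall>x. \<bar>g x - g_inf\<bar> \<le> c / ln (exp 1 + norm x)))"

definition log_exponents :: "(real^'n \<Rightarrow> ennreal) set" where
  "log_exponents = {r \<in> var_exponents. globally_log_Hoelder (\<lambda>x. enn2real (1 / r x))}"

text \<open>The limit exists for \<open>r\<close> in \<open>log_exponents\<close>.\<close>

definition exp_infinity :: "(real^'n \<Rightarrow> ennreal) \<Rightarrow> ennreal" where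
  "exp_infinity r = 1 / Lim at_infinity (\<lambda>x. 1 / r x)"

definition decay_psi :: "(real^'n \<Rightarrow> ennreal) \<Rightarrow> (real^'n \<Rightarrow> ennreal) \<Rightarrow> real \<Rightarrow> real" where
  "decay_psi p r t =
     (if t \<le> 1 then enn2real (1 / exp_minus r) * (1 - enn2real (exp_minus r / exp_plus p))
      else enn2real (1 / exp_plus r) * (1 - enn2real (exp_minus r / exp_minus p)))"

end

theory Submission
  imports Defs "HOL-Probability.Sinc_Integral"
begin

text \<open>
  Since \<open>r\<^sub>\<infinity> = r\<^sup>-\<close>, the decay condition at infinity embeds \<open>L\<^bsup>r(\<cdot>)\<^esup>\<close> into the
  classical space \<open>L\<^bsup>q\<^esup>\<close> with \<open>q = r\<^sup>-\<close>, so no maximal function is needed.  Both kernels are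
  constant multiples of dilates \<open>\<tau>\<^bsup>-n\<^esup> J(x / \<tau>)\<close>, \<open>\<tau> = t\<^bsup>1/(2\<alpha>)\<^esup>\<close>, of fixed
  functions \<open>J \<in> L\<^sup>1 \<inter> L\<^sup>\<infinity>\<close>, and convolution with such a dilate maps \<open>L\<^bsup>q\<^esup>\<close> boundedly into
  \<open>L\<^bsup>q\<^esup>\<close>, and into \<open>L\<^sup>\<infinity>\<close> with norm of order \<open>\<tau>\<^bsup>-n/q\<^esup>\<close>.  As \<open>q \<le> p\<close>, interpolating
  pointwise between these two bounds inside the modular gives the exponent \<open>1/q - 1/p\<^sup>+\<close> for
  \<open>\<tau> \<le> 1\<close> and \<open>1/q - 1/p\<^sup>-\<close> for \<open>\<tau> > 1\<close>; the latter is at least \<open>\<psi>\<close>.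

  The kernels are integrable although the symbols \<open>F(\<bar>\<xi>\<bar>\<^sup>2)\<close>, \<open>F(s) = s\<^bsup>a\<^esup> exp (- s\<^bsup>\<alpha>\<^esup>)\<close>, are not
  smooth at the origin: Taylor's formula at infinity writes \<open>F(\<bar>\<xi>\<bar>\<^sup>2)\<close> as an integral over \<open>R > 0\<close>
  of the bumps \<open>max 0 (1 - \<bar>\<xi>\<bar>\<^sup>2 / R) ^ N\<close>, with a weight that is integrable; the Fourier transforms
  of these bumps are dilates of one integrable function and so have the same \<open>L\<^sup>1\<close> norm.
\<close>

subsection \<open>Integration over Euclidean space\<close>

text \<open>The embedding works because r(x) >= q does no harm where |f(x)| >= 1, and where |f(x)|
  is small the gap between 1/q and 1/r(x), at most c / log(e + |x|), costs only a fixed factor and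
  an error (e + |x|)^(-2n), which is integrable. The weight of the bumps is integrable by a count of
  orders at the origin: N + 1 derivatives lower the order d of the profile to d - N - 1, the factor
  R^N that turns (R - s)^N into a bump repays N of them, and R^(d-1) is integrable since d > 0. The
  heat symbol equals 1 at the origin, but this constant disappears in the first derivative, which
  leaves d = \<alpha>. In the interpolation let M be the sup bound and A the L^q bound of the
  convolution. A number \<Lambda> bounds the norm as soon as (M / \<Lambda>)^p(x) <= (M / A)^q
  almost everywhere. Both sides are powers of \<tau>, so the critical p(x) is p^+ or p^- according
  to the side of 1 on which \<tau> lies; this is the origin of the two branches of \<psi>. The
  fractional Laplacian acts on the kernel, not on its symbol, so recovering the symbol takes a
  Fourier inversion formula, if only up to a constant.\<close>

lemma nn_integral_lborel_affine:
  fixes f :: "'a::euclidean_space \<Rightarrow> ennreal"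
  assumes [measurable]: "f \<in> borel_measurable borel" and c: "c \<noteq> 0"
  shows "(\<integral>\<^sup>+x. f x \<partial>lborel) = ennreal (\<bar>c\<bar> ^ DIM('a)) * (\<integral>\<^sup>+x. f (t + c *\<^sub>R x) \<partial>lborel)"
  by (subst lborel_affine[OF c, of t])
    (simp add: nn_integral_density nn_integral_distr nn_integral_cmult)

lemma
  fixes f :: "'a::euclidean_space \<Rightarrow> 'b::{banach, second_countable_topology}"
  assumes [measurable]: "f \<in> borel_measurable borel" and c: "c \<noteq> 0"
  shows integral_lborel_affine:
      "(LINT x|lborel. f x) = (\<bar>c\<bar> ^ DIM('a)) *\<^sub>R (LINT x|lborel. f (t + c *\<^sub>R x))" (is ?int)
    and integrable_lborel_affine:
      "integrable lborel f \<Longrightarrow> integrable lborel (\<lambda>x. f (t + c *\<^sub>R x))" (is "_ \<Longrightarrow> ?able")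
proof -
  show ?int
    by (subst lborel_affine[OF c, of t]) (simp add: integral_density integral_distr)
  assume "integrable lborel f"
  then have "integrable lborel (\<lambda>x. \<bar>c\<bar> ^ DIM('a) *\<^sub>R f (t + c *\<^sub>R x))"
    by (subst (asm) lborel_affine[OF c, of t]) (simp add: integrable_density integrable_distr_eq)
  from integrable_scaleR_right[OF this, of "inverse (\<bar>c\<bar> ^ DIM('a))"] show ?able
    using c by simp
qed

lemma integral_lborel_translation:
  fixes f :: "'a::euclidean_space \<Rightarrow> 'b::{banach, second_countable_topology}"
  assumes "f \<in> borel_measurable borel"
  shows "(LINT x|lborel. f (x + t)) = (LINT x|lborel. f x)"
  using integral_lborel_affine[OF assms, of 1 t] by (simp add: add.commute)

lemma integrable_lborel_translation:
  fixes f :: "'a::euclidean_space \<Rightarrow> 'b::{banach, second_countable_topology}"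
  assumes "integrable lborel f"
  shows "integrable lborel (\<lambda>x. f (x + t))"
  using integrable_lborel_affine[of f 1 t] assms by (simp add: add.commute)

text \<open>Since |x . b| <= |x|, the weight lies below a product of one-dimensional functions 1 /
  (1 + t^2), and Tonelli reduces the claim to the real line. It is the common majorant for
  transforms of bumps, for the symbols, and for the error term of the embedding into L^q.\<close>

lemma integrable_polynomial_weight:
  "integrable lborel (\<lambda>x::'a::euclidean_space. inverse ((1 + (norm x)\<^sup>2) ^ DIM('a)))"
proof (rule integrableI_nonneg)
  have *: "(\<integral>\<^sup>+x. ennreal (inverse (1 + (x::real)\<^sup>2)) \<partial>lborel) < \<infinity>"
  proof -
    have "integrable lborel (\<lambda>x::real. inverse (1 + x\<^sup>2))"
      using integrable_inverse_1_plus_square unfolding set_integrable_def einterval_eq by simp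
    then have "(\<integral>\<^sup>+x. ennreal (norm (inverse (1 + (x::real)\<^sup>2))) \<partial>lborel) < \<infinity>"
      unfolding integrable_iff_bounded by blast
    moreover have "norm (inverse (1 + x\<^sup>2)) = inverse (1 + x\<^sup>2)" for x :: real
      by (simp add: add_nonneg_nonneg)
    ultimately show ?thesis by simp
  qed
  have "(\<integral>\<^sup>+x. ennreal (inverse ((1 + (norm (x::'a))\<^sup>2) ^ DIM('a))) \<partial>lborel)
      \<le> (\<integral>\<^sup>+x. (\<Prod>b\<in>Basis. ennreal (inverse (1 + ((x::'a) \<bullet> b)\<^sup>2))) \<partial>lborel)"
  proof (rule nn_integral_mono)
    fix x :: 'a
    have "(\<Prod>b\<in>(Basis::'a set). 1 + (x \<bullet> b)\<^sup>2) \<le> (\<Prod>b\<in>(Basis::'a set). 1 + (norm x)\<^sup>2)"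
    proof (intro prod_mono conjI)
      fix b :: 'a assume "b \<in> Basis"
      then have "\<bar>x \<bullet> b\<bar>\<^sup>2 \<le> (norm x)\<^sup>2"
        by (intro power_mono) (auto simp: Basis_le_norm)
      then show "1 + (x \<bullet> b)\<^sup>2 \<le> 1 + (norm x)\<^sup>2" by simp
    qed simp
    also have "\<dots> = (1 + (norm x)\<^sup>2) ^ DIM('a)" by simp
    finally have "inverse ((1 + (norm x)\<^sup>2) ^ DIM('a)) \<le> (\<Prod>b\<in>(Basis::'a set). inverse (1 + (x \<bullet> b)\<^sup>2))"
      using prod_inversef[of "\<lambda>b. 1 + (x \<bullet> b)\<^sup>2" "Basis :: 'a set"]
      by (simp add: o_def le_imp_inverse_le prod_pos add_pos_nonneg)
    then show "ennreal (inverse ((1 + (norm x)\<^sup>2) ^ DIM('a)))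
        \<le> (\<Prod>b\<in>Basis. ennreal (inverse (1 + (x \<bullet> b)\<^sup>2)))"
      by (simp add: prod_ennreal ennreal_leI)
  qed
  also have "\<dots> = (\<Prod>b\<in>(Basis::'a set). (\<integral>\<^sup>+x. ennreal (inverse (1 + (x::real)\<^sup>2)) \<partial>lborel))"
    by (rule nn_integral_lborel_prod) auto
  also have "\<dots> < \<infinity>"
    using * by (simp add: power_less_top_ennreal)
  finally show "(\<integral>\<^sup>+x. ennreal (inverse ((1 + (norm (x::'a))\<^sup>2) ^ DIM('a))) \<partial>lborel) < \<infinity>" .
qed auto

section \<open>Integration by parts for compactly supported functions\<close>

lemma integrable_compact_support:
  fixes f :: "'a::euclidean_space \<Rightarrow> 'b::euclidean_space"
  assumes "continuous_on UNIV f" and "\<And>x. norm x > 1 \<Longrightarrow> f x = 0"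
  shows "integrable lborel f"
proof (rule Bochner_Integration.integrable_bound)
  show "integrable lborel (\<lambda>x. indicator (cball 0 1) x *\<^sub>R f x)"
    by (rule borel_integrable_compact) (use assms in \<open>auto intro: continuous_on_subset\<close>)
  show "AE x in lborel. norm (f x) \<le> norm (indicator (cball 0 1) x *\<^sub>R f x)"
    using assms(2) by (intro AE_I2) (auto simp: not_le indicator_def)
qed (use assms(1) in \<open>auto intro: borel_measurable_continuous_onI\<close>)

text \<open>Difference quotients of \<open>u\<close> have integral 0 by translation invariance, and
  they converge to \<open>u'\<close> under a common majorant. Applied to a product, this is
  integration by parts without iterated integrals.\<close>

lemma integral_directional_derivative_eq_0:
  fixes u u' :: "'a::euclidean_space \<Rightarrow> complex"
  assumes cont: "continuous_on UNIV u" "continuous_on UNIV u'"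
    and supp: "\<And>x. norm x > 1 \<Longrightarrow> u x = 0" "\<And>x. norm x > 1 \<Longrightarrow> u' x = 0"
    and deriv: "\<And>x. ((\<lambda>h. u (x + h *\<^sub>R j)) has_vector_derivative u' x) (at 0)"
    and j: "norm j = 1"
  shows "(LINT x|lborel. u' x) = 0"
proof -
  have [measurable]: "u \<in> borel_measurable borel" "u' \<in> borel_measurable borel"
    using cont by (auto intro: borel_measurable_continuous_onI)
  have "compact (u' ` cball 0 1)"
    by (rule compact_continuous_image) (use cont in \<open>auto intro: continuous_on_subset\<close>)
  then have "bounded (u' ` cball 0 1)"
    by (rule compact_imp_bounded)
  then obtain D where D0: "D > 0" and "\<forall>z\<in>u' ` cball 0 1. norm z \<le> D"
    unfolding bounded_pos by auto
  then have D: "norm (u' x) \<le> D" if "x \<in> cball 0 1" for x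
    using that by blast
  have D': "norm (u' x) \<le> D" for x
    using D[of x] supp(2)[of x] D0 by (cases "norm x \<le> 1") auto
  \<comment> \<open>The hypothesis differentiates at parameter 0 only, but from every base point;
    recentring at x + h j gives every h.\<close>
  have dline: "((\<lambda>h. u (x + h *\<^sub>R j)) has_vector_derivative u' (x + h *\<^sub>R j)) (at h)" for x h
  proof -
    have "((\<lambda>h'. u ((x + h *\<^sub>R j) + (h' - h) *\<^sub>R j)) has_vector_derivative u' (x + h *\<^sub>R j)) (at h)"
    proof (rule vector_diff_chain_at[where f = "\<lambda>h'. h' - h" and f' = 1
          and g = "\<lambda>s. u ((x + h *\<^sub>R j) + s *\<^sub>R j)" and g' = "u' (x + h *\<^sub>R j)", unfolded o_def scaleR_one])
      show "((\<lambda>h'. h' - h) has_vector_derivative 1) (at h)"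
        by (auto intro!: derivative_eq_intros)
      show "((\<lambda>s. u (x + h *\<^sub>R j + s *\<^sub>R j)) has_vector_derivative u' (x + h *\<^sub>R j)) (at (h - h))"
        using deriv[of "x + h *\<^sub>R j"] by simp
    qed
    then show ?thesis
      by (simp add: algebra_simps)
  qed
  have lip: "norm (u (x + h *\<^sub>R j) - u x) \<le> D * \<bar>h\<bar>" for x h
  proof -
    have "norm ((\<lambda>h. u (x + h *\<^sub>R j)) h - (\<lambda>h. u (x + h *\<^sub>R j)) 0) \<le> D * norm (h - 0)"
    proof (rule differentiable_bound[OF convex_UNIV _ _ UNIV_I UNIV_I])
      show "((\<lambda>h. u (x + h *\<^sub>R j)) has_derivative (\<lambda>s. s *\<^sub>R u' (x + h *\<^sub>R j))) (at h within UNIV)" for h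
        using dline[of x h] by (simp add: has_vector_derivative_def)
      show "onorm (\<lambda>s. s *\<^sub>R u' (x + h *\<^sub>R j)) \<le> D" for h
        by (rule onorm_le) (use mult_right_mono[OF D' abs_ge_zero] in \<open>auto simp: mult.commute\<close>)
    qed
    then show ?thesis by simp
  qed
  define e :: "nat \<Rightarrow> real" where "e k = inverse (Suc k)" for k
  have e: "e k > 0" "e k \<le> 1" for k by (auto simp: e_def field_simps)
  define s where "s k x = (u (x + e k *\<^sub>R j) - u x) /\<^sub>R e k" for k x
  have [measurable]: "s k \<in> borel_measurable borel" for k unfolding s_def by measurable
  have "(\<lambda>k. LINT x|lborel. s k x) \<longlonglongrightarrow> (LINT x|lborel. u' x)"
  \<comment> \<open>Steps have length at most 1 and \<open>u\<close> lives in the unit ball, so all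
    quotients vanish outside the ball of radius 2; inside it they are at most D by
    \<open>lip\<close>.\<close>
  proof (rule integral_dominated_convergence[where w = "\<lambda>x. D * indicator (cball 0 2) x"])
    show "integrable lborel (\<lambda>x. D * indicator (cball (0::'a) 2) x :: real)"
      by (intro integrable_mult_right integrable_real_indicator) (use emeasure_lborel_cball_finite[of "0::'a" 2] in auto)
    show "AE x in lborel. (\<lambda>k. s k x) \<longlonglongrightarrow> u' x"
    proof (rule AE_I2)
      fix x
      have "((\<lambda>h. (u (x + h *\<^sub>R j) - u x) /\<^sub>R h) \<longlongrightarrow> u' x) (at 0)"
      proof -
        have "((\<lambda>h. norm (((u (x + h *\<^sub>R j) - u (x + 0 *\<^sub>R j)) - (h - 0) *\<^sub>R u' x) /\<^sub>R norm (h - 0))) \<longlongrightarrow> 0) (at 0)"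
          using deriv[of x] unfolding has_vector_derivative_def has_derivative_def
          by (auto dest: tendsto_norm_zero)
        moreover have "\<forall>\<^sub>F h in at 0. norm (((u (x + h *\<^sub>R j) - u (x + 0 *\<^sub>R j)) - (h - 0) *\<^sub>R u' x) /\<^sub>R norm (h - 0))
            = norm ((u (x + h *\<^sub>R j) - u x) /\<^sub>R h - u' x)"
          unfolding eventually_at_filter
        proof (rule always_eventually, intro allI impI)
          fix h :: real assume h: "h \<noteq> 0"
          have "((u (x + h *\<^sub>R j) - u x) /\<^sub>R h - u' x) = ((u (x + h *\<^sub>R j) - u x) - h *\<^sub>R u' x) /\<^sub>R h"
            using h by (simp add: scaleR_diff_right)
          then show "norm (((u (x + h *\<^sub>R j) - u (x + 0 *\<^sub>R j)) - (h - 0) *\<^sub>R u' x) /\<^sub>R norm (h - 0))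
            = norm ((u (x + h *\<^sub>R j) - u x) /\<^sub>R h - u' x)"
            by simp
        qed
        ultimately have "((\<lambda>h. norm ((u (x + h *\<^sub>R j) - u x) /\<^sub>R h - u' x)) \<longlongrightarrow> 0) (at 0)"
          by (rule Lim_transform_eventually)
        then show ?thesis
          by (simp add: tendsto_norm_zero_iff LIM_zero_iff)
      qed
      moreover have "filterlim e (at 0) sequentially"
        unfolding filterlim_at e_def using LIMSEQ_inverse_real_of_nat by auto
      ultimately show "(\<lambda>k. s k x) \<longlonglongrightarrow> u' x"
        using filterlim_compose[of "\<lambda>h. (u (x + h *\<^sub>R j) - u x) /\<^sub>R h" "nhds (u' x)" "at 0" e sequentially]
        by (simp add: s_def)
    qed
    fix k
    show "AE x in lborel. norm (s k x) \<le> D * indicator (cball 0 2) x"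
    proof (rule AE_I2)
      fix x
      show "norm (s k x) \<le> D * indicator (cball 0 2) x"
      proof (cases "norm x \<le> 2")
        case True
        then show ?thesis
          using lip[of x "e k"] e[of k] by (simp add: s_def divide_simps mult.commute)
      next
        case False
        have "norm (x + e k *\<^sub>R j) > 1"
          using norm_triangle_ineq4[of "x + e k *\<^sub>R j" "e k *\<^sub>R j"] False e[of k] j by simp
        then show ?thesis
          using False supp(1)[of x] supp(1)[of "x + e k *\<^sub>R j"] by (simp add: s_def)
      qed
    qed
  qed auto
  moreover have "(LINT x|lborel. s k x) = 0" for k
  proof -
    have iu: "integrable lborel u"
      by (rule integrable_compact_support[OF cont(1) supp(1)])
    have "(LINT x|lborel. s k x) = ((LINT x|lborel. u (x + e k *\<^sub>R j)) - (LINT x|lborel. u x)) /\<^sub>R e k"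
      unfolding s_def using iu integrable_lborel_translation[OF iu, of "e k *\<^sub>R j"] by simp
    then show ?thesis
      by (simp add: integral_lborel_translation)
  qed
  ultimately show ?thesis
    by (simp add: LIMSEQ_const_iff)
qed

subsection \<open>Fourier transforms of bumps\<close>

lemma borel_measurable_cis [measurable (raw)]:
  "f \<in> borel_measurable M \<Longrightarrow> (\<lambda>x. cis (f x)) \<in> borel_measurable M"
  by (rule borel_measurable_continuous_on[of cis]) (auto simp: cis_conv_exp intro!: continuous_intros)

lemma has_vector_derivative_cis_affine:
  "((\<lambda>h. cis (c + h * d)) has_vector_derivative \<i> * complex_of_real d * cis c) (at 0)"
proof -
  have "((\<lambda>h. \<i> * complex_of_real (c + h * d)) has_vector_derivative \<i> * complex_of_real d) (at 0)"
    by (intro has_vector_derivative_mult_right has_vector_derivative_of_real)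
       (auto intro!: derivative_eq_intros simp: has_real_derivative_iff_has_vector_derivative[symmetric])
  from field_vector_diff_chain_at[OF this DERIV_exp] show ?thesis
    by (simp add: o_def cis_conv_exp)
qed

text \<open>One transform for both directions: \<open>inv_fourier\<close> is a constant times
  \<open>ft\<close>, and \<open>fourier\<close> is \<open>ft\<close> at the reflected point.
  Integrating over \<open>lborel\<close> gives access to Fubini on products of Borel
  measures.\<close>

definition ft :: "('a::euclidean_space \<Rightarrow> complex) \<Rightarrow> 'a \<Rightarrow> complex" where
  "ft f x = (LINT \<xi>|lborel. cis (x \<bullet> \<xi>) * f \<xi>)"

lemma inv_fourier_eq_ft:
  fixes h :: "real^'n \<Rightarrow> complex"
  assumes [measurable]: "h \<in> borel_measurable borel"
  shows "inv_fourier h x = complex_of_real ((2 * pi) powr (- real CARD('n))) * ft h x"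
  unfolding inv_fourier_def ft_def by (subst integral_completion) auto

lemma fourier_eq_ft:
  fixes h :: "real^'n \<Rightarrow> complex"
  assumes [measurable]: "h \<in> borel_measurable borel"
  shows "fourier h x = ft h (- x)"
  unfolding fourier_def ft_def by (subst integral_completion) (auto simp: inner_commute)

lemma norm_ft_le: "norm (ft f x) \<le> (LINT \<xi>|lborel. norm (f \<xi>))"
  unfolding ft_def using integral_norm_bound[of lborel "\<lambda>\<xi>. cis (x \<bullet> \<xi>) * f \<xi>"]
  by (simp add: norm_mult)

lemma integrable_cis_mult:
  fixes f :: "'a::euclidean_space \<Rightarrow> complex"
  assumes "integrable lborel f"
  shows "integrable lborel (\<lambda>\<xi>. cis (x \<bullet> \<xi>) * f \<xi>)"
proof (rule Bochner_Integration.integrable_bound[OF assms])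
  have [measurable]: "f \<in> borel_measurable borel"
    using assms by auto
  show "(\<lambda>\<xi>. cis (x \<bullet> \<xi>) * f \<xi>) \<in> borel_measurable lborel"
    by measurable
qed (simp add: norm_mult)

lemma borel_measurable_ft [measurable]:
  fixes f :: "'a::euclidean_space \<Rightarrow> complex"
  assumes [measurable]: "f \<in> borel_measurable borel"
  shows "ft f \<in> borel_measurable borel"
proof -
  have "(\<lambda>(x::'a, \<xi>::'a). cis (x \<bullet> \<xi>) * f \<xi>) \<in> borel_measurable (borel \<Otimes>\<^sub>M lborel)"
    by measurable
  from lborel.borel_measurable_lebesgue_integral[OF this] show ?thesis
    unfolding ft_def by simp
qed

text \<open>These are the Bochner-Riesz multipliers. \<open>M\<close> measures the smoothness across
  the unit sphere and so controls the decay of the transform. For M = 0 the value is 1 everywhere,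
  because 0 ^ 0 = 1; hence the conditions M > 0 below.\<close>

definition bump :: "nat \<Rightarrow> 'a::real_inner \<Rightarrow> real" where
  "bump M x = max 0 (1 - (norm x)\<^sup>2) ^ M"

lemma bump_0 [simp]: "bump M 0 = 1"
  by (simp add: bump_def)

lemma bump_nonneg: "0 \<le> bump M x" and bump_le_1: "bump M x \<le> 1"
  by (auto simp: bump_def intro!: power_le_one)

lemma bump_eq_0: "norm x > 1 \<Longrightarrow> M > 0 \<Longrightarrow> bump M x = 0"
  by (simp add: bump_def max_def power_le_one_iff power2_le_iff_abs_le abs_square_le_1)

lemma continuous_bump [continuous_intros]:
  "continuous_on A f \<Longrightarrow> continuous_on A (\<lambda>x. bump M (f x))"
  unfolding bump_def by (intro continuous_intros)

lemma borel_measurable_bump [measurable]: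
  "bump M \<in> borel_measurable (borel :: 'a::euclidean_space measure)"
  by (intro borel_measurable_continuous_onI continuous_bump continuous_on_id)

lemma has_field_derivative_max_0_power:
  assumes "M \<ge> 2"
  shows "((\<lambda>y::real. max 0 y ^ M) has_field_derivative real M * max 0 y ^ (M - 1)) (at y)"
proof -
  consider "y < 0" | "y = 0" | "y > 0" by linarith
  then show ?thesis
  proof cases
    case 1
    have "((\<lambda>y::real. 0) has_field_derivative real M * max 0 y ^ (M - 1)) (at y)"
    proof -
      have "0 < M - Suc 0" using assms by simp
      then have "real M * max 0 y ^ (M - 1) = 0" using 1 by (simp add: max_def zero_power)
      then show ?thesis by (simp only: DERIV_const)
    qed
    then show ?thesis
      by (rule has_field_derivative_transform_within_open[of _ _ _ "{..<0}"]) (use 1 assms in \<open>auto simp: max_def\<close>)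
  next
    case 2
    \<comment> \<open>The two one-sided formulas meet at the origin: the quotient is at most
      |h|^(M-1), which tends to 0 because M >= 2.\<close>
    have "(\<lambda>h. max 0 h ^ M / h) \<midarrow>0\<rightarrow> (0::real)"
    proof (rule Lim_null_comparison)
      show "\<forall>\<^sub>F h in at 0. norm (max 0 h ^ M / h) \<le> \<bar>h\<bar> ^ (M - 1)"
        unfolding eventually_at_filter
      proof (rule always_eventually, intro allI impI)
        fix h :: real assume "h \<noteq> 0"
        have "\<bar>h\<bar> ^ M = \<bar>h\<bar> ^ (M - 1) * \<bar>h\<bar>"
          using assms by (metis Suc_diff_1 less_le_trans pos2 power_Suc2)
        then have "norm (max 0 h ^ M) \<le> \<bar>h\<bar> ^ (M - 1) * \<bar>h\<bar>"
          using assms by (metis abs_ge_self abs_ge_zero abs_power_minus max.bounded_iff max.cobounded1 norm_power power_mono real_norm_def abs_of_nonneg)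
        then show "norm (max 0 h ^ M / h) \<le> \<bar>h\<bar> ^ (M - 1)"
          using \<open>h \<noteq> 0\<close> by (simp add: divide_le_eq)
      qed
      show "(\<lambda>h::real. \<bar>h\<bar> ^ (M - 1)) \<midarrow>0\<rightarrow> 0"
        using assms by (auto intro!: tendsto_eq_intros)
    qed
    moreover have e: "(0::real) ^ M = 0" "(0::real) ^ (M - 1) = 0"
      using assms by (auto simp: zero_power)
    ultimately show ?thesis
      unfolding DERIV_def 2 by (simp only: add_0 max.idem e mult_zero_right diff_zero)
  next
    case 3
    have "((\<lambda>y::real. y ^ M) has_field_derivative real M * max 0 y ^ (M - 1)) (at y)"
      using 3 by (auto intro!: derivative_eq_intros simp: max_def)
    then show ?thesis
      by (rule has_field_derivative_transform_within_open[of _ _ _ "{0<..}"]) (use 3 in \<open>auto simp: max_def\<close>)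
  qed
qed

lemma has_field_derivative_bump_line:
  fixes x j :: "'a::euclidean_space"
  assumes "M \<ge> 2" and j: "norm j = 1"
  shows "((\<lambda>h. bump M (x + h *\<^sub>R j)) has_field_derivative
    - 2 * real M * (x \<bullet> j) * bump (M - 1) x) (at 0)"
proof -
  have eq: "1 - (norm (x + h *\<^sub>R j))\<^sup>2 = 1 - (norm x)\<^sup>2 - 2 * h * (x \<bullet> j) - h\<^sup>2" for h
    using j unfolding power2_norm_eq_inner norm_eq_1
    by (simp add: inner_left_distrib inner_right_distrib inner_commute power2_eq_square algebra_simps)
  have "((\<lambda>h. 1 - (norm x)\<^sup>2 - 2 * h * (x \<bullet> j) - h\<^sup>2) has_field_derivative (- 2 * (x \<bullet> j))) (at 0)"
    by (auto intro!: derivative_eq_intros)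
  from DERIV_chain2[OF has_field_derivative_max_0_power[OF assms(1)] this]
  show ?thesis
    unfolding bump_def eq by (simp add: mult_ac)
qed

text \<open>A bump differentiated along \<open>j\<close> acquires a factor x . j. Admitting
  monomials makes the family closed under this derivative, as an induction on the decay
  requires.\<close>

definition mon_bump :: "'a::euclidean_space \<Rightarrow> nat \<Rightarrow> nat \<Rightarrow> 'a \<Rightarrow> complex" where
  "mon_bump j a M x = complex_of_real ((x \<bullet> j) ^ a * bump M x)"

lemma continuous_mon_bump: "continuous_on UNIV (mon_bump j a M)"
  unfolding mon_bump_def by (intro continuous_intros)

lemma mon_bump_eq_0: "norm x > 1 \<Longrightarrow> M > 0 \<Longrightarrow> mon_bump j a M x = 0"
  by (simp add: mon_bump_def bump_eq_0)

lemma integrable_mon_bump: "M > 0 \<Longrightarrow> integrable lborel (mon_bump j a M)"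
  by (intro integrable_compact_support continuous_mon_bump mon_bump_eq_0)

text \<open>This is the vanishing integral of the derivative along \<open>j\<close> of
  \<open>cis (x \<bullet> \<xi>) * mon_bump j a M \<xi>\<close>. The condition M >= 2 keeps
  \<open>M - 1\<close> positive, so that the derivative is still continuous with compact support.
  For a = 0 the truncated \<open>a - 1\<close> is harmless, its coefficient being 0.\<close>

lemma ft_mon_bump_rec:
  fixes j :: "'a::euclidean_space"
  assumes M: "M \<ge> 2" and j: "norm j = 1"
  shows "\<i> * (x \<bullet> j) * ft (mon_bump j a M) x
    = 2 * real M * ft (mon_bump j (Suc a) (M - 1)) x - real a * ft (mon_bump j (a - 1) M) x"
proof -
  define u where "u \<xi> = cis (x \<bullet> \<xi>) * mon_bump j a M \<xi>" for \<xi>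
  define u' where "u' \<xi> = \<i> * (x \<bullet> j) * (cis (x \<bullet> \<xi>) * mon_bump j a M \<xi>)
     + real a * (cis (x \<bullet> \<xi>) * mon_bump j (a - 1) M \<xi>)
     - 2 * real M * (cis (x \<bullet> \<xi>) * mon_bump j (Suc a) (M - 1) \<xi>)" for \<xi>
  have M': "M > 0" "M - 1 > 0" using M by auto
  have "(LINT \<xi>|lborel. u' \<xi>) = 0"
  proof (rule integral_directional_derivative_eq_0[OF _ _ _ _ _ j])
    show "continuous_on UNIV u" "continuous_on UNIV u'"
      unfolding u_def u'_def cis_conv_exp
      by (intro continuous_intros continuous_on_compose2[OF continuous_mon_bump]; simp)+
    show "u y = 0" "u' y = 0" if "norm y > 1" for y
      using that M' by (simp_all add: u_def u'_def mon_bump_eq_0)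
    fix y
    have d1: "((\<lambda>h. cis (x \<bullet> (y + h *\<^sub>R j))) has_vector_derivative (x \<bullet> j) *\<^sub>R (\<i> * cis (x \<bullet> y))) (at 0)"
      using has_vector_derivative_cis_affine[of "x \<bullet> y" "x \<bullet> j"]
      by (simp add: inner_right_distrib scaleR_conv_of_real mult_ac)
    have d2: "((\<lambda>h. ((y + h *\<^sub>R j) \<bullet> j) ^ a * bump M (y + h *\<^sub>R j)) has_field_derivative
       (real a * (y \<bullet> j) ^ (a - 1) * bump M y - 2 * real M * (y \<bullet> j) * (y \<bullet> j) ^ a * bump (M - 1) y)) (at 0)"
      using j by (auto intro!: derivative_eq_intros has_field_derivative_bump_line[OF M j]
        simp: inner_left_distrib norm_eq_1)
    have "((\<lambda>h. mon_bump j a M (y + h *\<^sub>R j)) has_vector_derivative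
        (real a * mon_bump j (a - 1) M y - 2 * real M * mon_bump j (Suc a) (M - 1) y)) (at 0)"
      using has_vector_derivative_of_real[OF d2, where ?'a = complex]
      unfolding mon_bump_def by (simp add: mult_ac)
    from has_vector_derivative_mult[OF d1 this]
    show "((\<lambda>h. u (y + h *\<^sub>R j)) has_vector_derivative u' y) (at 0)"
      unfolding u_def u'_def by (simp add: algebra_simps scaleR_conv_of_real)
  qed
  moreover have "(LINT \<xi>|lborel. u' \<xi>) = \<i> * (x \<bullet> j) * ft (mon_bump j a M) x
     + real a * ft (mon_bump j (a - 1) M) x - 2 * real M * ft (mon_bump j (Suc a) (M - 1)) x"
  proof -
    have i: "integrable lborel (\<lambda>\<xi>. c * (cis (x \<bullet> \<xi>) * mon_bump j b N \<xi>))" if "N > 0" for c b N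
      by (intro integrable_mult_right integrable_cis_mult integrable_mon_bump that)
    show ?thesis
      unfolding u'_def ft_def
      by (subst Bochner_Integration.integral_diff Bochner_Integration.integral_add,
          intro Bochner_Integration.integrable_add i M', intro i M')+ simp
  qed
  ultimately show ?thesis by (simp add: algebra_simps)
qed

text \<open>Each factor x . j is paid for with one unit of \<open>M\<close> through the recursion,
  which also changes \<open>a\<close>; the induction therefore runs over all \<open>a\<close> and
  \<open>M\<close>.\<close>

lemma ft_mon_bump_decay:
  fixes j :: "'a::euclidean_space"
  assumes j: "norm j = 1" and "M \<ge> k + 1"
  shows "\<exists>C. \<forall>x. \<bar>x \<bullet> j\<bar> ^ k * norm (ft (mon_bump j a M) x) \<le> C"
  using assms(2)
proof (induction k arbitrary: a M)
  case 0
  then show ?case using norm_ft_le[of "mon_bump j a M"] by auto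
next
  case (Suc k)
  have M: "k + 1 \<le> M - 1" "k + 1 \<le> M" using Suc.prems by auto
  obtain C1 where C1: "\<And>x. \<bar>x \<bullet> j\<bar> ^ k * norm (ft (mon_bump j (Suc a) (M - 1)) x) \<le> C1"
    using Suc.IH[OF M(1), of "Suc a"] by blast
  obtain C2 where C2: "\<And>x. \<bar>x \<bullet> j\<bar> ^ k * norm (ft (mon_bump j (a - 1) M) x) \<le> C2"
    using Suc.IH[OF M(2), of "a - 1"] by blast
  have "\<bar>x \<bullet> j\<bar> ^ Suc k * norm (ft (mon_bump j a M) x) \<le> 2 * real M * C1 + real a * C2" for x
  proof -
    have "\<bar>x \<bullet> j\<bar> ^ Suc k * norm (ft (mon_bump j a M) x)
        = \<bar>x \<bullet> j\<bar> ^ k * norm (\<i> * (x \<bullet> j) * ft (mon_bump j a M) x)"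
      by (simp add: norm_mult)
    also have "\<dots> \<le> \<bar>x \<bullet> j\<bar> ^ k * (2 * real M * norm (ft (mon_bump j (Suc a) (M - 1)) x)
        + real a * norm (ft (mon_bump j (a - 1) M) x))"
      using Suc.prems j
      by (subst ft_mon_bump_rec)
        (auto intro!: mult_left_mono norm_triangle_le_diff simp: norm_mult)
    also have "\<dots> = 2 * real M * (\<bar>x \<bullet> j\<bar> ^ k * norm (ft (mon_bump j (Suc a) (M - 1)) x))
        + real a * (\<bar>x \<bullet> j\<bar> ^ k * norm (ft (mon_bump j (a - 1) M) x))"
      by (simp add: algebra_simps)
    also have "\<dots> \<le> 2 * real M * C1 + real a * C2"
      using C1 C2 by (intro add_mono mult_left_mono) auto
    finally show ?thesis .
  qed
  then show ?case by blast
qed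

lemma norm_power_le_sum_Basis:
  fixes x :: "'a::euclidean_space"
  shows "(norm x) ^ k \<le> real (DIM('a)) ^ k * (\<Sum>j\<in>Basis. \<bar>x \<bullet> j\<bar> ^ k)"
proof -
  define m where "m = Max ((\<lambda>j. \<bar>x \<bullet> j\<bar>) ` Basis)"
  have m: "\<bar>x \<bullet> j\<bar> \<le> m" if "j \<in> Basis" for j
    unfolding m_def using that by (intro Max_ge) auto
  obtain j where j: "j \<in> Basis" "m = \<bar>x \<bullet> j\<bar>"
  proof -
    have "m \<in> (\<lambda>j. \<bar>x \<bullet> j\<bar>) ` Basis"
      unfolding m_def by (rule Max_in) auto
    then show thesis using that by blast
  qed
  have "norm x \<le> (\<Sum>j\<in>Basis. \<bar>x \<bullet> j\<bar>)" by (rule norm_le_l1)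
  also have "\<dots> \<le> real (DIM('a)) * m" using sum_bounded_above[of Basis "\<lambda>j. \<bar>x \<bullet> j\<bar>" m] m by auto
  finally have "(norm x) ^ k \<le> (real (DIM('a)) * m) ^ k"
    by (rule power_mono) simp
  also have "\<dots> = real (DIM('a)) ^ k * \<bar>x \<bullet> j\<bar> ^ k" using j by (simp add: power_mult_distrib)
  also have "\<dots> \<le> real (DIM('a)) ^ k * (\<Sum>j\<in>Basis. \<bar>x \<bullet> j\<bar> ^ k)"
    using j by (intro mult_left_mono member_le_sum) auto
  finally show ?thesis .
qed

text \<open>The majorant (1 + |x|^2)^(-n) requires decay of order 2n;
  \<open>ft_mon_bump_decay\<close> supplies it in each coordinate direction when M >= 2n + 1, and
  boundedness covers the region near the origin.\<close>

lemma integrable_ft_bump: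
  assumes "M \<ge> 2 * DIM('a::euclidean_space) + 1"
  shows "integrable lborel (ft (\<lambda>x::'a. complex_of_real (bump M x)))"
proof -
  let ?f = "\<lambda>x::'a. complex_of_real (bump M x)" and ?n = "DIM('a)"
  have f: "?f = mon_bump j 0 M" for j by (simp add: mon_bump_def fun_eq_iff)
  have "\<exists>C. \<forall>x. \<bar>x \<bullet> j\<bar> ^ (2 * ?n) * norm (ft ?f x) \<le> C" if "j \<in> Basis" for j :: 'a
    using ft_mon_bump_decay[of j "2 * ?n" M 0] assms that f[of j] by simp
  then obtain C where C: "\<And>j x. j \<in> Basis \<Longrightarrow> \<bar>x \<bullet> j\<bar> ^ (2 * ?n) * norm (ft ?f x) \<le> C j"
    by metis
  define C0 where "C0 = (LINT \<xi>|lborel. norm (?f \<xi>))"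
  have C0: "norm (ft ?f x) \<le> C0" for x unfolding C0_def by (rule norm_ft_le)
  define D where "D = 2 ^ ?n * (C0 + real ?n ^ (2 * ?n) * (\<Sum>j\<in>(Basis::'a set). C j))"
  have bound: "norm (ft ?f x) \<le> D * inverse ((1 + (norm x)\<^sup>2) ^ ?n)" for x
  proof -
    have "(1 + (norm x)\<^sup>2) ^ ?n \<le> (2 * max 1 ((norm x)\<^sup>2)) ^ ?n"
      by (intro power_mono) auto
    also have "\<dots> = 2 ^ ?n * max 1 ((norm x)\<^sup>2) ^ ?n"
      by (simp add: power_mult_distrib)
    also have "\<dots> \<le> 2 ^ ?n * (1 + (norm x) ^ (2 * ?n))"
      by (intro mult_left_mono) (auto simp: max_def power_mult)
    finally have "(1 + (norm x)\<^sup>2) ^ ?n * norm (ft ?f x)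
        \<le> 2 ^ ?n * (1 + (norm x) ^ (2 * ?n)) * norm (ft ?f x)"
      by (rule mult_right_mono) simp
    also have "\<dots> = 2 ^ ?n * (norm (ft ?f x) + (norm x) ^ (2 * ?n) * norm (ft ?f x))"
      by (simp add: algebra_simps)
    also have "\<dots> \<le> 2 ^ ?n * (C0 + real ?n ^ (2 * ?n) * (\<Sum>j\<in>Basis. \<bar>x \<bullet> j\<bar> ^ (2 * ?n)) * norm (ft ?f x))"
      using C0 by (intro mult_left_mono add_mono mult_right_mono norm_power_le_sum_Basis) auto
    also have "\<dots> = 2 ^ ?n * (C0 + real ?n ^ (2 * ?n) * (\<Sum>j\<in>Basis. \<bar>x \<bullet> j\<bar> ^ (2 * ?n) * norm (ft ?f x)))"
      by (simp add: sum_distrib_right mult.assoc)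
    also have "\<dots> \<le> D"
      unfolding D_def using C by (intro mult_left_mono add_mono sum_mono order_refl) auto
    finally have "norm (ft ?f x) \<le> D / (1 + (norm x)\<^sup>2) ^ ?n"
      by (subst pos_le_divide_eq) (auto simp: add_pos_nonneg mult.commute)
    then show ?thesis by (simp add: divide_inverse)
  qed
  show ?thesis
  proof (rule Bochner_Integration.integrable_bound)
    show "integrable lborel (\<lambda>x::'a. D * inverse ((1 + (norm x)\<^sup>2) ^ ?n))"
      by (intro integrable_mult_right integrable_polynomial_weight)
    show "AE x in lborel. norm (ft ?f x) \<le> norm (D * inverse ((1 + (norm x)\<^sup>2) ^ ?n))"
      using bound by (intro AE_I2) (metis abs_ge_self order_trans real_norm_def)
  qed measurable
qed

subsection \<open>Fourier inversion and superpositions of bumps\<close>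

lemma integrable_lborel_pair:
  fixes f :: "'a::euclidean_space \<Rightarrow> 'b::euclidean_space \<Rightarrow> complex"
  assumes [measurable]: "case_prod f \<in> borel_measurable (borel \<Otimes>\<^sub>M borel)"
    and fin: "(\<integral>\<^sup>+x. \<integral>\<^sup>+y. norm (f x y) \<partial>lborel \<partial>lborel) < \<infinity>"
  shows "integrable (lborel \<Otimes>\<^sub>M lborel) (case_prod f)"
proof (rule integrableI_bounded)
  have [measurable]: "case_prod f \<in> borel_measurable (lborel \<Otimes>\<^sub>M lborel)"
    using assms(1) by (simp cong: measurable_cong_sets sets_pair_measure_cong)
  then show "case_prod f \<in> borel_measurable (lborel \<Otimes>\<^sub>M lborel)" .
  have "(\<integral>\<^sup>+z. ennreal (norm (case_prod f z)) \<partial>(lborel \<Otimes>\<^sub>M lborel))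
      = (\<integral>\<^sup>+x. \<integral>\<^sup>+y. norm (f x y) \<partial>lborel \<partial>lborel)"
    by (subst lborel.nn_integral_fst[symmetric]) auto
  with fin show "(\<integral>\<^sup>+z. ennreal (norm (case_prod f z)) \<partial>(lborel \<Otimes>\<^sub>M lborel)) < \<infinity>"
    by simp
qed

lemma lborel_Fubini_swap:
  fixes f :: "'a::euclidean_space \<Rightarrow> 'b::euclidean_space \<Rightarrow> complex"
  assumes "case_prod f \<in> borel_measurable (borel \<Otimes>\<^sub>M borel)"
    and "(\<integral>\<^sup>+x. \<integral>\<^sup>+y. norm (f x y) \<partial>lborel \<partial>lborel) < \<infinity>"
  shows "(LINT x|lborel. LINT y|lborel. f x y) = (LINT y|lborel. LINT x|lborel. f x y)"
  by (rule lborel_pair.Fubini_integral[symmetric, OF integrable_lborel_pair[OF assms]])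

lemma nn_integral_norm_finite:
  fixes f :: "'a \<Rightarrow> 'b::{banach, second_countable_topology}"
  shows "integrable M f \<Longrightarrow> (\<integral>\<^sup>+x. ennreal (norm (f x)) \<partial>M) < \<infinity>"
  unfolding integrable_iff_bounded by blast

lemma norm_integral_le_nn_integral:
  fixes f :: "'a \<Rightarrow> 'b::{banach, second_countable_topology}"
  shows "ennreal (norm (integral\<^sup>L M f)) \<le> (\<integral>\<^sup>+x. norm (f x) \<partial>M)"
  by (cases "integrable M f") (auto simp: integral_norm_bound_ennreal not_integrable_integral_eq)

lemma ft_dilation:
  fixes f :: "'a::euclidean_space \<Rightarrow> complex"
  assumes [measurable]: "f \<in> borel_measurable borel" and c: "c > 0"
  shows "ft (\<lambda>\<xi>. f (\<xi> /\<^sub>R c)) x = (c ^ DIM('a)) *\<^sub>R ft f (c *\<^sub>R x)"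
  unfolding ft_def
  by (subst integral_lborel_affine[of _ c 0]) (use c in \<open>auto simp: inner_commute\<close>)

lemma integrable_bump: "M > 0 \<Longrightarrow> integrable lborel (\<lambda>x::'a::euclidean_space. complex_of_real (bump M x))"
  by (rule integrable_compact_support) (auto simp: bump_eq_0 intro!: continuous_intros)

text \<open>The constant is \<open>(2 * pi) ^ DIM('a)\<close>, but nothing below depends on its value; leaving it
  unspecified makes it unnecessary to evaluate any Fourier transform explicitly.\<close>

lemma ft_inversion_up_to_constant:
  obtains c :: complex where
    "\<And>h x. continuous_on UNIV h \<Longrightarrow> bounded (range h) \<Longrightarrow> integrable lborel h \<Longrightarrow>
      integrable lborel (ft h) \<Longrightarrow> ft (ft h) (- x :: 'a::euclidean_space) = c * h x"
proof -
  define M where "M = 2 * DIM('a) + 1"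
  \<comment> \<open>The bump takes the place of the usual Gaussian: \<open>B 0 = 1\<close> makes the
    cut-off disappear in the limit, and since \<open>ft B\<close> is integrable its dilates form an
    approximate identity of total mass \<open>c\<close>.\<close>
  define B where "B x = complex_of_real (bump M x)" for x :: 'a
  have [measurable]: "B \<in> borel_measurable borel"
    unfolding B_def by measurable
  have iB: "integrable lborel B" and iftB: "integrable lborel (ft B)"
    unfolding B_def by (auto simp: M_def intro!: integrable_bump integrable_ft_bump)
  have B1: "norm (B x) \<le> 1" for x
    by (simp add: B_def bump_nonneg bump_le_1)
  define c where "c = (LINT u|lborel. ft B u)"
  have "ft (ft h) (- \<xi>) = c * h \<xi>"
    if ch: "continuous_on UNIV h" and bh: "bounded (range h)" and ih: "integrable lborel h"
      and ift: "integrable lborel (ft h)" for h and \<xi> :: 'a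
  proof -
    have [measurable]: "h \<in> borel_measurable borel"
      using ih by auto
    obtain K where K: "\<And>x. norm (h x) \<le> K"
      using bh by (auto simp: bounded_iff)
    define e :: "nat \<Rightarrow> real" where "e k = inverse (Suc k)" for k
    have e: "e k > 0" for k by (auto simp: e_def)
    have e0: "e \<longlonglongrightarrow> 0" unfolding e_def by (rule LIMSEQ_inverse_real_of_nat)
    \<comment> \<open>The limit of \<open>I\<close> is computed twice: directly it is the double
      transform, and after Fubini it is the limit of averages of \<open>h\<close> around \<xi> with
      weight \<open>ft B\<close>.\<close>
    define I where "I k = (LINT x|lborel. cis (- \<xi> \<bullet> x) * ft h x * B (e k *\<^sub>R x))" for k
    have "I \<longlonglongrightarrow> ft (ft h) (- \<xi>)"
      unfolding I_def ft_def[of "ft h"]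
    proof (rule integral_dominated_convergence[where w = "\<lambda>x. norm (ft h x)"])
      show "AE x in lborel. (\<lambda>k. cis (- \<xi> \<bullet> x) * ft h x * B (e k *\<^sub>R x)) \<longlonglongrightarrow> cis (- \<xi> \<bullet> x) * ft h x"
      proof (rule AE_I2)
        fix x
        have "isCont B 0"
        proof -
          have "continuous_on UNIV B"
            unfolding B_def by (intro continuous_intros)
          then show ?thesis
            by (simp add: continuous_on_eq_continuous_at)
        qed
        then have "(\<lambda>k. B (e k *\<^sub>R x)) \<longlonglongrightarrow> B 0"
          by (rule isCont_tendsto_compose) (use e0 in \<open>auto intro!: tendsto_eq_intros\<close>)
        from tendsto_mult[OF tendsto_const this, of "cis (- \<xi> \<bullet> x) * ft h x"]
        show "(\<lambda>k. cis (- \<xi> \<bullet> x) * ft h x * B (e k *\<^sub>R x)) \<longlonglongrightarrow> cis (- \<xi> \<bullet> x) * ft h x"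
          by (simp add: B_def)
      qed
      show "AE x in lborel. norm (cis (- \<xi> \<bullet> x) * ft h x * B (e k *\<^sub>R x)) \<le> norm (ft h x)" for k
        using B1 by (auto simp: norm_mult mult_left_le)
    qed (use ift in auto)
    moreover have "I \<longlonglongrightarrow> c * h \<xi>"
    proof -
      have Ieq: "I k = (LINT u|lborel. ft B u * h (\<xi> + e k *\<^sub>R u))" for k
      proof -
        \<comment> \<open>The cut-off is what makes this jointly integrable; without it the modulus
          would not depend on x.\<close>
        define G where "G x \<eta> = cis ((\<eta> - \<xi>) \<bullet> x) * h \<eta> * B (e k *\<^sub>R x)" for x \<eta>
        have Gm: "case_prod G \<in> borel_measurable (borel \<Otimes>\<^sub>M borel)"
          unfolding G_def by measurable
        have "I k = (LINT x|lborel. LINT \<eta>|lborel. G x \<eta>)"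
          unfolding I_def
        proof (rule Bochner_Integration.integral_cong[OF refl])
          fix x
          have "G x \<eta> = cis (- \<xi> \<bullet> x) * B (e k *\<^sub>R x) * (cis (x \<bullet> \<eta>) * h \<eta>)" for \<eta>
          proof -
            have "cis ((\<eta> - \<xi>) \<bullet> x) = cis (- \<xi> \<bullet> x) * cis (x \<bullet> \<eta>)"
              by (simp add: cis_mult inner_diff_left inner_commute[of x \<eta>])
            then show ?thesis by (simp add: G_def mult_ac)
          qed
          then have "(LINT \<eta>|lborel. G x \<eta>)
              = cis (- \<xi> \<bullet> x) * B (e k *\<^sub>R x) * (LINT \<eta>|lborel. cis (x \<bullet> \<eta>) * h \<eta>)"
            by (simp only: integral_mult_right_zero)
          then show "cis (- \<xi> \<bullet> x) * ft h x * B (e k *\<^sub>R x) = (LINT \<eta>|lborel. G x \<eta>)"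
            unfolding ft_def by (simp only: mult_ac)
        qed
        also have "\<dots> = (LINT \<eta>|lborel. LINT x|lborel. G x \<eta>)"
        proof (rule lborel_Fubini_swap[OF Gm])
          have iBe: "integrable lborel (\<lambda>x. B (e k *\<^sub>R x))"
            using integrable_lborel_affine[of B "e k" 0] e[of k] iB by simp
          have "(\<integral>\<^sup>+x. \<integral>\<^sup>+\<eta>. norm (G x \<eta>) \<partial>lborel \<partial>lborel)
              = (\<integral>\<^sup>+x. norm (B (e k *\<^sub>R x)) * (\<integral>\<^sup>+\<eta>. norm (h \<eta>) \<partial>lborel) \<partial>lborel)"
            by (subst nn_integral_cmult[symmetric]) (auto simp: G_def norm_mult ennreal_mult mult_ac)
          also have "\<dots> = (\<integral>\<^sup>+x. norm (B (e k *\<^sub>R x)) \<partial>lborel) * (\<integral>\<^sup>+\<eta>. norm (h \<eta>) \<partial>lborel)"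
            by (subst nn_integral_multc) auto
          also have "\<dots> < \<infinity>"
            using nn_integral_norm_finite[OF iBe] nn_integral_norm_finite[OF ih]
            by (simp add: ennreal_mult_less_top)
          finally show "(\<integral>\<^sup>+x. \<integral>\<^sup>+\<eta>. norm (G x \<eta>) \<partial>lborel \<partial>lborel) < \<infinity>" .
        qed
        also have "\<dots> = (LINT \<eta>|lborel. ft (\<lambda>x. B (x /\<^sub>R inverse (e k))) (\<eta> - \<xi>) * h \<eta>)"
        proof (rule Bochner_Integration.integral_cong[OF refl])
          fix \<eta>
          have "(LINT x|lborel. G x \<eta>) = (LINT x|lborel. h \<eta> * (cis ((\<eta> - \<xi>) \<bullet> x) * B (e k *\<^sub>R x)))"
            by (rule Bochner_Integration.integral_cong[OF refl]) (simp add: G_def)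
          then show "(LINT x|lborel. G x \<eta>) = ft (\<lambda>x. B (x /\<^sub>R inverse (e k))) (\<eta> - \<xi>) * h \<eta>"
            by (simp add: ft_def)
        qed
        also have "\<dots> = (LINT \<eta>|lborel. (inverse (e k) ^ DIM('a)) *\<^sub>R (ft B (inverse (e k) *\<^sub>R (\<eta> - \<xi>)) * h \<eta>))"
          by (subst ft_dilation) (use e in auto)
        also have "\<dots> = (LINT u|lborel. ft B u * h (\<xi> + e k *\<^sub>R u))"
          using e[of k] by (subst integral_lborel_affine[of _ "e k" \<xi>]) (auto simp: power_inverse)
        finally show ?thesis .
      qed
      have "(\<lambda>k. LINT u|lborel. ft B u * h (\<xi> + e k *\<^sub>R u)) \<longlonglongrightarrow> (LINT u|lborel. ft B u * h \<xi>)"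
      proof (rule integral_dominated_convergence[where w = "\<lambda>u. K * norm (ft B u)"])
        show "integrable lborel (\<lambda>u. K * norm (ft B u))"
          using iftB by auto
        show "AE u in lborel. (\<lambda>k. ft B u * h (\<xi> + e k *\<^sub>R u)) \<longlonglongrightarrow> ft B u * h \<xi>"
        proof (intro AE_I2 tendsto_mult tendsto_const)
          fix u
          have "isCont h \<xi>" using ch by (simp add: continuous_on_eq_continuous_at)
          then show "(\<lambda>k. h (\<xi> + e k *\<^sub>R u)) \<longlonglongrightarrow> h \<xi>"
            by (rule isCont_tendsto_compose) (use e0 in \<open>auto intro!: tendsto_eq_intros\<close>)
        qed
        show "AE u in lborel. norm (ft B u * h (\<xi> + e k *\<^sub>R u)) \<le> K * norm (ft B u)" for k
          using K by (auto simp: norm_mult mult.commute[of K] intro!: mult_left_mono)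
      qed measurable
      then show ?thesis
        by (simp add: Ieq[abs_def] c_def)
    qed
    ultimately show ?thesis
      by (rule LIMSEQ_unique)
  qed
  then show thesis by (rule that)
qed

text \<open>The two integrability conditions serve two exchanges of integrals. Transforming under
  the integral sign involves the bumps themselves, whose L^1 norms grow like (sqrt R)^n, hence
  \<open>w'\<close>. The final bound involves their transforms, whose L^1 norms do not depend on R,
  hence \<open>w\<close>. By \<open>w0\<close> only R > 0 counts, where scaling by
  \<open>sqrt R\<close> is a dilation.\<close>

lemma integrable_ft_superposition:
  fixes m :: "'a::euclidean_space \<Rightarrow> complex" and w :: "real \<Rightarrow> real"
  assumes M: "M \<ge> 2 * DIM('a) + 1"
    and m: "AE \<xi> in lborel. m \<xi> = (LINT R|lborel. complex_of_real (w R * bump M (\<xi> /\<^sub>R sqrt R)))"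
    and [measurable]: "m \<in> borel_measurable borel"
    and w0: "\<And>R. R \<le> 0 \<Longrightarrow> w R = 0"
    and w: "integrable lborel w" and w': "integrable lborel (\<lambda>R. sqrt R ^ DIM('a) * w R)"
  shows "integrable lborel (ft m)"
proof -
  define B where "B x = complex_of_real (bump M x)" for x :: 'a
  have [measurable]: "B \<in> borel_measurable borel" "w \<in> borel_measurable borel"
    unfolding B_def using w by auto
  have iB: "integrable lborel B" and iftB: "integrable lborel (ft B)"
    unfolding B_def using M by (auto intro!: integrable_bump integrable_ft_bump)
  define c where "c = (\<integral>\<^sup>+x. norm (B x) \<partial>lborel)"
  define d where "d = (\<integral>\<^sup>+x. norm (ft B x) \<partial>lborel)"
  have c: "c < \<infinity>" and d: "d < \<infinity>"
    unfolding c_def d_def by (rule nn_integral_norm_finite[OF iB], rule nn_integral_norm_finite[OF iftB])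
  have ft_m: "ft m x = (LINT R|lborel. (w R * sqrt R ^ DIM('a)) *\<^sub>R ft B (sqrt R *\<^sub>R x))" for x
  proof -
    define G where "G R \<xi> = cis (x \<bullet> \<xi>) * (w R *\<^sub>R B (\<xi> /\<^sub>R sqrt R))" for R and \<xi> :: 'a
    have Gm: "case_prod G \<in> borel_measurable (borel \<Otimes>\<^sub>M borel)"
      unfolding G_def by measurable
    have "ft m x = (LINT \<xi>|lborel. LINT R|lborel. G R \<xi>)"
      unfolding ft_def
    proof (rule integral_cong_AE)
      have "(\<lambda>(\<xi>, R). G R \<xi>) \<in> borel_measurable (borel \<Otimes>\<^sub>M lborel)"
        unfolding G_def by measurable
      from lborel.borel_measurable_lebesgue_integral[OF this]
      show "(\<lambda>\<xi>. LINT R|lborel. G R \<xi>) \<in> borel_measurable lborel" by simp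
      show "AE \<xi> in lborel. cis (x \<bullet> \<xi>) * m \<xi> = (LINT R|lborel. G R \<xi>)"
        using m by eventually_elim (simp add: G_def B_def scaleR_conv_of_real)
    qed measurable
    also have "\<dots> = (LINT R|lborel. LINT \<xi>|lborel. G R \<xi>)"
    proof (rule lborel_Fubini_swap[OF Gm, symmetric])
      have "(\<integral>\<^sup>+\<xi>. norm (G R \<xi>) \<partial>lborel) = ennreal (norm (sqrt R ^ DIM('a) * w R)) * c" for R
      proof (cases "R > 0")
        case True
        have "(\<integral>\<^sup>+\<xi>. norm (G R \<xi>) \<partial>lborel)
            = ennreal \<bar>w R\<bar> * (\<integral>\<^sup>+\<xi>. norm (B (\<xi> /\<^sub>R sqrt R)) \<partial>lborel)"
          by (subst nn_integral_cmult[symmetric]) (auto simp: G_def norm_mult ennreal_mult)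
        also have "(\<integral>\<^sup>+\<xi>. norm (B (\<xi> /\<^sub>R sqrt R)) \<partial>lborel) = ennreal (sqrt R ^ DIM('a)) * c"
          using True unfolding c_def by (subst nn_integral_lborel_affine[of _ "sqrt R" 0]) auto
        finally show ?thesis
          using True by (simp add: ennreal_mult abs_mult mult_ac)
      qed (simp add: w0 G_def)
      then have "(\<integral>\<^sup>+R. \<integral>\<^sup>+\<xi>. norm (G R \<xi>) \<partial>lborel \<partial>lborel)
          = (\<integral>\<^sup>+R. norm (sqrt R ^ DIM('a) * w R) \<partial>lborel) * c"
        by (simp add: nn_integral_multc)
      also have "\<dots> < \<infinity>"
        using nn_integral_norm_finite[OF w'] c by (simp add: ennreal_mult_less_top)
      finally show "(\<integral>\<^sup>+R. \<integral>\<^sup>+\<xi>. norm (G R \<xi>) \<partial>lborel \<partial>lborel) < \<infinity>" .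
    qed
    also have "\<dots> = (LINT R|lborel. (w R * sqrt R ^ DIM('a)) *\<^sub>R ft B (sqrt R *\<^sub>R x))"
    proof (rule Bochner_Integration.integral_cong[OF refl])
      fix R
      show "(LINT \<xi>|lborel. G R \<xi>) = (w R * sqrt R ^ DIM('a)) *\<^sub>R ft B (sqrt R *\<^sub>R x)"
      proof (cases "R > 0")
        case True
        have "(LINT \<xi>|lborel. G R \<xi>) = w R *\<^sub>R ft (\<lambda>\<xi>. B (\<xi> /\<^sub>R sqrt R)) x"
          by (simp add: G_def ft_def scaleR_conv_of_real mult.left_commute)
        then show ?thesis using True by (simp add: ft_dilation)
      qed (simp add: w0 G_def)
    qed
    finally show ?thesis .
  qed
  show ?thesis
  proof (rule integrableI_bounded)
    have "(\<integral>\<^sup>+x. norm (ft m x) \<partial>lborel)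
        \<le> (\<integral>\<^sup>+x. \<integral>\<^sup>+R. norm ((w R * sqrt R ^ DIM('a)) *\<^sub>R ft B (sqrt R *\<^sub>R x)) \<partial>lborel \<partial>lborel)"
      unfolding ft_m by (intro nn_integral_mono norm_integral_le_nn_integral)
    also have "\<dots> = (\<integral>\<^sup>+R. \<integral>\<^sup>+x. norm ((w R * sqrt R ^ DIM('a)) *\<^sub>R ft B (sqrt R *\<^sub>R x)) \<partial>lborel \<partial>lborel)"
      by (rule lborel_pair.Fubini') measurable
    also have "\<dots> = (\<integral>\<^sup>+R. norm (w R) * d \<partial>lborel)"
    proof (rule nn_integral_cong)
      fix R
      show "(\<integral>\<^sup>+x. norm ((w R * sqrt R ^ DIM('a)) *\<^sub>R ft B (sqrt R *\<^sub>R x)) \<partial>lborel) = norm (w R) * d"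
      proof (cases "R > 0")
        case True
        have "(\<integral>\<^sup>+x. norm ((w R * sqrt R ^ DIM('a)) *\<^sub>R ft B (sqrt R *\<^sub>R x)) \<partial>lborel)
          = ennreal (norm (w R)) * (ennreal (sqrt R ^ DIM('a)) * (\<integral>\<^sup>+x. norm (ft B (sqrt R *\<^sub>R x)) \<partial>lborel))"
          using True
          by (simp add: abs_mult ennreal_mult nn_integral_cmult mult_ac)
        also have "ennreal (sqrt R ^ DIM('a)) * (\<integral>\<^sup>+x. norm (ft B (sqrt R *\<^sub>R x)) \<partial>lborel) = d"
          using True unfolding d_def
          by (subst (2) nn_integral_lborel_affine[of _ "sqrt R" 0]) auto
        finally show ?thesis .
      qed (simp add: w0)
    qed
    also have "\<dots> = (\<integral>\<^sup>+R. norm (w R) \<partial>lborel) * d"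
      by (simp add: nn_integral_multc)
    also have "\<dots> < \<infinity>"
      using nn_integral_norm_finite[OF w] d by (simp add: ennreal_mult_less_top)
    finally show "(\<integral>\<^sup>+x. norm (ft m x) \<partial>lborel) < \<infinity>" .
  qed measurable
qed

subsection \<open>Integrable kernels of radial symbols\<close>

definition powr_exp :: "real \<Rightarrow> real \<Rightarrow> real \<Rightarrow> real" where
  "powr_exp \<alpha> b s = s powr b * exp (- (s powr \<alpha>))"

lemma borel_measurable_powr_exp [measurable]: "powr_exp \<alpha> b \<in> borel_measurable borel"
  unfolding powr_exp_def by measurable

lemma powr_exp_nonneg: "0 \<le> powr_exp \<alpha> b s"
  by (simp add: powr_exp_def)

lemma powr_mult_powr_exp: "s > 0 \<Longrightarrow> s powr v * powr_exp \<alpha> b s = powr_exp \<alpha> (v + b) s"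
  by (simp add: powr_exp_def powr_add)

lemma has_field_derivative_powr_exp:
  assumes "s > 0"
  shows "(powr_exp \<alpha> b has_field_derivative b * powr_exp \<alpha> (b - 1) s - \<alpha> * powr_exp \<alpha> (b + \<alpha> - 1) s) (at s)"
proof -
  have "(powr_exp \<alpha> b has_field_derivative
      b * s powr (b - 1) * exp (- (s powr \<alpha>)) + s powr b * (exp (- (s powr \<alpha>)) * (- (\<alpha> * s powr (\<alpha> - 1))))) (at s)"
    unfolding powr_exp_def using assms
    by (auto intro!: derivative_eq_intros simp: powr_diff field_simps)
  moreover have "s powr (b + \<alpha> - 1) = s powr b * s powr (\<alpha> - 1)"
    by (simp add: powr_add[symmetric] add_diff_eq)
  ultimately show ?thesis
    by (simp only: powr_exp_def[of \<alpha> "b - 1"] powr_exp_def[of \<alpha> "b + \<alpha> - 1"]) (simp add: mult_ac)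
qed

text \<open>A single term y^m / m! of the series of exp(y), y = s^\<alpha>, is enough once \<alpha>
  m >= b - c; this gives K = m!.\<close>

lemma powr_exp_le_powr:
  assumes "\<alpha> > 0"
  obtains K where "K > 0" "\<And>s. s \<ge> 1 \<Longrightarrow> powr_exp \<alpha> b s \<le> K * s powr c"
proof -
  obtain m :: nat where m: "b - c \<le> \<alpha> * real m"
    using assms real_arch_simple[of "(b - c) / \<alpha>"] by (auto simp: divide_le_eq mult.commute)
  have "powr_exp \<alpha> b s \<le> fact m * s powr c" if s: "s \<ge> 1" for s
  proof -
    define y where "y = s powr \<alpha>"
    have "y ^ m / fact m \<le> exp y"
    proof -
      have "(\<Sum>n\<in>{m}. y ^ n /\<^sub>R fact n) \<le> (\<Sum>n. y ^ n /\<^sub>R fact n)"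
        by (rule sum_le_suminf) (auto simp: y_def summable_exp)
      then show ?thesis by (simp add: exp_def divide_inverse mult.commute)
    qed
    moreover have "y ^ m = s powr (\<alpha> * real m)"
      unfolding y_def using s by (simp add: powr_powr[symmetric] powr_realpow)
    moreover have "s powr (b - c) \<le> s powr (\<alpha> * real m)"
      using s m by (intro powr_mono) auto
    ultimately have "s powr (b - c) \<le> fact m * exp y"
      by (simp add: divide_le_eq mult.commute)
    then have "s powr (b - c) * exp (- y) \<le> fact m"
      by (simp add: exp_minus field_simps)
    then have "s powr c * (s powr (b - c) * exp (- y)) \<le> s powr c * fact m"
      by (rule mult_left_mono) simp
    then show ?thesis
      using s by (simp add: powr_exp_def y_def mult.assoc[symmetric] powr_add[symmetric] mult.commute[of _ "fact m"])
  qed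
  then show thesis by (intro that[of "fact m"]) auto
qed

lemma integrable_of_has_integral:
  fixes f :: "real \<Rightarrow> real"
  assumes [measurable]: "f \<in> borel_measurable borel" "S \<in> sets borel"
    and "\<And>x. 0 \<le> f x" and "(f has_integral I) S"
  shows "integrable lborel (\<lambda>x. indicator S x * f x)"
proof (rule integrableI_nonneg)
  have "((\<lambda>x. indicator S x * f x) has_integral I) UNIV"
  proof -
    have "(\<lambda>x. indicator S x * f x) = (\<lambda>x. if x \<in> S then f x else 0)"
      by (auto simp: indicator_def)
    then show ?thesis
      using assms(4) by (simp only: has_integral_restrict_UNIV)
  qed
  then show "(\<integral>\<^sup>+x. ennreal (indicator S x * f x) \<partial>lborel) < \<infinity>"
    using assms by (subst nn_integral_has_integral_lborel) auto
qed (use assms in auto)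

lemma integrable_powr_exp:
  assumes \<alpha>: "\<alpha> > 0" and v: "v > -1"
  shows "integrable lborel (\<lambda>R. indicator {0<..} R * powr_exp \<alpha> v R)"
proof -
  obtain K where K: "K > 0" "\<And>s. s \<ge> 1 \<Longrightarrow> powr_exp \<alpha> v s \<le> K * s powr (-2)"
    using powr_exp_le_powr[OF \<alpha>] by blast
  show ?thesis
  proof (rule Bochner_Integration.integrable_bound)
    show "integrable lborel (\<lambda>R. indicator {0..1} R * R powr v + K * (indicator {1..} R * R powr (-2)))"
      using has_integral_powr_from_0[OF v, of 1] has_integral_powr_to_inf[of "-2" 1]
      by (intro Bochner_Integration.integrable_add integrable_mult_right integrable_of_has_integral) auto
    show "AE R in lborel. norm (indicator {0<..} R * powr_exp \<alpha> v R)
      \<le> norm (indicator {0..1} R * R powr v + K * (indicator {1..} R * R powr (-2)))"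
    proof (rule AE_I2)
      fix R :: real
      consider "R \<le> 0" | "0 < R" "R < 1" | "R = 1" | "R > 1" by linarith
      then show "norm (indicator {0<..} R * powr_exp \<alpha> v R)
        \<le> norm (indicator {0..1} R * R powr v + K * (indicator {1..} R * R powr (-2)))"
      proof cases
        case 2
        have "powr_exp \<alpha> v R \<le> R powr v * 1"
          unfolding powr_exp_def by (intro mult_left_mono) auto
        then show ?thesis using 2 by (simp add: powr_exp_nonneg)
      next
        case 3
        have "powr_exp \<alpha> v R \<le> 1" using 3 by (simp add: powr_exp_def)
        then show ?thesis using 3 K(1) by (simp add: powr_exp_nonneg)
      next
        case 4
        then show ?thesis using K(2)[of R] K(1) by (simp add: powr_exp_nonneg)
      qed (use K in \<open>simp_all add: powr_exp_def\<close>)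
    qed
  qed measurable
qed

text \<open>Away from the origin any exponent is allowed: on R > s the factor R^(-|v|) is at most
  s^(-|v|), and what remains has the exponent |v| + v >= 0.\<close>

lemma integrable_powr_exp_ray:
  assumes \<alpha>: "\<alpha> > 0" and s: "s > 0"
  shows "integrable lborel (\<lambda>R. indicator {s<..} R * powr_exp \<alpha> v R)"
proof (rule Bochner_Integration.integrable_bound)
  show "integrable lborel (\<lambda>R. s powr (- \<bar>v\<bar>) * (indicator {0<..} R * powr_exp \<alpha> (\<bar>v\<bar> + v) R))"
    using \<alpha> by (intro integrable_mult_right integrable_powr_exp) auto
  show "AE R in lborel. norm (indicator {s<..} R * powr_exp \<alpha> v R)
    \<le> norm (s powr (- \<bar>v\<bar>) * (indicator {0<..} R * powr_exp \<alpha> (\<bar>v\<bar> + v) R))"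
  proof (rule AE_I2)
    fix R
    show "norm (indicator {s<..} R * powr_exp \<alpha> v R)
      \<le> norm (s powr (- \<bar>v\<bar>) * (indicator {0<..} R * powr_exp \<alpha> (\<bar>v\<bar> + v) R))"
    proof (cases "R > s")
      case True
      have "powr_exp \<alpha> v R = R powr (- \<bar>v\<bar>) * powr_exp \<alpha> (\<bar>v\<bar> + v) R"
        using True s by (simp add: powr_mult_powr_exp)
      also have "\<dots> \<le> s powr (- \<bar>v\<bar>) * powr_exp \<alpha> (\<bar>v\<bar> + v) R"
        using True s by (intro mult_right_mono powr_mono2') (auto simp: powr_exp_nonneg)
      finally show ?thesis using True s by (simp add: powr_exp_nonneg)
    qed simp
  qed
qed measurable

section \<open>Derivatives of the profiles\<close>

text \<open>Repeated derivatives need no closed form if only their order at the origin is recorded: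
  \<open>d\<close> bounds the exponents from below and drops by 1 with each derivative. At infinity
  every member decays faster than any power.\<close>

inductive_set powr_exp_span :: "real \<Rightarrow> real \<Rightarrow> (real \<Rightarrow> real) set" for \<alpha> d where
  base: "d \<le> b \<Longrightarrow> powr_exp \<alpha> b \<in> powr_exp_span \<alpha> d"
| add: "f \<in> powr_exp_span \<alpha> d \<Longrightarrow> g \<in> powr_exp_span \<alpha> d \<Longrightarrow> (\<lambda>s. f s + g s) \<in> powr_exp_span \<alpha> d"
| scale: "f \<in> powr_exp_span \<alpha> d \<Longrightarrow> (\<lambda>s. c * f s) \<in> powr_exp_span \<alpha> d"

lemma borel_measurable_powr_exp_span: "f \<in> powr_exp_span \<alpha> d \<Longrightarrow> f \<in> borel_measurable borel"
  by (induction rule: powr_exp_span.induct) auto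

lemma deriv_powr_exp_span:
  assumes "f \<in> powr_exp_span \<alpha> d" and "\<alpha> > 0"
  shows "\<exists>f'\<in>powr_exp_span \<alpha> (d - 1). \<forall>s>0. (f has_field_derivative f' s) (at s)"
  using assms(1)
proof induction
  case (base b)
  have "powr_exp \<alpha> (b - 1) \<in> powr_exp_span \<alpha> (d - 1)" "powr_exp \<alpha> (b + \<alpha> - 1) \<in> powr_exp_span \<alpha> (d - 1)"
    using base assms(2) by (auto intro!: powr_exp_span.base)
  from powr_exp_span.add[OF powr_exp_span.scale[OF this(1), of b] powr_exp_span.scale[OF this(2), of "- \<alpha>"]]
  show ?case
    using has_field_derivative_powr_exp[of _ \<alpha> b] by (intro bexI) auto
next
  case (add f g)
  then obtain f' g' where "f' \<in> powr_exp_span \<alpha> (d - 1)" "g' \<in> powr_exp_span \<alpha> (d - 1)"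
    "\<forall>s>0. (f has_field_derivative f' s) (at s)" "\<forall>s>0. (g has_field_derivative g' s) (at s)"
    by blast
  then show ?case
    by (intro bexI[of _ "\<lambda>s. f' s + g' s"]) (auto intro: powr_exp_span.add DERIV_add)
next
  case (scale f c)
  then obtain f' where "f' \<in> powr_exp_span \<alpha> (d - 1)" "\<forall>s>0. (f has_field_derivative f' s) (at s)"
    by blast
  then show ?case
    by (intro bexI[of _ "\<lambda>s. c * f' s"]) (auto intro: powr_exp_span.scale DERIV_cmult)
qed

lemma isCont_powr_exp_span:
  "f \<in> powr_exp_span \<alpha> d \<Longrightarrow> \<alpha> > 0 \<Longrightarrow> s > 0 \<Longrightarrow> isCont f s"
  using deriv_powr_exp_span[of f \<alpha> d] DERIV_isCont by blast

lemma integrable_powr_exp_span: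
  assumes "f \<in> powr_exp_span \<alpha> d" and "\<alpha> > 0" and "v + d > -1"
  shows "integrable lborel (\<lambda>R. indicator {0<..} R * (R powr v * f R))"
  using assms(1)
proof induction
  case (base b)
  have "integrable lborel (\<lambda>R. indicator {0<..} R * powr_exp \<alpha> (v + b) R)"
    using base assms by (intro integrable_powr_exp) auto
  moreover have "indicator {0<..} R * (R powr v * powr_exp \<alpha> b R) = indicator {0<..} R * powr_exp \<alpha> (v + b) R"
    for R :: real by (cases "R > 0") (auto simp: powr_mult_powr_exp)
  ultimately show ?case by (simp only:)
next
  case (add f g)
  from Bochner_Integration.integrable_add[OF add.IH] show ?case
    by (simp add: distrib_left)
next
  case (scale f c)
  from integrable_mult_right[OF scale.IH, of c] show ?case
    by (simp add: mult_ac)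
qed

lemma integrable_powr_exp_span_ray:
  assumes "f \<in> powr_exp_span \<alpha> d" and "\<alpha> > 0" and "s > 0"
  shows "integrable lborel (\<lambda>R. indicator {s<..} R * (R powr v * f R))"
  using assms(1)
proof induction
  case (base b)
  have "integrable lborel (\<lambda>R. indicator {s<..} R * powr_exp \<alpha> (v + b) R)"
    using assms by (intro integrable_powr_exp_ray) auto
  moreover have "indicator {s<..} R * (R powr v * powr_exp \<alpha> b R) = indicator {s<..} R * powr_exp \<alpha> (v + b) R"
    for R :: real using assms(3) by (cases "R > s") (auto simp: powr_mult_powr_exp)
  ultimately show ?case by (simp only:)
next
  case (add f g)
  from Bochner_Integration.integrable_add[OF add.IH] show ?case
    by (simp add: distrib_left)
next
  case (scale f c)
  from integrable_mult_right[OF scale.IH, of c] show ?case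
    by (simp add: mult_ac)
qed

lemma integrable_power_powr_exp_span_ray:
  assumes f: "f \<in> powr_exp_span \<alpha> d" and "\<alpha> > 0" and s: "s > 0"
  shows "integrable lborel (\<lambda>R. indicator {s<..} R * ((R - s) ^ k * f R))"
proof (rule Bochner_Integration.integrable_bound)
  have [measurable]: "f \<in> borel_measurable borel"
    using f by (rule borel_measurable_powr_exp_span)
  show "integrable lborel (\<lambda>R. indicator {s<..} R * (R powr real k * f R))"
    by (rule integrable_powr_exp_span_ray) fact+
  show "(\<lambda>R. indicator {s<..} R * ((R - s) ^ k * f R)) \<in> borel_measurable lborel"
    by measurable
  have "\<bar>R - s\<bar> ^ k \<le> R powr real k" if "R > s" for R
    using that s by (simp add: powr_realpow power_mono)
  then show "AE R in lborel. norm (indicator {s<..} R * ((R - s) ^ k * f R))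
      \<le> norm (indicator {s<..} R * (R powr real k * f R))"
    by (intro AE_I2) (auto simp: indicator_def abs_mult power_abs intro!: mult_right_mono)
qed

lemma powr_exp_span_tendsto_0:
  assumes "f \<in> powr_exp_span \<alpha> d" and \<alpha>: "\<alpha> > 0"
  shows "((\<lambda>R. R powr v * f R) \<longlongrightarrow> 0) at_top"
  using assms(1)
proof induction
  case (base b)
  obtain K where K: "\<And>s. s \<ge> 1 \<Longrightarrow> powr_exp \<alpha> (v + b) s \<le> K * s powr (-1)"
    using powr_exp_le_powr[OF \<alpha>] by blast
  show ?case
  proof (rule Lim_null_comparison)
    show "\<forall>\<^sub>F R in at_top. norm (R powr v * powr_exp \<alpha> b R) \<le> K * R powr (-1)"
      using eventually_ge_at_top[of 1]
    proof eventually_elim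
      case (elim R)
      then show ?case using K[of R] powr_mult_powr_exp[of R v \<alpha> b] powr_exp_nonneg[of \<alpha> "v + b" R] by simp
    qed
    show "((\<lambda>R. K * R powr (-1)) \<longlongrightarrow> 0) at_top"
      by (intro tendsto_mult_right_zero tendsto_neg_powr filterlim_ident) simp
  qed
next
  case (add f g)
  from tendsto_add[OF add.IH] show ?case by (simp add: distrib_left)
next
  case (scale f c)
  from tendsto_mult_right_zero[OF scale.IH, of c] show ?case by (simp add: mult_ac)
qed

lemma integral_derivative_ray:
  fixes \<Phi> \<phi> :: "real \<Rightarrow> real"
  assumes "\<And>R. R > s \<Longrightarrow> (\<Phi> has_field_derivative \<phi> R) (at R)" and "\<And>R. R > s \<Longrightarrow> isCont \<phi> R"
    and "integrable lborel (\<lambda>R. indicator {s<..} R * \<phi> R)"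
    and "isCont \<Phi> s" and "(\<Phi> \<longlongrightarrow> 0) at_top"
  shows "(LINT R|lborel. indicator {s<..} R * \<phi> R) = - \<Phi> s"
proof -
  have "(LBINT R=ereal s..\<infinity>. \<phi> R) = 0 - \<Phi> s"
  proof (rule interval_integral_FTC_integrable)
    show "set_integrable lborel (einterval (ereal s) \<infinity>) \<phi>"
      using assms(3) by (simp add: set_integrable_def einterval_eq)
    show "((\<Phi> \<circ> real_of_ereal) \<longlongrightarrow> \<Phi> s) (at_right (ereal s))"
      using assms(4) unfolding ereal_tendsto_simps
      by (simp add: continuous_at filterlim_at_split)
    show "((\<Phi> \<circ> real_of_ereal) \<longlongrightarrow> 0) (at_left \<infinity>)"
      using assms(5) unfolding ereal_tendsto_simps .
  qed (use assms in \<open>auto simp: has_real_derivative_iff_has_vector_derivative\<close>)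
  then show ?thesis
    by (simp add: interval_lebesgue_integral_def set_lebesgue_integral_def einterval_eq)
qed

text \<open>Taylor's formula with integral remainder, expanded at infinity, where \<open>powr_exp\<close> vanishes.\<close>

lemma powr_exp_eq_integral:
  assumes \<alpha>: "\<alpha> > 0" and a: "a \<ge> 0"
  obtains d where "d > 0" and
    "\<And>N. \<exists>H\<in>powr_exp_span \<alpha> (d - real N - 1). \<forall>s>0.
        powr_exp \<alpha> a s = (LINT R|lborel. indicator {s<..} R * ((R - s) ^ N * H R))"
proof -
  \<comment> \<open>\<open>d - 1\<close> is the order of the first derivative at the origin. For a =
    0 the term with s^(a-1) has coefficient 0 and the one with s^(\<alpha>-1) leads, so
    \<open>d\<close> is positive in either case.\<close>
  define d where "d = (if a = 0 then \<alpha> else a)"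
  have d: "d > 0" using assms by (auto simp: d_def)
  have E: "powr_exp \<alpha> a \<in> powr_exp_span \<alpha> a"
    by (rule powr_exp_span.base) simp
  have "\<exists>H\<in>powr_exp_span \<alpha> (d - real N - 1). \<forall>s>0.
        powr_exp \<alpha> a s = (LINT R|lborel. indicator {s<..} R * ((R - s) ^ N * H R))" for N
  proof (induction N)
    case 0
    define H where "H s = - (a * powr_exp \<alpha> (a - 1) s - \<alpha> * powr_exp \<alpha> (a + \<alpha> - 1) s)" for s
    have "(\<lambda>s. (- a) * powr_exp \<alpha> (a - 1) s + \<alpha> * powr_exp \<alpha> (a + \<alpha> - 1) s) \<in> powr_exp_span \<alpha> (d - 1)"
    proof (cases "a = 0")
      case True
      then show ?thesis
        using powr_exp_span.scale[OF powr_exp_span.base[of "\<alpha> - 1" "\<alpha> - 1" \<alpha>], of \<alpha>] by (simp add: d_def)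
    next
      case False
      then show ?thesis
        using \<alpha> by (intro powr_exp_span.add powr_exp_span.scale powr_exp_span.base) (auto simp: d_def)
    qed
    then have H: "H \<in> powr_exp_span \<alpha> (d - 1)"
      by (simp add: H_def[abs_def])
    have "powr_exp \<alpha> a s = (LINT R|lborel. indicator {s<..} R * H R)" if s: "s > 0" for s
    proof -
      have "(LINT R|lborel. indicator {s<..} R * H R) = - (- powr_exp \<alpha> a s)"
      proof (rule integral_derivative_ray)
        show "((\<lambda>s. - powr_exp \<alpha> a s) has_field_derivative H R) (at R)" if "R > s" for R
          unfolding H_def using that s by (intro DERIV_minus has_field_derivative_powr_exp) auto
        show "isCont H R" if "R > s" for R
          using isCont_powr_exp_span[OF H \<alpha>, of R] that s by auto
        show "integrable lborel (\<lambda>R. indicator {s<..} R * H R)"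
          using integrable_power_powr_exp_span_ray[OF H \<alpha> s, of 0] by simp
        show "isCont (\<lambda>s. - powr_exp \<alpha> a s) s"
          using isCont_powr_exp_span[OF E \<alpha> s] by (intro continuous_minus)
        have "\<forall>\<^sub>F R in at_top. R powr 0 * powr_exp \<alpha> a R = powr_exp \<alpha> a R"
          using eventually_gt_at_top[of "0::real"] by eventually_elim simp
        from Lim_transform_eventually[OF powr_exp_span_tendsto_0[OF E \<alpha>, of 0] this]
        show "((\<lambda>s. - powr_exp \<alpha> a s) \<longlongrightarrow> 0) at_top"
          using tendsto_minus by fastforce
      qed
      then show ?thesis by simp
    qed
    then show ?case using H by auto
  next
    case (Suc N)
    then obtain H where H: "H \<in> powr_exp_span \<alpha> (d - real N - 1)"
      and rep: "\<And>s. s > 0 \<Longrightarrow> powr_exp \<alpha> a s = (LINT R|lborel. indicator {s<..} R * ((R - s) ^ N * H R))"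
      by blast
    obtain H' where H': "H' \<in> powr_exp_span \<alpha> (d - real N - 1 - 1)"
      and deriv: "\<And>s. s > 0 \<Longrightarrow> (H has_field_derivative H' s) (at s)"
      using deriv_powr_exp_span[OF H \<alpha>] by blast
    \<comment> \<open>Integration by parts: (R - s)^(N+1) H(R) vanishes at R = s through the power
      and at infinity through rapid decay, so the derivative can be moved onto \<open>H\<close> at
      the price of -1/(N+1).\<close>
    define K where "K s = (- inverse (real (Suc N))) * H' s" for s
    have K: "K \<in> powr_exp_span \<alpha> (d - real (Suc N) - 1)"
      using powr_exp_span.scale[OF H', of "- inverse (real (Suc N))"] by (simp add: K_def[abs_def] algebra_simps)
    have "powr_exp \<alpha> a s = (LINT R|lborel. indicator {s<..} R * ((R - s) ^ Suc N * K R))" if s: "s > 0" for s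
    proof -
      define \<Phi> where "\<Phi> R = (R - s) ^ Suc N * H R" for R
      define \<phi> where "\<phi> R = real (Suc N) * ((R - s) ^ N * H R) + (R - s) ^ Suc N * H' R" for R
      note int = integrable_power_powr_exp_span_ray[OF H \<alpha> s] integrable_power_powr_exp_span_ray[OF H' \<alpha> s]
      have "(LINT R|lborel. indicator {s<..} R * \<phi> R) = - \<Phi> s"
      proof (rule integral_derivative_ray)
        show "(\<Phi> has_field_derivative \<phi> R) (at R)" if "R > s" for R
        proof -
          have "((\<lambda>R. (R - s) ^ Suc N) has_field_derivative real (Suc N) * (R - s) ^ N) (at R)"
            by (rule DERIV_cong[OF DERIV_power_Suc[OF DERIV_diff[OF DERIV_ident DERIV_const]]]) simp
          from DERIV_mult[OF this deriv[of R]] that s show ?thesis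
            unfolding \<Phi>_def[abs_def] \<phi>_def by (simp add: mult_ac)
        qed
        show "isCont \<phi> R" if "R > s" for R
          unfolding \<phi>_def using that s isCont_powr_exp_span[OF H \<alpha>, of R] isCont_powr_exp_span[OF H' \<alpha>, of R]
          by (intro continuous_intros) auto
        show "integrable lborel (\<lambda>R. indicator {s<..} R * \<phi> R)"
          using Bochner_Integration.integrable_add[OF integrable_mult_right[OF int(1)[of N], of "real (Suc N)"] int(2)[of "Suc N"]]
          by (simp add: \<phi>_def algebra_simps)
        show "isCont \<Phi> s"
          unfolding \<Phi>_def using s isCont_powr_exp_span[OF H \<alpha>, of s] by (intro continuous_intros) auto
        show "(\<Phi> \<longlongrightarrow> 0) at_top"
        proof (rule Lim_null_comparison)
          show "\<forall>\<^sub>F R in at_top. norm (\<Phi> R) \<le> norm (R powr real (Suc N) * H R)"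
            using eventually_gt_at_top[of s]
          proof eventually_elim
            case (elim R)
            then have "(R - s) ^ Suc N \<le> R ^ Suc N"
              using s by (intro power_mono) auto
            moreover have "R powr real (Suc N) = R ^ Suc N"
              using s elim by (intro powr_realpow) auto
            ultimately show ?case
              using elim s unfolding \<Phi>_def norm_mult by (intro mult_right_mono) auto
          qed
          show "((\<lambda>R. norm (R powr real (Suc N) * H R)) \<longlongrightarrow> 0) at_top"
            by (rule tendsto_norm_zero[OF powr_exp_span_tendsto_0[OF H \<alpha>]])
        qed
      qed
      moreover have "(LINT R|lborel. indicator {s<..} R * \<phi> R) = real (Suc N) * powr_exp \<alpha> a s
          - real (Suc N) * (LINT R|lborel. indicator {s<..} R * ((R - s) ^ Suc N * K R))"
      proof -
        have HK: "H' R = - real (Suc N) * K R" for R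
          unfolding K_def by (simp del: of_nat_Suc)
        have "(LINT R|lborel. indicator {s<..} R * \<phi> R)
          = (LINT R|lborel. real (Suc N) * (indicator {s<..} R * ((R - s) ^ N * H R))
              + indicator {s<..} R * ((R - s) ^ Suc N * H' R))"
          by (simp add: \<phi>_def algebra_simps)
        also have "\<dots> = real (Suc N) * powr_exp \<alpha> a s
              + (LINT R|lborel. indicator {s<..} R * ((R - s) ^ Suc N * H' R))"
          by (subst Bochner_Integration.integral_add[OF integrable_mult_right[OF int(1)] int(2)])
            (simp add: rep[OF s])
        also have "(LINT R|lborel. indicator {s<..} R * ((R - s) ^ Suc N * H' R))
          = (LINT R|lborel. (- real (Suc N)) * (indicator {s<..} R * ((R - s) ^ Suc N * K R)))"
          by (rule Bochner_Integration.integral_cong[OF refl]) (simp add: HK mult_ac del: of_nat_Suc power_Suc)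
        also have "\<dots> = (- real (Suc N)) * (LINT R|lborel. indicator {s<..} R * ((R - s) ^ Suc N * K R))"
          by (rule integral_mult_right_zero)
        finally show ?thesis by (simp del: of_nat_Suc power_Suc)
      qed
      moreover have "\<Phi> s = 0" by (simp add: \<Phi>_def)
      ultimately have "real (Suc N) * (powr_exp \<alpha> a s
          - (LINT R|lborel. indicator {s<..} R * ((R - s) ^ Suc N * K R))) = 0"
        by (simp add: right_diff_distrib del: of_nat_Suc power_Suc)
      then show ?thesis by (simp del: power_Suc)
    qed
    then show ?case using K by blast
  qed
  then show thesis using that d by blast
qed

section \<open>From profiles back to radial symbols\<close>

text \<open>The profile is bounded near the origin because a >= 0, and beats every power at
  infinity. Integrability of the symbol makes its transform bounded, which the sup bound of the
  convolution requires, and it is also a premise of the inversion formula.\<close>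

lemma integrable_radial_powr_exp:
  fixes m :: "'a::euclidean_space \<Rightarrow> complex"
  assumes \<alpha>: "\<alpha> > 0" and a: "a \<ge> 0" and [measurable]: "m \<in> borel_measurable borel"
    and m: "\<And>\<xi>. \<xi> \<noteq> 0 \<Longrightarrow> m \<xi> = complex_of_real (powr_exp \<alpha> a ((norm \<xi>)\<^sup>2))"
  shows "integrable lborel m"
proof -
  let ?n = "DIM('a)"
  obtain K where K: "K > 0" "\<And>s. s \<ge> 1 \<Longrightarrow> powr_exp \<alpha> a s \<le> K * s powr (- real ?n)"
    using powr_exp_le_powr[OF \<alpha>] by blast
  define D where "D = 2 ^ ?n * (1 + K)"
  have bound: "powr_exp \<alpha> a s * (1 + s) ^ ?n \<le> D" if s: "s > 0" for s
  proof (cases "s \<le> 1")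
    case True
    have "powr_exp \<alpha> a s \<le> 1 * 1"
      unfolding powr_exp_def using s a True by (intro mult_mono powr_le1) auto
    moreover have "(1 + s) ^ ?n \<le> 2 ^ ?n"
      using s True by (intro power_mono) auto
    ultimately have "powr_exp \<alpha> a s * (1 + s) ^ ?n \<le> 1 * 2 ^ ?n"
      using s by (intro mult_mono) (auto simp: powr_exp_nonneg)
    then show ?thesis using K by (simp add: D_def algebra_simps add_increasing2)
  next
    case False
    have "powr_exp \<alpha> a s * (1 + s) ^ ?n \<le> (K * s powr (- real ?n)) * (2 * s) ^ ?n"
      using K(1) K(2)[of s] False by (intro mult_mono power_mono) auto
    also have "\<dots> = K * 2 ^ ?n"
      using False by (simp add: powr_minus powr_realpow power_mult_distrib)
    also have "\<dots> \<le> D" by (simp add: D_def algebra_simps)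
    finally show ?thesis .
  qed
  show ?thesis
  proof (rule Bochner_Integration.integrable_bound)
    show "integrable lborel (\<lambda>x::'a. D * inverse ((1 + (norm x)\<^sup>2) ^ ?n))"
      by (intro integrable_mult_right integrable_polynomial_weight)
    show "AE x in lborel. norm (m x) \<le> norm (D * inverse ((1 + (norm x)\<^sup>2) ^ ?n))"
      using AE_lborel_singleton[of "0::'a"]
    proof eventually_elim
      case (elim x)
      have "powr_exp \<alpha> a ((norm x)\<^sup>2) \<le> D / ((1 + (norm x)\<^sup>2) ^ ?n)"
        using bound[of "(norm x)\<^sup>2"] elim by (subst pos_le_divide_eq) (auto simp: add_pos_nonneg)
      then show ?case
        using elim by (simp add: m powr_exp_nonneg divide_inverse)
    qed
  qed measurable
qed

text \<open>With s = |\<xi>|^2, the kernel (R - s)^N of Taylor's formula on R > s is R^N times the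
  bump of radius sqrt R. The weight R^N H(R) has order d - 1 > -1 at the origin whatever N is, so N
  can be taken as large as the bumps demand.\<close>

lemma integrable_ft_radial_powr_exp:
  fixes m :: "'a::euclidean_space \<Rightarrow> complex"
  assumes \<alpha>: "\<alpha> > 0" and a: "a \<ge> 0" and [measurable]: "m \<in> borel_measurable borel"
    and m: "\<And>\<xi>. \<xi> \<noteq> 0 \<Longrightarrow> m \<xi> = complex_of_real (powr_exp \<alpha> a ((norm \<xi>)\<^sup>2))"
  shows "integrable lborel (ft m)"
proof -
  define N where "N = 2 * DIM('a) + 1"
  obtain d where d: "d > 0" and rep: "\<And>N. \<exists>H\<in>powr_exp_span \<alpha> (d - real N - 1). \<forall>s>0.
        powr_exp \<alpha> a s = (LINT R|lborel. indicator {s<..} R * ((R - s) ^ N * H R))"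
    using powr_exp_eq_integral[OF \<alpha> a] by blast
  obtain H where H: "H \<in> powr_exp_span \<alpha> (d - real N - 1)"
    and rep: "\<And>s. s > 0 \<Longrightarrow> powr_exp \<alpha> a s = (LINT R|lborel. indicator {s<..} R * ((R - s) ^ N * H R))"
    using rep[of N] by blast
  define w where "w R = indicator {0<..} R * (R powr real N * H R)" for R
  show ?thesis
  proof (rule integrable_ft_superposition[where w = w and M = N])
    show "AE \<xi> in lborel. m \<xi> = (LINT R|lborel. complex_of_real (w R * bump N (\<xi> /\<^sub>R sqrt R)))"
      using AE_lborel_singleton[of "0::'a"]
    proof eventually_elim
      case (elim \<xi>)
      have "indicator {(norm \<xi>)\<^sup>2<..} R * ((R - (norm \<xi>)\<^sup>2) ^ N * H R) = w R * bump N (\<xi> /\<^sub>R sqrt R)" for R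
      proof (cases "R > 0")
        case True
        have e: "(norm (\<xi> /\<^sub>R sqrt R))\<^sup>2 = (norm \<xi>)\<^sup>2 / R"
          using True by (simp add: power_mult_distrib power_divide divide_inverse power_inverse mult.commute)
        show ?thesis
        proof (cases "R > (norm \<xi>)\<^sup>2")
          case R: True
          have "R powr real N * (1 - (norm \<xi>)\<^sup>2 / R) ^ N = (R * (1 - (norm \<xi>)\<^sup>2 / R)) ^ N"
            using True by (simp add: powr_realpow power_mult_distrib)
          also have "R * (1 - (norm \<xi>)\<^sup>2 / R) = R - (norm \<xi>)\<^sup>2"
            using True by (simp add: field_simps)
          finally show ?thesis
            using True R unfolding w_def bump_def e by (simp add: max_def mult_ac)
        next
          case R: False
          then have "1 - (norm \<xi>)\<^sup>2 / R \<le> 0" using True by (simp add: field_simps)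
          then show ?thesis
            using R unfolding bump_def e by (simp add: max_def N_def)
        qed
      next
        case False
        then have "\<not> R > (norm \<xi>)\<^sup>2" using zero_le_power2[of "norm \<xi>"] by linarith
        with False show ?thesis by (simp add: w_def)
      qed
      then show ?case
        using rep[of "(norm \<xi>)\<^sup>2"] elim m[of \<xi>] by (subst integral_complex_of_real) simp
    qed
    show "integrable lborel w"
      unfolding w_def using d by (intro integrable_powr_exp_span[OF H \<alpha>]) auto
    have "sqrt R ^ DIM('a) * w R = indicator {0<..} R * (R powr (real DIM('a) / 2 + real N) * H R)" for R
    proof (cases "R > 0")
      case True
      then have "sqrt R ^ DIM('a) = R powr (real DIM('a) / 2)"
        by (simp add: powr_half_sqrt[symmetric] powr_realpow[symmetric] powr_powr)
      then show ?thesis using True by (simp add: w_def powr_add)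
    qed (simp add: w_def)
    then show "integrable lborel (\<lambda>R. sqrt R ^ DIM('a) * w R)"
      using integrable_powr_exp_span[OF H \<alpha>, of "real DIM('a) / 2 + real N"] d by simp
  qed (auto simp: w_def N_def)
qed

subsection \<open>The heat kernels, and the exponent \<open>r\<close>\<close>

definition dilate :: "real \<Rightarrow> ('a::euclidean_space \<Rightarrow> complex) \<Rightarrow> 'a \<Rightarrow> complex" where
  "dilate \<tau> J x = (inverse \<tau> ^ DIM('a)) *\<^sub>R J (x /\<^sub>R \<tau>)"

lemma ft_dilate:
  fixes m :: "'a::euclidean_space \<Rightarrow> complex"
  assumes "m \<in> borel_measurable borel" and "\<tau> > 0"
  shows "ft (\<lambda>\<xi>. m (\<tau> *\<^sub>R \<xi>)) = dilate \<tau> (ft m)"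
  using ft_dilation[OF assms(1), of "inverse \<tau>"] assms(2)
  by (auto simp: dilate_def fun_eq_iff)

lemma ft_cmult: "ft (\<lambda>\<xi>. c * m \<xi>) x = c * ft m x"
  by (simp add: ft_def mult.left_commute)

lemma integrable_dilate:
  fixes J :: "'a::euclidean_space \<Rightarrow> complex"
  assumes "integrable lborel J" and "\<tau> > 0"
  shows "integrable lborel (dilate \<tau> J)"
  unfolding dilate_def
  using integrable_lborel_affine[of J "inverse \<tau>" 0] assms
  by (intro integrable_scaleR_right) auto

text \<open>Since t |\<xi>|^(2\<alpha>) = |\<tau>\<xi>|^(2\<alpha>) for \<tau> = t^(1/(2\<alpha>)),
  time enters by dilation only; writing |\<xi>|^\<kappa> in terms of \<tau>\<xi> leaves the factor
  \<tau>^(-\<kappa>) = t^(-\<kappa>/(2\<alpha>)).\<close>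

lemma heat_kernels_are_dilates:
  fixes \<alpha> \<kappa> :: real
  assumes \<alpha>: "\<alpha> > 0" and \<kappa>: "\<kappa> > 0"
  obtains J0 J1 :: "real^'n \<Rightarrow> complex"
  where "integrable lborel J0" "bounded (range J0)" "integrable lborel J1" "bounded (range J1)"
    and "\<And>t. t > 0 \<Longrightarrow> frac_heat_kernel \<alpha> t = dilate (t powr (1 / (2 * \<alpha>))) J0"
    and "\<And>t x. t > 0 \<Longrightarrow> frac_laplacian (\<kappa> / 2) (frac_heat_kernel \<alpha> t) x
      = (t powr (- (\<kappa> / (2 * \<alpha>)))) *\<^sub>R dilate (t powr (1 / (2 * \<alpha>))) J1 x"
proof -
  define k :: complex where "k = complex_of_real ((2 * pi) powr (- real CARD('n)))"
  define m where "m \<xi> = complex_of_real (exp (- (norm \<xi> powr (2 * \<alpha>))))" for \<xi> :: "real^'n"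
  define q where "q \<xi> = complex_of_real (norm \<xi> powr \<kappa>) * m \<xi>" for \<xi> :: "real^'n"
  have [measurable]: "m \<in> borel_measurable borel" "q \<in> borel_measurable borel"
    unfolding q_def m_def by measurable
  note mm = \<open>m \<in> borel_measurable borel\<close> and qm = \<open>q \<in> borel_measurable borel\<close>
  have sq: "(norm \<xi>)\<^sup>2 powr b = norm \<xi> powr (2 * b)" if "\<xi> \<noteq> 0" for \<xi> :: "real^'n" and b
  proof -
    have "(norm \<xi>)\<^sup>2 = norm \<xi> powr 2"
      using that by (simp add: powr_numeral)
    then show ?thesis by (simp only: powr_powr)
  qed
  \<comment> \<open>The origin has to be excluded: \<open>0 powr 0 = 0\<close> gives the right side
    the value 0 there, while \<open>m 0 = 1\<close>.\<close>
  have m_radial: "m \<xi> = complex_of_real (powr_exp \<alpha> 0 ((norm \<xi>)\<^sup>2))" if "\<xi> \<noteq> 0" for \<xi>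
    using that by (simp add: m_def powr_exp_def sq)
  have q_radial: "q \<xi> = complex_of_real (powr_exp \<alpha> (\<kappa> / 2) ((norm \<xi>)\<^sup>2))" if "\<xi> \<noteq> 0" for \<xi>
    using that by (simp add: q_def m_def powr_exp_def sq)
  have im: "integrable lborel m" "integrable lborel (ft m)"
    by (rule integrable_radial_powr_exp[OF \<alpha> order_refl mm m_radial], assumption)
       (rule integrable_ft_radial_powr_exp[OF \<alpha> order_refl mm m_radial], assumption)
  have "\<kappa> / 2 \<ge> 0" using \<kappa> by simp
  have iq: "integrable lborel q" "integrable lborel (ft q)"
    by (rule integrable_radial_powr_exp[OF \<alpha> \<open>\<kappa> / 2 \<ge> 0\<close> qm q_radial], assumption)
       (rule integrable_ft_radial_powr_exp[OF \<alpha> \<open>\<kappa> / 2 \<ge> 0\<close> qm q_radial], assumption)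
  obtain c where c: "\<And>h x. continuous_on UNIV h \<Longrightarrow> bounded (range h) \<Longrightarrow> integrable lborel h \<Longrightarrow>
      integrable lborel (ft h) \<Longrightarrow> ft (ft h) (- x :: real^'n) = c * h x"
    using ft_inversion_up_to_constant by blast
  define J0 where "J0 x = k * ft m x" for x
  \<comment> \<open>One \<open>k\<close> normalises the heat kernel, \<open>c\<close> arises when it
    is transformed back to its symbol, and the other \<open>k\<close> normalises the inverse
    transform in \<open>frac_laplacian\<close>.\<close>
  define J1 where "J1 x = k * k * c * ft q x" for x
  have heat: "frac_heat_kernel \<alpha> t = dilate (t powr (1 / (2 * \<alpha>))) J0"
    and lap: "frac_laplacian (\<kappa> / 2) (frac_heat_kernel \<alpha> t) x
      = (t powr (- (\<kappa> / (2 * \<alpha>)))) *\<^sub>R dilate (t powr (1 / (2 * \<alpha>))) J1 x"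
    if t: "t > 0" for t x
  proof -
    define \<tau> where "\<tau> = t powr (1 / (2 * \<alpha>))"
    have \<tau>: "\<tau> > 0" using t by (simp add: \<tau>_def)
    have scale: "norm (\<tau> *\<^sub>R \<xi>) powr (2 * \<alpha>) = t * norm \<xi> powr (2 * \<alpha>)" for \<xi> :: "real^'n"
      using \<alpha> t by (simp add: \<tau>_def powr_mult powr_powr)
    have mt: "complex_of_real (exp (- t * norm \<xi> powr (2 * \<alpha>))) = m (\<tau> *\<^sub>R \<xi>)" for \<xi>
      unfolding m_def scale by simp
    have mtm: "(\<lambda>\<xi>. m (\<tau> *\<^sub>R \<xi>)) \<in> borel_measurable borel"
      by measurable
    have g: "frac_heat_kernel \<alpha> t x = k * dilate \<tau> (ft m) x" for x
      unfolding frac_heat_kernel_def mt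
      by (simp only: inv_fourier_eq_ft[OF mtm] ft_dilate[OF mm \<tau>] k_def)
    then show "frac_heat_kernel \<alpha> t = dilate (t powr (1 / (2 * \<alpha>))) J0"
      by (simp add: fun_eq_iff dilate_def J0_def \<tau>_def)
    have gm: "frac_heat_kernel \<alpha> t = (\<lambda>x. k * ft (\<lambda>\<xi>. m (\<tau> *\<^sub>R \<xi>)) x)"
      by (simp add: fun_eq_iff g ft_dilate[OF mm \<tau>])
    have inv: "ft (ft (\<lambda>\<xi>. m (\<tau> *\<^sub>R \<xi>))) (- \<xi>) = c * m (\<tau> *\<^sub>R \<xi>)" for \<xi>
    proof (rule c)
      show "continuous_on UNIV (\<lambda>\<xi>. m (\<tau> *\<^sub>R \<xi>))"
        unfolding m_def using \<alpha> by (intro continuous_intros continuous_on_powr') auto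
      have "norm (m \<xi>) \<le> 1" for \<xi> by (simp add: m_def)
      then show "bounded (range (\<lambda>\<xi>. m (\<tau> *\<^sub>R \<xi>)))"
        by (auto simp: bounded_iff)
      show "integrable lborel (\<lambda>\<xi>. m (\<tau> *\<^sub>R \<xi>))"
        using integrable_lborel_affine[of m \<tau> 0] im \<tau> by simp
      show "integrable lborel (ft (\<lambda>\<xi>. m (\<tau> *\<^sub>R \<xi>)))"
        unfolding ft_dilate[OF mm \<tau>] by (rule integrable_dilate[OF im(2) \<tau>])
    qed
    have fg: "fourier (frac_heat_kernel \<alpha> t) \<xi> = k * c * m (\<tau> *\<^sub>R \<xi>)" for \<xi>
    proof -
      have "(\<lambda>x. k * ft (\<lambda>\<xi>. m (\<tau> *\<^sub>R \<xi>)) x) \<in> borel_measurable borel"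
        using mtm by measurable
      then have "fourier (frac_heat_kernel \<alpha> t) \<xi> = ft (\<lambda>x. k * ft (\<lambda>\<xi>. m (\<tau> *\<^sub>R \<xi>)) x) (- \<xi>)"
        unfolding gm by (rule fourier_eq_ft)
      also have "\<dots> = k * (c * m (\<tau> *\<^sub>R \<xi>))"
        by (simp only: ft_cmult inv)
      finally show ?thesis by simp
    qed
    have "complex_of_real (norm \<xi> powr (2 * (\<kappa> / 2))) * fourier (frac_heat_kernel \<alpha> t) \<xi>
        = (complex_of_real (\<tau> powr (- \<kappa>)) * k * c) * q (\<tau> *\<^sub>R \<xi>)" for \<xi>
    proof -
      have "norm \<xi> powr \<kappa> = \<tau> powr (- \<kappa>) * norm (\<tau> *\<^sub>R \<xi>) powr \<kappa>"
        using \<tau> by (simp add: powr_mult powr_minus)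
      then show ?thesis
        unfolding fg q_def by simp
    qed
    moreover have "(\<lambda>\<xi>. (complex_of_real (\<tau> powr (- \<kappa>)) * k * c) * q (\<tau> *\<^sub>R \<xi>)) \<in> borel_measurable borel"
      by measurable
    ultimately have "frac_laplacian (\<kappa> / 2) (frac_heat_kernel \<alpha> t) x
        = k * ((complex_of_real (\<tau> powr (- \<kappa>)) * k * c) * dilate \<tau> (ft q) x)"
      unfolding frac_laplacian_def
      by (simp only: inv_fourier_eq_ft ft_cmult ft_dilate[OF qm \<tau>] k_def)
    moreover have "\<tau> powr (- \<kappa>) = t powr (- (\<kappa> / (2 * \<alpha>)))"
      by (simp add: \<tau>_def powr_powr)
    ultimately show "frac_laplacian (\<kappa> / 2) (frac_heat_kernel \<alpha> t) x
      = (t powr (- (\<kappa> / (2 * \<alpha>)))) *\<^sub>R dilate (t powr (1 / (2 * \<alpha>))) J1 x"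
      by (simp add: dilate_def J1_def \<tau>_def scaleR_conv_of_real)
  qed
  show thesis
  proof (rule that)
    show "integrable lborel J0" "integrable lborel J1"
      unfolding J0_def J1_def using im iq by auto
    have "norm (J0 x) \<le> norm k * (LINT \<xi>|lborel. norm (m \<xi>))" for x
      unfolding J0_def norm_mult by (intro mult_left_mono norm_ft_le norm_ge_zero)
    moreover have "norm (J1 x) \<le> norm (k * k * c) * (LINT \<xi>|lborel. norm (q \<xi>))" for x
      unfolding J1_def by (subst norm_mult, intro mult_left_mono norm_ft_le norm_ge_zero)
    ultimately show "bounded (range J0)" "bounded (range J1)"
      unfolding bounded_iff by blast+
  qed (fact heat lap)+
qed

section \<open>Embedding of the unit ball of L^r(.) into L^q\<close>

text \<open>The bound forces 1/r to converge to the constant in the log-Hoelder condition, so this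
  constant, existentially quantified in the definition, is 1/q.\<close>

lemma log_exponents_at_infinity:
  fixes r :: "real^'n \<Rightarrow> ennreal"
  assumes r: "r \<in> log_exponents" and q: "exp_infinity r = ennreal q" and "q \<ge> 0"
  obtains c where "c > 0" and "\<And>x. \<bar>enn2real (1 / r x) - 1 / q\<bar> \<le> c / ln (exp 1 + norm x)"
proof -
  have r1: "1 \<le> r x" for x
    using r by (auto simp: log_exponents_def var_exponents_def)
  obtain c g where c: "c > 0" and g: "\<And>x. \<bar>enn2real (1 / r x) - g\<bar> \<le> c / ln (exp 1 + norm x)"
    using r unfolding log_exponents_def globally_log_Hoelder_def by blast
  have "((\<lambda>x. enn2real (1 / r x) - g) \<longlongrightarrow> 0) at_infinity"
  proof (rule Lim_null_comparison)
    show "\<forall>\<^sub>F x in at_infinity. norm (enn2real (1 / r x) - g) \<le> c / ln (exp 1 + norm x)"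
      using g by (intro always_eventually) auto
    have "filterlim (\<lambda>x::real^'n. exp 1 + norm x) at_top at_infinity"
      by (intro filterlim_tendsto_add_at_top[OF tendsto_const] filterlim_norm_at_top)
    then have "filterlim (\<lambda>x::real^'n. ln (exp 1 + norm x)) at_top at_infinity"
      by (rule filterlim_compose[OF ln_at_top])
    then show "((\<lambda>x::real^'n. c / ln (exp 1 + norm x)) \<longlongrightarrow> 0) at_infinity"
      by (intro tendsto_divide_0[OF tendsto_const] filterlim_at_top_imp_at_infinity)
  qed
  then have "((\<lambda>x. ennreal (enn2real (1 / r x))) \<longlongrightarrow> ennreal g) at_infinity"
    by (intro tendsto_ennrealI) (simp add: LIM_zero_iff)
  moreover have "1 / r x < top" for x
    using r1[of x] by (simp add: ennreal_divide_eq_top_iff less_top[symmetric]) (metis not_one_le_zero)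
  ultimately have "((\<lambda>x. 1 / r x) \<longlongrightarrow> ennreal g) at_infinity"
    by (simp add: less_top)
  then have "Lim at_infinity (\<lambda>x. 1 / r x) = ennreal g"
    by (intro tendsto_Lim trivial_limit_at_infinity)
  with q have e: "1 / ennreal g = ennreal q"
    by (simp add: exp_infinity_def)
  \<comment> \<open>A nonpositive \<open>g\<close> would become 0 in \<open>ennreal\<close>, and 1 /
    0 = \<infinity> is not the finite \<open>q\<close>.\<close>
  have "g > 0"
    using e by (cases "g > 0") (auto simp: ennreal_neg)
  have "g = 1 / q"
  proof -
    have "ennreal (1 / g) = ennreal q"
      using e \<open>g > 0\<close> by (simp add: ennreal_1[symmetric] divide_ennreal del: ennreal_1)
    then have "1 / g = q"
      using \<open>g > 0\<close> \<open>q \<ge> 0\<close> by simp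
    then show ?thesis by auto
  qed
  with that c g show thesis by blast
qed

text \<open>Put \<gamma> = exp(- N c q). If y^(\<rho>-q) >= \<gamma>, the first term on the right
  suffices. Otherwise \<gamma> y^q <= \<gamma>^(1 + q/(\<rho>-q)) = exp(- N c q\<rho>/(\<rho>-q)),
  and q\<rho>/(\<rho>-q) is the reciprocal of 1/q - 1/\<rho>, hence at least \<beta>/c. In the
  application \<beta> = ln(e + |x|), so the second term is (e + |x|)^(-N).\<close>

lemma log_exponent_young:
  fixes y :: real
  assumes q: "q \<ge> 1" and \<rho>: "\<rho> \<ge> q" and y: "y \<ge> 0" and \<beta>: "\<beta> > 0" and c: "c > 0" and N: "N \<ge> 0"
    and le: "1 / q - 1 / \<rho> \<le> c / \<beta>"
  shows "exp (- N * c * q) * y powr q \<le> y powr \<rho> + exp (- N * \<beta>)"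
proof -
  have small: "exp (- N * c * q) \<le> 1" using q c N by simp
  show ?thesis
  proof (cases "y = 0 \<or> \<rho> = q")
    case True
    have "exp (- N * c * q) * y powr q \<le> 1 * y powr q"
      by (intro mult_right_mono small) simp
    then show ?thesis using True by (auto intro: add_increasing2)
  next
    case False
    then have y: "y > 0" and \<rho>: "\<rho> > q" using y \<rho> by auto
    show ?thesis
    proof (cases "exp (- N * c * q) \<le> y powr (\<rho> - q)")
      case True
      have "exp (- N * c * q) * y powr q \<le> y powr (\<rho> - q) * y powr q"
        by (intro mult_right_mono True) simp
      also have "\<dots> = y powr \<rho>" by (simp add: powr_add[symmetric])
      finally show ?thesis by (simp add: add_increasing2)
    next
      case False
      then have "(y powr (\<rho> - q)) powr (q / (\<rho> - q)) \<le> exp (- N * c * q) powr (q / (\<rho> - q))"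
        using q \<rho> by (intro powr_mono2) auto
      then have "y powr q \<le> exp (- N * c * q * (q / (\<rho> - q)))"
        using \<rho> by (simp add: powr_powr exp_powr_real)
      then have "exp (- N * c * q) * y powr q \<le> exp (- N * c * q) * exp (- N * c * q * (q / (\<rho> - q)))"
        by (intro mult_left_mono) auto
      also have "\<dots> = exp (- N * (c * (q * \<rho> / (\<rho> - q))))"
        using \<rho> by (simp add: exp_add[symmetric] field_simps)
      also have "\<dots> \<le> exp (- N * \<beta>)"
      proof -
        have "(\<rho> - q) / (q * \<rho>) \<le> c / \<beta>"
          using le q \<rho> by (simp add: field_simps)
        then have "\<beta> \<le> c * (q * \<rho> / (\<rho> - q))"
          using q \<rho> \<beta> by (simp add: field_simps)
        from mult_left_mono[OF this N] show ?thesis by simp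
      qed
      finally show ?thesis by (simp add: add_increasing)
    qed
  qed
qed

text \<open>The supremum runs over uncountably many lower bounds, each with its own null set; a
  sequence of them with the same supremum leaves countably many.\<close>

lemma AE_exp_minus_le: "AE x in lebesgue. exp_minus r \<le> r x"
proof -
  let ?A = "{z. AE x in lebesgue. z \<le> r x}"
  have "0 \<in> ?A" by simp
  then have "?A \<noteq> {}" by blast
  from ennreal_Sup_countable_SUP[OF this]
  obtain f :: "nat \<Rightarrow> ennreal" where f: "range f \<subseteq> ?A" "Sup ?A = (SUP i. f i)"
    by (elim exE conjE)
  have "AE x in lebesgue. f i \<le> r x" for i
    using f(1) by (simp add: image_subset_iff)
  then have "AE x in lebesgue. \<forall>i. f i \<le> r x"
    unfolding AE_all_countable by blast
  then show ?thesis
    unfolding exp_minus_def f(2) by eventually_elim (auto intro: SUP_least)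
qed

lemma borel_measurable_omega [measurable]:
  assumes [measurable]: "p \<in> borel_measurable M" "s \<in> borel_measurable M"
  shows "(\<lambda>x. omega (p x) (s x)) \<in> borel_measurable M"
  unfolding omega_def by measurable

text \<open>The inequality of \<open>log_exponent_young\<close> is integrated; the constant is (1 +
  W) / \<gamma> with W the mass of the error weight. Its premise r >= q comes from r^- = q, and the
  smallness of 1/q - 1/r from r_\<infinity> = q.\<close>

lemma nn_integral_powr_le_of_modular:
  fixes r :: "real^'n \<Rightarrow> ennreal"
  assumes r: "r \<in> log_exponents" and q: "q \<ge> 1"
    and inf: "exp_infinity r = ennreal q" and minus: "exp_minus r = ennreal q"
  obtains C where "C \<ge> 0" and "\<And>f. f \<in> borel_measurable lebesgue \<Longrightarrow> modular r f \<le> 1 \<Longrightarrow>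
    (\<integral>\<^sup>+x. ennreal (cmod (f x) powr q) \<partial>lebesgue) \<le> ennreal C"
proof -
  let ?n = "real (CARD('n))"
  obtain c where c: "c > 0" and hoelder: "\<And>x. \<bar>enn2real (1 / r x) - 1 / q\<bar> \<le> c / ln (exp 1 + norm x)"
    using log_exponents_at_infinity[OF r inf] q by auto
  have [measurable]: "r \<in> borel_measurable lebesgue"
    using r by (simp add: log_exponents_def var_exponents_def)
  \<comment> \<open>The choice N = 2n puts the error (e + |x|)^(-2n) below the integrable weight
    \<open>w\<close>.\<close>
  define \<gamma> where "\<gamma> = exp (- (2 * ?n) * c * q)"
  define w where "w x = inverse ((1 + (norm x)\<^sup>2) ^ CARD('n))" for x :: "real^'n"
  have [measurable]: "w \<in> borel_measurable lebesgue"
    unfolding w_def by (intro measurable_completion) measurable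
  define W where "W = enn2real (\<integral>\<^sup>+x. ennreal (w x) \<partial>lebesgue)"
  have W: "(\<integral>\<^sup>+x. ennreal (w x) \<partial>lebesgue) = ennreal W"
  proof -
    have "(\<integral>\<^sup>+x. ennreal (norm (w x)) \<partial>lborel) < \<infinity>"
      using nn_integral_norm_finite[OF integrable_polynomial_weight[where 'a = "real^'n"]] by (simp add: w_def)
    moreover have "norm (w x) = w x" for x by (simp add: w_def)
    ultimately show ?thesis
      unfolding W_def by (simp add: nn_integral_completion)
  qed
  have w: "exp (- (2 * ?n) * ln (exp 1 + norm x)) \<le> w x" for x :: "real^'n"
  proof -
    define z where "z = exp 1 + norm x"
    have z: "z > 0" "1 \<le> exp (1::real)" by (auto simp: z_def add_pos_nonneg)
    have "(1 + (norm x)\<^sup>2) \<le> z\<^sup>2"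
    proof -
      have "1 \<le> (exp 1 :: real)\<^sup>2" by (rule one_le_power) simp
      moreover have "0 \<le> 2 * (exp 1 :: real) * norm x" by simp
      ultimately show ?thesis unfolding z_def power2_sum by linarith
    qed
    then have "(1 + (norm x)\<^sup>2) ^ CARD('n) \<le> (z\<^sup>2) ^ CARD('n)"
      by (intro power_mono) auto
    also have "(z\<^sup>2) ^ CARD('n) = exp (2 * ?n * ln z)"
    proof -
      have "exp (2 * ?n * ln z) = exp (real (2 * CARD('n)) * ln z)" by simp
      also have "\<dots> = exp (ln z) ^ (2 * CARD('n))" by (rule exp_of_nat_mult)
      finally show ?thesis using z by (simp add: power_mult)
    qed
    finally show ?thesis
      unfolding w_def z_def by (simp add: exp_minus le_imp_inverse_le add_pos_nonneg)
  qed
  have ptw: "AE x in lebesgue. ennreal (\<gamma> * cmod (f x) powr q) \<le> omega (r x) (cmod (f x)) + ennreal (w x)" for f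
    using AE_exp_minus_le[of r]
  proof eventually_elim
    case (elim x)
    define \<beta> where "\<beta> = ln (exp 1 + norm x)"
    have \<beta>: "\<beta> > 0"
      unfolding \<beta>_def by (intro ln_gt_zero) (smt (verit) norm_ge_zero one_less_exp_iff zero_less_one)
    show ?case
    proof (cases "r x = \<infinity>")
      case True
      \<comment> \<open>An infinite exponent has 1 / r x = 0, so the decay condition says \<beta> <=
        c q: such points lie in a bounded region, on which \<gamma> <= exp(-2n\<beta>).\<close>
      then have le: "1 / q \<le> c / \<beta>"
        using hoelder[of x] q by (simp add: \<beta>_def)
      show ?thesis
      proof (cases "cmod (f x) \<le> 1")
        case f: True
        have "\<gamma> * cmod (f x) powr q \<le> \<gamma> * 1"
          using f q by (intro mult_left_mono powr_le1) (auto simp: \<gamma>_def)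
        also have "\<dots> \<le> exp (- (2 * ?n) * \<beta>)"
          using le q \<beta> by (simp add: \<gamma>_def field_simps)
        also have "\<dots> \<le> w x" unfolding \<beta>_def by (rule w)
        finally show ?thesis
          using True f by (simp add: omega_def ennreal_leI)
      next
        case False
        then show ?thesis using True by (simp add: omega_def)
      qed
    next
      case False
      define \<rho> where "\<rho> = enn2real (r x)"
      have r\<rho>: "r x = ennreal \<rho>" "\<rho> \<ge> 0"
        using False by (simp_all add: \<rho>_def less_top)
      have \<rho>: "\<rho> \<ge> q"
        using elim r\<rho>(2) unfolding minus r\<rho>(1) by (simp add: ennreal_le_iff)
      have e: "enn2real (1 / r x) = 1 / \<rho>"
        using \<rho> q unfolding r\<rho>(1) by (simp add: ennreal_1[symmetric] divide_ennreal del: ennreal_1)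
      have "1 / q - 1 / \<rho> \<le> c / \<beta>"
        using hoelder[of x] unfolding e \<beta>_def by linarith
      then have "\<gamma> * cmod (f x) powr q \<le> cmod (f x) powr \<rho> + exp (- (2 * ?n) * \<beta>)"
        unfolding \<gamma>_def
        by (intro log_exponent_young q \<rho> norm_ge_zero \<beta> c) auto
      also have "\<dots> \<le> cmod (f x) powr \<rho> + w x" using w[of x] by (simp add: \<beta>_def)
      finally have "ennreal (\<gamma> * cmod (f x) powr q) \<le> ennreal (cmod (f x) powr \<rho> + w x)"
        by (rule ennreal_leI)
      also have "\<dots> = ennreal (cmod (f x) powr \<rho>) + ennreal (w x)"
        by (rule ennreal_plus) (auto simp: w_def)
      also have "ennreal (cmod (f x) powr \<rho>) = omega (r x) (cmod (f x))"
        using False by (simp add: omega_def \<rho>_def)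
      finally show ?thesis .
    qed
  qed
  define C where "C = (1 + W) / \<gamma>"
  have \<gamma>: "\<gamma> > 0" by (simp add: \<gamma>_def)
  have W0: "W \<ge> 0" by (simp add: W_def)
  show thesis
  proof (rule that)
    show "C \<ge> 0" using W0 \<gamma> by (simp add: C_def)
    fix f :: "real^'n \<Rightarrow> complex"
    assume [measurable]: "f \<in> borel_measurable lebesgue" and mod: "modular r f \<le> 1"
    have "ennreal \<gamma> * (\<integral>\<^sup>+x. ennreal (cmod (f x) powr q) \<partial>lebesgue)
        = (\<integral>\<^sup>+x. ennreal (\<gamma> * cmod (f x) powr q) \<partial>lebesgue)"
      using \<gamma> by (subst nn_integral_cmult[symmetric]) (auto simp: ennreal_mult)
    also have "\<dots> \<le> (\<integral>\<^sup>+x. omega (r x) (cmod (f x)) + ennreal (w x) \<partial>lebesgue)"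
      by (rule nn_integral_mono_AE[OF ptw])
    also have "\<dots> = modular r f + ennreal W"
      unfolding modular_def W[symmetric] by (rule nn_integral_add) measurable
    also have "\<dots> \<le> 1 + ennreal W"
      by (intro add_mono mod order_refl)
    also have "\<dots> = ennreal \<gamma> * ennreal C"
    proof -
      have "1 + ennreal W = ennreal (1 + W)"
        using W0 by (subst ennreal_plus) auto
      also have "1 + W = \<gamma> * C" using \<gamma> by (simp add: C_def)
      also have "ennreal (\<gamma> * C) = ennreal \<gamma> * ennreal C"
        using \<gamma> W0 by (intro ennreal_mult) (auto simp: C_def)
      finally show ?thesis .
    qed
    finally show "(\<integral>\<^sup>+x. ennreal (cmod (f x) powr q) \<partial>lebesgue) \<le> ennreal C"
      using \<gamma> by (subst (asm) ennreal_mult_le_mult_iff) auto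
  qed
qed

subsection \<open>Convolution with integrable bounded kernels\<close>

lemma nn_integral_dilate:
  fixes J :: "'a::euclidean_space \<Rightarrow> complex"
  assumes [measurable]: "J \<in> borel_measurable borel" and \<tau>: "\<tau> > 0"
  shows nn_integral_dilate_left: "(\<integral>\<^sup>+x. norm (dilate \<tau> J (x - y)) \<partial>lborel) = (\<integral>\<^sup>+u. norm (J u) \<partial>lborel)"
    and nn_integral_dilate_right: "(\<integral>\<^sup>+y. norm (dilate \<tau> J (x - y)) \<partial>lborel) = (\<integral>\<^sup>+u. norm (J u) \<partial>lborel)"
proof -
  have [measurable]: "dilate \<tau> J \<in> borel_measurable borel"
    unfolding dilate_def[abs_def] by measurable
  have e: "ennreal (\<tau> ^ DIM('a)) * ennreal (norm (dilate \<tau> J (\<tau> *\<^sub>R u))) = ennreal (norm (J u))" for u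
    using \<tau> by (simp add: dilate_def power_inverse flip: ennreal_mult)
  have e': "norm (dilate \<tau> J (x - (x + (- \<tau>) *\<^sub>R u))) = norm (dilate \<tau> J (\<tau> *\<^sub>R u))" for u
    by simp
  show "(\<integral>\<^sup>+x. norm (dilate \<tau> J (x - y)) \<partial>lborel) = (\<integral>\<^sup>+u. norm (J u) \<partial>lborel)"
    using \<tau> by (subst nn_integral_lborel_affine[of _ \<tau> y]) (auto simp: e nn_integral_cmult[symmetric])
  show "(\<integral>\<^sup>+y. norm (dilate \<tau> J (x - y)) \<partial>lborel) = (\<integral>\<^sup>+u. norm (J u) \<partial>lborel)"
    using \<tau> by (subst nn_integral_lborel_affine[of _ "- \<tau>" x]) (auto simp: e nn_integral_cmult[symmetric])
qed

text \<open>A form of Young's inequality with a free level \<open>l\<close>: above the level,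
  u^(1-q) <= l^(1-q) because q >= 1.\<close>

lemma le_add_powr_mult:
  fixes u l q :: real
  assumes "u \<ge> 0" "l > 0" "q \<ge> 1"
  shows "u \<le> l + l powr (1 - q) * u powr q"
proof (cases "u \<le> l")
  case True
  then show ?thesis by (simp add: add_increasing2)
next
  case False
  then have "u = u powr (1 - q) * u powr q"
    using assms by (simp add: powr_add[symmetric])
  also have "\<dots> \<le> l powr (1 - q) * u powr q"
    using False assms by (intro mult_right_mono powr_mono2') auto
  finally show ?thesis using assms by simp
qed

text \<open>Optimising over \<open>l\<close> in \<open>le_add_powr_mult\<close> replaces Hoelder's inequality.\<close>

lemma powr_le_of_interpolation:
  fixes s a i q :: real
  assumes "\<And>l. l > 0 \<Longrightarrow> s \<le> l * a + l powr (1 - q) * i"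
    and a: "a > 0" and i: "i \<ge> 0" and s: "s \<ge> 0" and q: "q \<ge> 1"
  shows "s powr q \<le> (2 * a) powr q * i / a"
proof (cases "i = 0")
  case True
  have "s \<le> 0"
  proof (rule field_le_epsilon)
    fix e :: real assume "e > 0"
    then show "s \<le> 0 + e"
      using assms(1)[of "e / a"] a True by simp
  qed
  then show ?thesis using s a i by simp
next
  case False
  \<comment> \<open>This level makes the two terms equal. For i = 0 it would be 0, which is why that
    case was settled by letting \<open>l\<close> tend to 0.\<close>
  define l where "l = (i / a) powr (1 / q)"
  have l: "l > 0" using False i a by (simp add: l_def)
  have lq: "l powr q = i / a"
    using False i a q by (simp add: l_def powr_powr)
  have "l powr (1 - q) * i = l * a"
    using l lq False i a by (simp add: powr_diff)
  then have "s \<le> 2 * a * l"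
    using assms(1)[OF l] by simp
  then have "s powr q \<le> (2 * a * l) powr q"
    using s q by (intro powr_mono2) auto
  also have "\<dots> = (2 * a) powr q * i / a"
    using a l lq by (simp add: powr_mult)
  finally show ?thesis .
qed

text \<open>Both bounds come from S <= l a + l^(1-q) I, where a is the L^1 norm of J and I is the
  convolution of |K| with |f|^q: I is at most k \<tau>^(-n) C pointwise, and its integral is at most
  a C by Tonelli. \<open>A\<close> is large enough for both. The bounds concern the integral of the
  modulus, so they also yield existence of the convolution.\<close>

lemma convolution_bounds_borel:
  fixes J f :: "'a::euclidean_space \<Rightarrow> complex"
  assumes J: "integrable lborel J" and k: "\<And>x. norm (J x) \<le> k"
    and [measurable]: "f \<in> borel_measurable borel" and C: "C \<ge> 0"
    and f: "(\<integral>\<^sup>+x. norm (f x) powr q \<partial>lborel) \<le> ennreal C"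
    and q: "q \<ge> 1" and \<tau>: "\<tau> > 0"
    and A: "A = 2 * ((LINT x|lborel. norm (J x)) + 1) * (1 + C) + k * C"
  shows "(\<integral>\<^sup>+y. norm (dilate \<tau> J (x - y) * f y) \<partial>lborel) \<le> ennreal (A * \<tau> powr (- real DIM('a) / q))"
    and "(\<integral>\<^sup>+x. ennreal (enn2real (\<integral>\<^sup>+y. norm (dilate \<tau> J (x - y) * f y) \<partial>lborel) powr q) \<partial>lborel)
      \<le> ennreal (A powr q)"
proof -
  let ?n = "real DIM('a)"
  define K where "K = dilate \<tau> J"
  have [measurable]: "J \<in> borel_measurable borel" using J by auto
  have [measurable]: "K \<in> borel_measurable borel"
    unfolding K_def dilate_def[abs_def] by measurable
  define a where "a = (LINT x|lborel. norm (J x))"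
  have a0: "a \<ge> 0" by (simp add: a_def)
  have a: "(\<integral>\<^sup>+u. norm (J u) \<partial>lborel) = ennreal a"
    unfolding a_def using J by (intro nn_integral_eq_integral) auto
  have k0: "k \<ge> 0" using k[of 0] norm_ge_zero[of "J 0"] by linarith
  define S where "S x = (\<integral>\<^sup>+y. norm (K (x - y) * f y) \<partial>lborel)" for x
  define I where "I x = (\<integral>\<^sup>+y. norm (K (x - y)) * norm (f y) powr q \<partial>lborel)" for x
  have S_le: "S x \<le> ennreal l * ennreal a + ennreal (l powr (1 - q)) * I x" if l: "l > 0" for l x
  proof -
    have "S x \<le> (\<integral>\<^sup>+y. ennreal l * norm (K (x - y))
        + ennreal (l powr (1 - q)) * (norm (K (x - y)) * norm (f y) powr q) \<partial>lborel)"
      unfolding S_def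
    proof (rule nn_integral_mono)
      fix y
      have "norm (K (x - y)) * norm (f y) \<le> norm (K (x - y)) * (l + l powr (1 - q) * norm (f y) powr q)"
        by (intro mult_left_mono le_add_powr_mult l q) auto
      also have "\<dots> = l * norm (K (x - y)) + l powr (1 - q) * (norm (K (x - y)) * norm (f y) powr q)"
        by (simp add: algebra_simps)
      finally have "ennreal (norm (K (x - y) * f y)) \<le>
          ennreal (l * norm (K (x - y)) + l powr (1 - q) * (norm (K (x - y)) * norm (f y) powr q))"
        by (intro ennreal_leI) (simp add: norm_mult)
      also have "\<dots> = ennreal l * norm (K (x - y))
          + ennreal (l powr (1 - q)) * (norm (K (x - y)) * norm (f y) powr q)"
        using l by (subst ennreal_plus) (auto simp: ennreal_mult)
      finally show "ennreal (norm (K (x - y) * f y)) \<le> \<dots>" .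
    qed
    also have "\<dots> = ennreal l * ennreal a + ennreal (l powr (1 - q)) * I x"
      unfolding I_def using nn_integral_dilate_right[OF _ \<tau>, of J x]
      by (simp add: nn_integral_add nn_integral_cmult K_def[symmetric] a)
    finally show ?thesis .
  qed
  define \<iota> where "\<iota> = k * inverse \<tau> ^ DIM('a) * C"
  have \<iota>0: "\<iota> \<ge> 0" using k0 \<tau> C by (simp add: \<iota>_def)
  have I_le: "I x \<le> ennreal \<iota>" for x
  proof -
    have "I x \<le> (\<integral>\<^sup>+y. ennreal (k * inverse \<tau> ^ DIM('a)) * (norm (f y) powr q) \<partial>lborel)"
      unfolding I_def
    proof (rule nn_integral_mono)
      fix y
      have "norm (K (x - y)) \<le> k * inverse \<tau> ^ DIM('a)"
        unfolding K_def dilate_def using k \<tau> by (simp add: mult.commute mult_right_mono)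
      then have "norm (K (x - y)) * norm (f y) powr q \<le> k * inverse \<tau> ^ DIM('a) * norm (f y) powr q"
        by (intro mult_right_mono) auto
      then show "ennreal (norm (K (x - y)) * norm (f y) powr q)
          \<le> ennreal (k * inverse \<tau> ^ DIM('a)) * ennreal (norm (f y) powr q)"
        using k0 \<tau> by (simp add: ennreal_mult[symmetric] ennreal_leI)
    qed
    also have "\<dots> = ennreal (k * inverse \<tau> ^ DIM('a)) * (\<integral>\<^sup>+y. norm (f y) powr q \<partial>lborel)"
      by (rule nn_integral_cmult) measurable
    also have "\<dots> \<le> ennreal (k * inverse \<tau> ^ DIM('a)) * ennreal C"
      by (intro mult_left_mono f) auto
    also have "\<dots> = ennreal \<iota>"
      unfolding \<iota>_def using k0 \<tau> C by (intro ennreal_mult[symmetric]) auto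
    finally show ?thesis .
  qed
  define i where "i x = enn2real (I x)" for x
  have I_i: "I x = ennreal (i x)" and i0: "i x \<ge> 0" and i\<iota>: "i x \<le> \<iota>" for x
    using I_le[of x] le_less_trans[OF I_le[of x] ennreal_less_top] \<iota>0 by (auto simp: i_def enn2real_leI)
  have S_le': "S x \<le> ennreal (l * a + l powr (1 - q) * i x)" if "l > 0" for l x
    using S_le[OF that, of x] that a0 i0[of x] by (simp add: I_i ennreal_mult)
  show "(\<integral>\<^sup>+y. norm (dilate \<tau> J (x - y) * f y) \<partial>lborel) \<le> ennreal (A * \<tau> powr (- ?n / q))" for x
  proof -
    \<comment> \<open>Then l^q = \<tau>^(-n), so l^(1-q) times the pointwise bound of I scales like
      \<open>l\<close>, as the first term does.\<close>
    define l where "l = \<tau> powr (- ?n / q)"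
    have l: "l > 0" using \<tau> by (simp add: l_def)
    have "l powr q = inverse \<tau> ^ DIM('a)"
    proof -
      have "l powr q = \<tau> powr (- ?n / q * q)" by (simp only: l_def powr_powr)
      also have "- ?n / q * q = - ?n" using q by simp
      finally show ?thesis using \<tau> by (simp add: powr_minus powr_realpow power_inverse)
    qed
    then have "l powr (1 - q) * \<iota> = l * (k * C)"
      using l \<tau> by (simp add: powr_diff \<iota>_def)
    moreover have "l powr (1 - q) * i x \<le> l powr (1 - q) * \<iota>"
      by (intro mult_left_mono i\<iota>) auto
    ultimately have "l * a + l powr (1 - q) * i x \<le> l * (a + k * C)"
      by (simp add: algebra_simps)
    also have "\<dots> \<le> l * A"
    proof (intro mult_left_mono)
      have "a * 1 \<le> 2 * (a + 1) * (1 + C)"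
        using a0 C by (intro mult_mono) auto
      then show "a + k * C \<le> A" by (simp add: A a_def)
    qed (use l in auto)
    finally have "S x \<le> ennreal (l * A)"
      using S_le'[OF l, of x] by (meson ennreal_leI order_trans)
    then show ?thesis
      by (simp add: S_def K_def l_def mult.commute)
  qed
  \<comment> \<open>\<open>a + 1\<close> replaces \<open>a\<close>, which is 0 for a vanishing
    kernel, because \<open>powr_le_of_interpolation\<close> divides by it.\<close>
  have s_le: "enn2real (S x) powr q \<le> (2 * (a + 1)) powr q * i x / (a + 1)" for x
  proof (rule powr_le_of_interpolation)
    fix l :: real assume l: "l > 0"
    have "enn2real (S x) \<le> l * a + l powr (1 - q) * i x"
      using S_le'[OF l, of x] l a0 i0[of x] by (intro enn2real_leI) auto
    also have "\<dots> \<le> l * (a + 1) + l powr (1 - q) * i x"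
      using l by (simp add: algebra_simps)
    finally show "enn2real (S x) \<le> l * (a + 1) + l powr (1 - q) * i x" .
  qed (use a0 i0 q in auto)
  define B where "B = (2 * (a + 1)) powr q / (a + 1)"
  have B: "B \<ge> 0" using a0 by (simp add: B_def)
  have "(\<integral>\<^sup>+x. ennreal (enn2real (S x) powr q) \<partial>lborel) \<le> (\<integral>\<^sup>+x. ennreal B * I x \<partial>lborel)"
  proof (rule nn_integral_mono)
    fix x
    show "ennreal (enn2real (S x) powr q) \<le> ennreal B * I x"
      using s_le[of x] B i0[of x] by (simp add: I_i B_def ennreal_mult[symmetric] ennreal_leI)
  qed
  also have "\<dots> = ennreal B * (\<integral>\<^sup>+x. I x \<partial>lborel)"
    by (rule nn_integral_cmult) (unfold I_def, measurable)
  also have "(\<integral>\<^sup>+x. I x \<partial>lborel) = (\<integral>\<^sup>+y. \<integral>\<^sup>+x. norm (K (x - y)) * norm (f y) powr q \<partial>lborel \<partial>lborel)"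
    unfolding I_def by (rule lborel_pair.Fubini') measurable
  also have "\<dots> = (\<integral>\<^sup>+y. ennreal a * norm (f y) powr q \<partial>lborel)"
    using nn_integral_dilate_left[OF _ \<tau>, of J]
    by (simp add: ennreal_mult nn_integral_multc K_def[symmetric] a)
  also have "\<dots> = ennreal a * (\<integral>\<^sup>+y. norm (f y) powr q \<partial>lborel)"
    by (rule nn_integral_cmult) measurable
  also have "ennreal B * \<dots> \<le> ennreal B * (ennreal a * ennreal C)"
    by (intro mult_left_mono f) auto
  also have "\<dots> = ennreal (B * a * C)"
    using B a0 C by (simp add: ennreal_mult mult.assoc)
  also have "\<dots> \<le> ennreal (A powr q)"
  proof (rule ennreal_leI)
    have "B * a \<le> (2 * (a + 1)) powr q"
      using a0 by (simp add: B_def divide_simps mult_left_mono)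
    moreover have "C \<le> (1 + C) powr q"
      using powr_mono[of 1 q "1 + C"] q C by simp
    ultimately have "B * a * C \<le> (2 * (a + 1)) powr q * (1 + C) powr q"
      using C by (intro mult_mono) auto
    also have "\<dots> = (2 * (a + 1) * (1 + C)) powr q"
      using a0 C by (intro powr_mult[symmetric])
    also have "\<dots> \<le> A powr q"
      using q a0 C k0 by (intro powr_mono2) (auto simp: A a_def[symmetric])
    finally show "B * a * C \<le> A powr q" .
  qed
  finally show "(\<integral>\<^sup>+x. ennreal (enn2real (\<integral>\<^sup>+y. norm (dilate \<tau> J (x - y) * f y) \<partial>lborel) powr q) \<partial>lborel)
      \<le> ennreal (A powr q)"
    by (simp add: S_def K_def)
qed

section \<open>Borel representatives, and interpolation inside the modular\<close>

lemma lebesgue_measurable_borel_version: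
  fixes f :: "'a::euclidean_space \<Rightarrow> complex"
  assumes [measurable]: "f \<in> borel_measurable lebesgue"
  obtains f' where "f' \<in> borel_measurable borel" "AE x in lborel. f x = f' x"
proof -
  obtain g where [measurable]: "g \<in> borel_measurable lborel" and g: "AE x in lborel. Re (f x) = g x"
  proof -
    have "(\<lambda>x. Re (f x)) \<in> borel_measurable lebesgue" by measurable
    from completion_ex_borel_measurable_real[OF this] that show thesis by blast
  qed
  obtain h where [measurable]: "h \<in> borel_measurable lborel" and h: "AE x in lborel. Im (f x) = h x"
  proof -
    have "(\<lambda>x. Im (f x)) \<in> borel_measurable lebesgue" by measurable
    from completion_ex_borel_measurable_real[OF this] that show thesis by blast
  qed
  show thesis
  proof (rule that)
    show "(\<lambda>x. complex_of_real (g x) + \<i> * complex_of_real (h x)) \<in> borel_measurable borel"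
      using \<open>g \<in> borel_measurable lborel\<close> \<open>h \<in> borel_measurable lborel\<close> by simp
    show "AE x in lborel. f x = complex_of_real (g x) + \<i> * complex_of_real (h x)"
      using g h by eventually_elim (simp add: complex_eq_iff)
  qed
qed

text \<open>Tonelli on products of Borel measures asks for joint Borel measurability of K(x - y)
  f(y), which a Lebesgue measurable f does not supply. A Borel function equal to f almost everywhere
  has the same convolution at every x.\<close>

lemma conv_fun_borel_version:
  fixes K f :: "real^'n \<Rightarrow> complex"
  assumes [measurable]: "K \<in> borel_measurable borel" and fm[measurable]: "f \<in> borel_measurable lebesgue"
  obtains f' where "f' \<in> borel_measurable borel" "AE x in lborel. f x = f' x"
    and "\<And>x. conv_fun K f x = (LINT y|lborel. K (x - y) * f' y)"
    and "\<And>x. integrable lborel (\<lambda>y. K (x - y) * f' y) \<Longrightarrow> integrable lebesgue (\<lambda>y. K (x - y) * f y)"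
    and "conv_fun K f \<in> borel_measurable lebesgue"
proof -
  obtain f' where [measurable]: "f' \<in> borel_measurable borel" and ff': "AE x in lborel. f x = f' x"
    using lebesgue_measurable_borel_version[OF fm] by blast
  have ae: "AE y in lebesgue. K (x - y) * f y = K (x - y) * f' y" for x
    using AE_completion[OF ff'] by eventually_elim simp
  have m1[measurable]: "(\<lambda>y. K (x - y)) \<in> borel_measurable lebesgue" for x
    by (intro measurable_completion) measurable
  have m2: "(\<lambda>y. K (x - y) * f y) \<in> borel_measurable lebesgue"
    "(\<lambda>y. K (x - y) * f' y) \<in> borel_measurable lborel" for x
    by measurable
  have m3: "(\<lambda>y. K (x - y) * f' y) \<in> borel_measurable lebesgue" for x
    by (rule measurable_completion[OF m2(2)])
  have eq: "conv_fun K f x = (LINT y|lborel. K (x - y) * f' y)" for x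
    unfolding conv_fun_def
    by (subst integral_cong_AE[OF m2(1) m3 ae]) (rule integral_completion[OF m2(2)])
  show thesis
  proof (rule that)
    show "integrable lebesgue (\<lambda>y. K (x - y) * f y)" if "integrable lborel (\<lambda>y. K (x - y) * f' y)" for x
      using integrable_cong_AE[OF m2(1) m3 ae] integrable_completion[OF m2(2)] that by blast
    have "(\<lambda>(x, y). K (x - y) * f' y) \<in> borel_measurable (borel \<Otimes>\<^sub>M lborel)"
      by measurable
    from lborel.borel_measurable_lebesgue_integral[OF this]
    have "(\<lambda>x. LINT y|lborel. K (x - y) * f' y) \<in> borel_measurable lborel" by simp
    then show "conv_fun K f \<in> borel_measurable lebesgue"
      unfolding eq[abs_def] by (rule measurable_completion)
  qed (fact ff' eq \<open>f' \<in> borel_measurable borel\<close>)+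
qed

text \<open>For \<rho> = p(x) write (|h|/\<Lambda>)^\<rho> = (M/\<Lambda>)^\<rho> (|h|/M)^\<rho>. As
  |h|/M <= 1 and \<rho> >= q, the last factor is at most (|h|/M)^q, and \<open>fin\<close> turns the
  product into |h|^q / A^q, whose integral is at most 1. The condition \<open>top\<close> does the
  same for \<rho> = \<infinity>.\<close>

lemma modular_le_1:
  fixes h :: "real^'n \<Rightarrow> complex"
  assumes h: "h \<in> borel_measurable lebesgue" and M: "M > 0" "\<And>x. cmod (h x) \<le> M" and A: "A > 0"
    and int: "(\<integral>\<^sup>+x. ennreal (cmod (h x) powr q) \<partial>lebesgue) \<le> ennreal (A powr q)"
    and q: "q \<ge> 1" "AE x in lebesgue. ennreal q \<le> p x" and \<Lambda>: "\<Lambda> > 0"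
    and top: "AE x in lebesgue. p x = \<infinity> \<longrightarrow> M \<le> \<Lambda>"
    and fin: "AE x in lebesgue. p x \<noteq> \<infinity> \<longrightarrow> (M / \<Lambda>) powr enn2real (p x) \<le> (M / A) powr q"
  shows "modular p (\<lambda>x. h x / complex_of_real \<Lambda>) \<le> 1"
proof -
  have "modular p (\<lambda>x. h x / complex_of_real \<Lambda>)
      \<le> (\<integral>\<^sup>+x. ennreal (inverse (A powr q)) * ennreal (cmod (h x) powr q) \<partial>lebesgue)"
    unfolding modular_def
  proof (rule nn_integral_mono_AE)
    show "AE x in lebesgue. omega (p x) (cmod (h x / complex_of_real \<Lambda>))
        \<le> ennreal (inverse (A powr q)) * ennreal (cmod (h x) powr q)"
      using q(2) top fin
    proof eventually_elim
      case (elim x)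
      have c: "cmod (h x / complex_of_real \<Lambda>) = cmod (h x) / \<Lambda>"
        using \<Lambda> by (simp add: norm_divide)
      show ?case
      proof (cases "p x = \<infinity>")
        case True
        then have "cmod (h x) / \<Lambda> \<le> 1"
          using elim M(2)[of x] \<Lambda> by (simp add: divide_le_eq)
        then show ?thesis using True by (simp add: c omega_def)
      next
        case False
        define \<rho> where "\<rho> = enn2real (p x)"
        have p: "p x = ennreal \<rho>" "\<rho> \<ge> 0" using False by (auto simp: \<rho>_def less_top)
        have \<rho>: "q \<le> \<rho>" using elim(1) p(2) unfolding p(1) by (simp add: ennreal_le_iff)
        have "(cmod (h x) / \<Lambda>) powr \<rho> = (M / \<Lambda>) powr \<rho> * (cmod (h x) / M) powr \<rho>"
          using M(1) \<Lambda> by (subst powr_mult[symmetric]) auto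
        also have "\<dots> \<le> (M / A) powr q * (cmod (h x) / M) powr q"
          using elim(3) False M(1) M(2)[of x] \<rho> by (intro mult_mono powr_mono') (auto simp: \<rho>_def)
        also have "\<dots> = inverse (A powr q) * cmod (h x) powr q"
          using M A by (simp add: powr_divide field_simps)
        finally show ?thesis
          using False A by (simp add: c omega_def \<rho>_def[symmetric] ennreal_leI flip: ennreal_mult)
      qed
    qed
  qed
  also have "\<dots> = ennreal (inverse (A powr q)) * (\<integral>\<^sup>+x. ennreal (cmod (h x) powr q) \<partial>lebesgue)"
    using h by (intro nn_integral_cmult) measurable
  also have "\<dots> \<le> ennreal (inverse (A powr q)) * ennreal (A powr q)"
    by (intro mult_left_mono int) auto
  also have "\<dots> = 1"
    using A by (simp flip: ennreal_mult)
  finally show ?thesis .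
qed

subsection \<open>The decay estimate\<close>

lemma AE_lebesgue_const:
  assumes "AE x in (lebesgue :: 'a::euclidean_space measure). P"
  shows P
proof (rule ccontr)
  assume "\<not> P"
  with assms have "AE x in (lborel :: 'a measure). False"
    by (simp add: AE_completion_iff)
  then have "emeasure lborel (UNIV :: 'a set) = 0"
    by (subst (asm) AE_iff_measurable[OF _ refl]) auto
  then show False by simp
qed

lemma AE_le_exp_plus:
  "AE x in lebesgue. r x \<le> exp_plus r"
  unfolding exp_plus_def by (rule esssup_AE)

lemma exp_minus_le_exp_plus:
  fixes r :: "real^'n \<Rightarrow> ennreal"
  assumes "r \<in> var_exponents"
  shows "exp_minus r \<le> exp_plus r"
proof (rule AE_lebesgue_const[where 'a = "real^'n"])
  from AE_exp_minus_le[of r] AE_le_exp_plus[of r]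
  show "AE x in (lebesgue :: (real^'n) measure). exp_minus r \<le> exp_plus r"
    by eventually_elim (rule order_trans)
qed

lemma one_le_exp_minus: "r \<in> var_exponents \<Longrightarrow> 1 \<le> exp_minus r"
  unfolding exp_minus_def by (rule Sup_upper) (auto simp: var_exponents_def)

lemma enn2real_divide_exponent:
  assumes "P \<ge> 1" "q \<ge> 0"
  shows "enn2real (ennreal q / P) = q * enn2real (1 / P)"
    and "P \<noteq> \<infinity> \<Longrightarrow> enn2real (1 / P) = 1 / enn2real P"
proof -
  show "enn2real (1 / P) = 1 / enn2real P" if P_fin: "P \<noteq> \<infinity>"
  proof -
    obtain P' where P: "P = ennreal P'" "P' \<ge> 0" using P_fin by (cases P) auto
    then have "P' \<ge> 1" using assms by simp
    then show ?thesis unfolding P by (simp add: divide_ennreal flip: ennreal_1)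
  qed
  show "enn2real (ennreal q / P) = q * enn2real (1 / P)"
  proof (cases P)
    case (real P')
    then have "P' \<ge> 1" using assms by simp
    then show ?thesis using assms unfolding real by (simp add: divide_ennreal flip: ennreal_1)
  qed simp
qed

text \<open>Here r and p are infinite almost everywhere, and the estimate is that of L^1 *
  L^\<infinity>: a modular at most 1 says |f| <= 1 almost everywhere, and dilation does not change
  the L^1 norm of the kernel.\<close>

lemma dilate_convolution_modular_top:
  fixes p r :: "real^'n \<Rightarrow> ennreal" and J :: "real^'n \<Rightarrow> complex"
  assumes p: "p \<in> var_exponents" and r: "r \<in> var_exponents"
    and minus: "exp_minus r = \<infinity>" and le: "exp_minus r \<le> exp_minus p"
    and J: "integrable lborel J"
  obtains A where "A > 0" and "\<And>\<tau> f. \<tau> > 0 \<Longrightarrow> f \<in> borel_measurable lebesgue \<Longrightarrow> modular r f \<le> 1 \<Longrightarrow>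
    conv_exists (dilate \<tau> J) f \<and> conv_fun (dilate \<tau> J) f \<in> borel_measurable lebesgue \<and>
    modular p (\<lambda>x. conv_fun (dilate \<tau> J) f x / complex_of_real A) \<le> 1"
proof -
  have [measurable]: "J \<in> borel_measurable borel" using J by auto
  have rtop: "AE x in lebesgue. r x = \<infinity>"
    using AE_exp_minus_le[of r] by eventually_elim (simp add: minus top_unique)
  have ptop: "AE x in lebesgue. p x = \<infinity>"
    using AE_exp_minus_le[of p] by eventually_elim (use le in \<open>simp add: minus top_unique\<close>)
  define a where "a = (LINT x|lborel. norm (J x))"
  have a0: "a \<ge> 0" by (simp add: a_def)
  have a: "(\<integral>\<^sup>+u. norm (J u) \<partial>lborel) = ennreal a"
    unfolding a_def using J by (intro nn_integral_eq_integral) auto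
  show thesis
  proof (rule that)
    show "a + 1 > 0" using a0 by simp
    fix \<tau> :: real and f :: "real^'n \<Rightarrow> complex"
    assume \<tau>: "\<tau> > 0" and fm[measurable]: "f \<in> borel_measurable lebesgue" and mod: "modular r f \<le> 1"
    define K where "K = dilate \<tau> J"
    have Km[measurable]: "K \<in> borel_measurable borel"
      unfolding K_def dilate_def[abs_def] by measurable
    have [measurable]: "r \<in> borel_measurable lebesgue"
      using r by (simp add: var_exponents_def)
    have "AE x in lebesgue. omega (r x) (cmod (f x)) \<noteq> \<infinity>"
    proof (rule nn_integral_PInf_AE)
      show "(\<integral>\<^sup>+x. omega (r x) (cmod (f x)) \<partial>lebesgue) \<noteq> \<infinity>"
        using mod by (auto simp: modular_def top_unique)
    qed measurable
    then have f1: "AE x in lebesgue. cmod (f x) \<le> 1"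
      using rtop by eventually_elim (auto simp: omega_def split: if_splits)
    obtain f' where [measurable]: "f' \<in> borel_measurable borel" and ff': "AE x in lborel. f x = f' x"
      and conv: "\<And>x. conv_fun K f x = (LINT y|lborel. K (x - y) * f' y)"
      and int: "\<And>x. integrable lborel (\<lambda>y. K (x - y) * f' y) \<Longrightarrow> integrable lebesgue (\<lambda>y. K (x - y) * f y)"
      and cm: "conv_fun K f \<in> borel_measurable lebesgue"
      using conv_fun_borel_version[OF Km fm] by blast
    have "AE x in lebesgue. cmod (f' x) \<le> 1"
      using f1 AE_completion[OF ff'] by eventually_elim simp
    then have f'1: "AE x in lborel. cmod (f' x) \<le> 1"
      by (subst (asm) AE_completion_iff) auto
    have S: "(\<integral>\<^sup>+y. norm (K (x - y) * f' y) \<partial>lborel) \<le> ennreal a" for x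
    proof -
      have "(\<integral>\<^sup>+y. norm (K (x - y) * f' y) \<partial>lborel) \<le> (\<integral>\<^sup>+y. norm (K (x - y)) \<partial>lborel)"
      proof (rule nn_integral_mono_AE)
        show "AE y in lborel. ennreal (norm (K (x - y) * f' y)) \<le> ennreal (norm (K (x - y)))"
          using f'1 by eventually_elim (auto simp: norm_mult intro!: ennreal_leI mult_left_le)
      qed
      also have "\<dots> = ennreal a"
        unfolding K_def using a by (simp add: nn_integral_dilate_right[OF _ \<tau>])
      finally show ?thesis .
    qed
    have "integrable lborel (\<lambda>y. K (x - y) * f' y)" for x
      by (rule integrableI_bounded) (use le_less_trans[OF S ennreal_less_top] in auto)
    then have ex: "conv_exists K f"
      unfolding conv_exists_def using int by simp
    have h: "cmod (conv_fun K f x) \<le> a" for x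
    proof -
      have "ennreal (cmod (conv_fun K f x)) \<le> ennreal a"
        unfolding conv by (rule order_trans[OF norm_integral_le_nn_integral S])
      then show ?thesis using a0 by (simp add: ennreal_le_iff)
    qed
    have "modular p (\<lambda>x. conv_fun K f x / complex_of_real (a + 1)) = (\<integral>\<^sup>+(x::real^'n). 0 \<partial>lebesgue)"
      unfolding modular_def
    proof (rule nn_integral_cong_AE)
      show "AE x in lebesgue. omega (p x) (cmod (conv_fun K f x / complex_of_real (a + 1))) = 0"
        using ptop
      proof eventually_elim
        case (elim x)
        have "cmod (conv_fun K f x / complex_of_real (a + 1)) = cmod (conv_fun K f x) / (a + 1)"
          unfolding norm_divide norm_of_real using a0 by simp
        also have "\<dots> \<le> 1" using h[of x] a0 by (simp add: divide_le_eq)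
        finally show ?case using elim by (simp add: omega_def)
      qed
    qed
    then show "conv_exists (dilate \<tau> J) f \<and> conv_fun (dilate \<tau> J) f \<in> borel_measurable lebesgue \<and>
        modular p (\<lambda>x. conv_fun (dilate \<tau> J) f x / complex_of_real (a + 1)) \<le> 1"
      using ex cm unfolding K_def by simp
  qed
qed

text \<open>Modulars are not homogeneous, so the interpolation needs an explicit \<Lambda>; a norm
  estimate follows later by scaling. The case r^- = \<infinity> stands apart because q is used as a
  real number; there 1/r^- = 1/r^+ = 0, so \<psi> = 0.\<close>

lemma dilate_convolution_modular:
  fixes p r :: "real^'n \<Rightarrow> ennreal" and J :: "real^'n \<Rightarrow> complex"
  assumes p: "p \<in> var_exponents" and r: "r \<in> log_exponents"
    and inf: "exp_infinity r = exp_minus r" and le: "exp_minus r \<le> exp_minus p"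
    and J: "integrable lborel J" "bounded (range J)"
  obtains A where "A > 0" and "\<And>\<tau> f. \<tau> > 0 \<Longrightarrow> f \<in> borel_measurable lebesgue \<Longrightarrow> modular r f \<le> 1 \<Longrightarrow>
    conv_exists (dilate \<tau> J) f \<and> conv_fun (dilate \<tau> J) f \<in> borel_measurable lebesgue \<and>
    (\<exists>\<Lambda>>0. \<Lambda> \<le> A * \<tau> powr (- (real CARD('n) * decay_psi p r \<tau>)) \<and>
      modular p (\<lambda>x. conv_fun (dilate \<tau> J) f x / complex_of_real \<Lambda>) \<le> 1)"
proof (cases "exp_minus r = \<infinity>")
  case True
  have rv: "r \<in> var_exponents" using r by (simp add: log_exponents_def)
  have "exp_plus r = \<infinity>"
    using exp_minus_le_exp_plus[OF rv] True by (simp add: top_unique)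
  then have psi: "decay_psi p r \<tau> = 0" for \<tau>
    using True by (simp add: decay_psi_def)
  obtain A where A: "A > 0" and *: "\<And>\<tau> f. \<tau> > 0 \<Longrightarrow> f \<in> borel_measurable lebesgue \<Longrightarrow> modular r f \<le> 1 \<Longrightarrow>
    conv_exists (dilate \<tau> J) f \<and> conv_fun (dilate \<tau> J) f \<in> borel_measurable lebesgue \<and>
    modular p (\<lambda>x. conv_fun (dilate \<tau> J) f x / complex_of_real A) \<le> 1"
    using dilate_convolution_modular_top[OF p rv True le J(1)] by blast
  show thesis
  proof (rule that[OF A])
    fix \<tau> :: real and f :: "real^'n \<Rightarrow> complex"
    assume \<tau>: "\<tau> > 0" and "f \<in> borel_measurable lebesgue" "modular r f \<le> 1"
    from *[OF this] A \<tau> show "conv_exists (dilate \<tau> J) f \<and> conv_fun (dilate \<tau> J) f \<in> borel_measurable lebesgue \<and>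
      (\<exists>\<Lambda>>0. \<Lambda> \<le> A * \<tau> powr (- (real CARD('n) * decay_psi p r \<tau>)) \<and>
        modular p (\<lambda>x. conv_fun (dilate \<tau> J) f x / complex_of_real \<Lambda>) \<le> 1)"
      by (intro conjI exI[of _ A]) (simp_all add: psi)
  qed
next
  case False
  let ?n = "real CARD('n)"
  have rv: "r \<in> var_exponents" using r by (simp add: log_exponents_def)
  define q where "q = enn2real (exp_minus r)"
  have rq: "exp_minus r = ennreal q" using False by (simp add: q_def less_top)
  have q: "q \<ge> 1"
    using one_le_exp_minus[OF rv] unfolding rq by simp
  have pq: "AE x in lebesgue. ennreal q \<le> p x"
    using AE_exp_minus_le[of p] by eventually_elim (use le rq in auto)
  have [measurable]: "J \<in> borel_measurable borel" using J by auto
  obtain k where k: "\<And>x. norm (J x) \<le> k"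
    using J(2) by (auto simp: bounded_iff)
  have k0: "k \<ge> 0" using k[of 0] norm_ge_zero[of "J 0"] by linarith
  obtain C where C: "C \<ge> 0" and emb: "\<And>f. f \<in> borel_measurable lebesgue \<Longrightarrow> modular r f \<le> 1 \<Longrightarrow>
    (\<integral>\<^sup>+x. ennreal (cmod (f x) powr q) \<partial>lebesgue) \<le> ennreal C"
    using nn_integral_powr_le_of_modular[OF r q inf[unfolded rq] rq] by blast
  define A where "A = 2 * ((LINT x|lborel. norm (J x)) + 1) * (1 + C) + k * C"
  have A: "A > 0"
  proof -
    have "(LINT x|lborel. norm (J x)) + 1 > 0" by (intro add_nonneg_pos) auto
    then have "2 * ((LINT x|lborel. norm (J x)) + 1) * (1 + C) > 0" using C by simp
    moreover have "k * C \<ge> 0" using k0 C by simp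
    ultimately show ?thesis unfolding A_def by (rule add_pos_nonneg)
  qed
  show thesis
  proof (rule that[OF A])
    fix \<tau> :: real and f :: "real^'n \<Rightarrow> complex"
    assume \<tau>: "\<tau> > 0" and fm[measurable]: "f \<in> borel_measurable lebesgue" and mod: "modular r f \<le> 1"
    define K where "K = dilate \<tau> J"
    have Km[measurable]: "K \<in> borel_measurable borel"
      unfolding K_def dilate_def[abs_def] by measurable
    obtain f' where f'm[measurable]: "f' \<in> borel_measurable borel" and ff': "AE x in lborel. f x = f' x"
      and conv: "\<And>x. conv_fun K f x = (LINT y|lborel. K (x - y) * f' y)"
      and int: "\<And>x. integrable lborel (\<lambda>y. K (x - y) * f' y) \<Longrightarrow> integrable lebesgue (\<lambda>y. K (x - y) * f y)"
      and cm: "conv_fun K f \<in> borel_measurable lebesgue"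
      using conv_fun_borel_version[OF Km fm] by blast
    have "(\<integral>\<^sup>+x. ennreal (cmod (f' x) powr q) \<partial>lborel) = (\<integral>\<^sup>+x. ennreal (cmod (f x) powr q) \<partial>lborel)"
      by (rule nn_integral_cong_AE) (use ff' in eventually_elim, simp)
    also have "\<dots> \<le> ennreal C"
      using emb[OF fm mod] by (simp add: nn_integral_completion)
    finally have f'C: "(\<integral>\<^sup>+x. ennreal (cmod (f' x) powr q) \<partial>lborel) \<le> ennreal C" .
    define S where "S x = (\<integral>\<^sup>+y. norm (K (x - y) * f' y) \<partial>lborel)" for x
    define M where "M = A * \<tau> powr (- ?n / q)"
    have M: "M > 0" using A \<tau> by (simp add: M_def)
    have S: "S x \<le> ennreal M" for x
      using convolution_bounds_borel(1)[OF J(1) k f'm C f'C q \<tau> A_def] by (simp add: S_def K_def M_def)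
    have "(\<integral>\<^sup>+x. ennreal (enn2real (S x) powr q) \<partial>lborel) \<le> ennreal (A powr q)"
      using convolution_bounds_borel(2)[OF J(1) k f'm C f'C q \<tau> A_def] by (simp add: S_def K_def)
    moreover have hS: "cmod (conv_fun K f x) \<le> enn2real (S x)" for x
    proof -
      have "ennreal (cmod (conv_fun K f x)) \<le> S x"
        unfolding conv S_def by (rule norm_integral_le_nn_integral)
      from enn2real_mono[OF this] le_less_trans[OF S[of x] ennreal_less_top] show ?thesis by simp
    qed
    ultimately have hq: "(\<integral>\<^sup>+x. ennreal (cmod (conv_fun K f x) powr q) \<partial>lebesgue) \<le> ennreal (A powr q)"
      unfolding nn_integral_completion using q
      by (elim order_trans[rotated]) (auto intro!: nn_integral_mono ennreal_leI powr_mono2)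
    have hM: "cmod (conv_fun K f x) \<le> M" for x
      using hS[of x] enn2real_mono[OF S[of x]] M by simp
    have "integrable lborel (\<lambda>y. K (x - y) * f' y)" for x
      by (rule integrableI_bounded) (use le_less_trans[OF S ennreal_less_top] in \<open>auto simp: S_def\<close>)
    then have ex: "conv_exists K f"
      unfolding conv_exists_def using int by simp
    have MA: "(M / A) powr q = \<tau> powr (- ?n)"
      using A q by (simp add: M_def powr_powr)
    \<comment> \<open>With \<Lambda> = M \<tau>^(n e) the condition \<open>fin\<close> of
      \<open>modular_le_1\<close> becomes \<tau>^(-n e \<rho>) <= \<tau>^(-n). For \<tau> <= 1 it
      holds if e \<rho> <= 1, and for \<tau> > 1 if e \<rho> >= 1; hence e = 1/p^+ and e = 1/p^-. In
      both cases \<Lambda> = A \<tau>^(-n(1/q - e)).\<close>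
    have quot: "(M / (M * \<tau> powr (?n * e))) powr \<rho> = \<tau> powr (- ?n * (e * \<rho>))" for e \<rho>
      using M \<tau> by (simp add: powr_minus_divide[symmetric] powr_powr mult.assoc)
    have "\<exists>\<Lambda>>0. \<Lambda> \<le> A * \<tau> powr (- (?n * decay_psi p r \<tau>)) \<and>
        modular p (\<lambda>x. conv_fun K f x / complex_of_real \<Lambda>) \<le> 1"
    proof (cases "\<tau> \<le> 1")
      case True
      define P where "P = exp_plus p"
      define e where "e = enn2real (1 / P)"
      define \<Lambda> where "\<Lambda> = M * \<tau> powr (?n * e)"
      have P1: "P \<ge> 1"
        unfolding P_def using one_le_exp_minus[OF p] exp_minus_le_exp_plus[OF p] by (rule order_trans)
      have \<Lambda>: "\<Lambda> > 0" using M \<tau> by (simp add: \<Lambda>_def)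
      have psi: "decay_psi p r \<tau> = 1 / q - e"
        using True q enn2real_divide_exponent(1)[OF P1, of q]
          enn2real_divide_exponent(2)[of "ennreal q" 0]
        by (simp add: decay_psi_def rq P_def[symmetric] e_def[symmetric] field_simps)
      have "\<Lambda> = A * \<tau> powr (- (?n * decay_psi p r \<tau>))"
        unfolding \<Lambda>_def M_def psi by (simp add: powr_add[symmetric] algebra_simps)
      moreover have "modular p (\<lambda>x. conv_fun K f x / complex_of_real \<Lambda>) \<le> 1"
      proof (rule modular_le_1[OF cm M hM A hq q pq \<Lambda>])
        show "AE x in lebesgue. p x = \<infinity> \<longrightarrow> M \<le> \<Lambda>"
          using AE_le_exp_plus[of p]
        proof eventually_elim
          case (elim x)
          show ?case
          proof
            assume "p x = \<infinity>"
            then have "P = \<infinity>" using elim by (simp add: P_def top_unique)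
            then show "M \<le> \<Lambda>" using \<tau> by (simp add: \<Lambda>_def e_def)
          qed
        qed
        show "AE x in lebesgue. p x \<noteq> \<infinity> \<longrightarrow> (M / \<Lambda>) powr enn2real (p x) \<le> (M / A) powr q"
          using AE_le_exp_plus[of p]
        proof eventually_elim
          case (elim x)
          show ?case
          proof
            assume fin: "p x \<noteq> \<infinity>"
            have "e * enn2real (p x) \<le> 1"
            proof (cases "P = \<infinity>")
              case False
              then have "enn2real (p x) \<le> enn2real P" "1 \<le> enn2real P"
                using elim P1 enn2real_mono[of "p x" P] enn2real_mono[of 1 P] by (auto simp: P_def less_top)
              then show ?thesis
                using enn2real_divide_exponent(2)[OF P1, of 0] False by (simp add: e_def divide_le_eq)
            qed (simp add: e_def)
            then have "- ?n * (e * enn2real (p x)) \<ge> - ?n"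
              by simp
            then show "(M / \<Lambda>) powr enn2real (p x) \<le> (M / A) powr q"
              unfolding MA \<Lambda>_def quot using True \<tau> by (intro powr_mono') auto
          qed
        qed
      qed
      ultimately show ?thesis using \<Lambda> by blast
    next
      case False
      define P where "P = exp_minus p"
      define e where "e = enn2real (1 / P)"
      define \<Lambda> where "\<Lambda> = M * \<tau> powr (?n * e)"
      have P1: "P \<ge> 1"
        unfolding P_def by (rule one_le_exp_minus[OF p])
      have \<Lambda>: "\<Lambda> > 0" using M \<tau> by (simp add: \<Lambda>_def)
      have e0: "e \<ge> 0" by (simp add: e_def)
      have qe: "q * e \<le> 1"
      proof (cases "P = \<infinity>")
        case False
        then have "q \<le> enn2real P"
          using le q enn2real_mono[of "ennreal q" P] by (auto simp: P_def rq less_top)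
        then show ?thesis
          using q enn2real_divide_exponent(2)[OF P1, of 0] False by (simp add: e_def)
      qed (simp add: e_def)
      \<comment> \<open>Because 1 - q e >= 0, this gives \<psi> <= 1/q - e, and for \<tau> > 1 the
        smaller exponent yields the larger bound.\<close>
      have "enn2real (1 / exp_plus r) \<le> 1 / q"
      proof (cases "exp_plus r = \<infinity>")
        case fin: False
        have "q \<le> enn2real (exp_plus r)"
          using enn2real_mono[OF exp_minus_le_exp_plus[OF rv]] fin q by (auto simp: rq less_top)
        then show ?thesis
          using enn2real_divide_exponent(2)[of "exp_plus r" 0] q fin
            order_trans[OF one_le_exp_minus[OF rv] exp_minus_le_exp_plus[OF rv]]
          by (simp add: frac_le)
      qed (use q in simp)
      then have "enn2real (1 / exp_plus r) * (1 - q * e) \<le> 1 / q * (1 - q * e)"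
        using qe by (intro mult_right_mono) auto
      then have psi: "decay_psi p r \<tau> \<le> 1 / q - e"
        using False q enn2real_divide_exponent(1)[OF P1, of q]
        by (simp add: decay_psi_def rq P_def[symmetric] e_def[symmetric] field_simps)
      have "\<Lambda> = A * \<tau> powr (- (?n * (1 / q - e)))"
        unfolding \<Lambda>_def M_def by (simp add: powr_add[symmetric] algebra_simps)
      also have "\<dots> \<le> A * \<tau> powr (- (?n * decay_psi p r \<tau>))"
        using A False psi by (intro mult_left_mono powr_mono) auto
      finally have "\<Lambda> \<le> A * \<tau> powr (- (?n * decay_psi p r \<tau>))" .
      moreover have "modular p (\<lambda>x. conv_fun K f x / complex_of_real \<Lambda>) \<le> 1"
      proof (rule modular_le_1[OF cm M hM A hq q pq \<Lambda>])
        have "M * 1 \<le> \<Lambda>"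
          unfolding \<Lambda>_def using M False e0 by (intro mult_left_mono ge_one_powr_ge_zero) auto
        then show "AE x in lebesgue. p x = \<infinity> \<longrightarrow> M \<le> \<Lambda>" by simp
        show "AE x in lebesgue. p x \<noteq> \<infinity> \<longrightarrow> (M / \<Lambda>) powr enn2real (p x) \<le> (M / A) powr q"
          using AE_exp_minus_le[of p]
        proof eventually_elim
          case (elim x)
          show ?case
          proof
            assume fin: "p x \<noteq> \<infinity>"
            have "P \<noteq> \<infinity>" using elim fin by (auto simp: P_def top_unique)
            moreover from this have "enn2real P \<le> enn2real (p x)" "1 \<le> enn2real P"
              using elim fin P1 enn2real_mono[of P "p x"] enn2real_mono[of 1 P] by (auto simp: P_def less_top)
            ultimately have "1 \<le> e * enn2real (p x)"
              using enn2real_divide_exponent(2)[OF P1, of 0] by (simp add: e_def)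
            then have "- ?n * (e * enn2real (p x)) \<le> - ?n"
              by simp
            then show "(M / \<Lambda>) powr enn2real (p x) \<le> (M / A) powr q"
              unfolding MA \<Lambda>_def quot using False by (intro powr_mono) auto
          qed
        qed
      qed
      ultimately show ?thesis using \<Lambda> by blast
    qed
    with ex cm show "conv_exists (dilate \<tau> J) f \<and> conv_fun (dilate \<tau> J) f \<in> borel_measurable lebesgue \<and>
      (\<exists>\<Lambda>>0. \<Lambda> \<le> A * \<tau> powr (- (?n * decay_psi p r \<tau>)) \<and>
        modular p (\<lambda>x. conv_fun (dilate \<tau> J) f x / complex_of_real \<Lambda>) \<le> 1)"
      by (simp add: K_def)
  qed
qed

section \<open>From the modular to the norm\<close>

text \<open>Convexity of \<omega> in its argument together with its value 0 at 0.\<close>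

lemma omega_divide_le:
  assumes "N \<ge> 1" "s \<ge> 0" "1 \<le> p"
  shows "ennreal N * omega p (s / N) \<le> omega p s"
proof (cases "p = \<infinity>")
  case True
  have "s / N \<le> 1" if "s \<le> 1" using that assms by (simp add: divide_le_eq)
  with True show ?thesis by (auto simp: omega_def)
next
  case False
  define \<rho> where "\<rho> = enn2real p"
  have p: "p = ennreal \<rho>" "\<rho> \<ge> 0" using False by (auto simp: \<rho>_def less_top)
  have \<rho>: "\<rho> \<ge> 1" using assms(3) unfolding p(1) by simp
  have "N powr 1 \<le> N powr \<rho>" using assms \<rho> by (intro powr_mono) auto
  then have "N * (s / N) powr \<rho> \<le> N powr \<rho> * (s / N) powr \<rho>"
    using assms by (intro mult_right_mono) auto
  also have "\<dots> = s powr \<rho>"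
    using assms by (simp add: powr_divide)
  finally show ?thesis
    using False assms by (simp add: omega_def \<rho>_def[symmetric] ennreal_leI flip: ennreal_mult)
qed

text \<open>\<open>var_norm\<close> is an infimum of real numbers and informative only over a
  nonempty set. Dividing by the larger of 1 and the finite modular brings the modular down to 1 by
  \<open>omega_divide_le\<close>.\<close>

lemma var_norm_set_nonempty:
  assumes r: "r \<in> var_exponents" and \<phi>: "\<phi> \<in> var_Lp r"
  shows "\<exists>l>0. modular r (\<lambda>x. \<phi> x / complex_of_real l) \<le> 1"
proof -
  have [measurable]: "r \<in> borel_measurable lebesgue" "\<phi> \<in> borel_measurable lebesgue"
    and r1: "\<And>x. 1 \<le> r x"
    using r \<phi> by (auto simp: var_exponents_def var_Lp_def)
  obtain l0 :: real where l0: "l0 > 0" "modular r (\<lambda>x. complex_of_real l0 * \<phi> x) < \<infinity>"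
    using \<phi> by (auto simp: var_Lp_def)
  define m where "m = enn2real (modular r (\<lambda>x. complex_of_real l0 * \<phi> x))"
  have m: "modular r (\<lambda>x. complex_of_real l0 * \<phi> x) = ennreal m"
    using l0(2) by (simp add: m_def)
  define N where "N = max 1 m"
  have N: "N \<ge> 1" "m \<le> N" by (auto simp: N_def)
  have eq: "cmod (\<phi> x / complex_of_real (N / l0)) = cmod (complex_of_real l0 * \<phi> x) / N" for x
    using l0 N by (simp add: norm_divide norm_mult)
  have "ennreal N * modular r (\<lambda>x. \<phi> x / complex_of_real (N / l0))
      = (\<integral>\<^sup>+x. ennreal N * omega (r x) (cmod (complex_of_real l0 * \<phi> x) / N) \<partial>lebesgue)"
    unfolding modular_def eq by (rule nn_integral_cmult[symmetric]) measurable
  also have "\<dots> \<le> modular r (\<lambda>x. complex_of_real l0 * \<phi> x)"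
    unfolding modular_def by (intro nn_integral_mono omega_divide_le N r1 norm_ge_zero)
  also have "\<dots> \<le> ennreal N * 1"
    unfolding m using N by (simp add: ennreal_leI)
  finally have "modular r (\<lambda>x. \<phi> x / complex_of_real (N / l0)) \<le> 1"
    using N by (subst (asm) ennreal_mult_le_mult_iff) auto
  moreover have "N / l0 > 0" using N l0 by simp
  ultimately show ?thesis by blast
qed

lemma conv_fun_cmult_right: "conv_fun K (\<lambda>x. c * f x) x = c * conv_fun K f x"
  by (simp add: conv_fun_def mult.left_commute)

lemma conv_fun_cmult_left: "conv_fun (\<lambda>x. c * K x) f x = c * conv_fun K f x"
  by (simp add: conv_fun_def mult.assoc)

text \<open>Every admissible \<open>l\<close> for \<phi> gives, by linearity of the convolution, the
  admissible \<open>l * \<Lambda>\<close> for its image. Taking the infimum only at the end avoids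
  having to show that the norm itself is admissible.\<close>

lemma var_norm_convolution_le:
  fixes K :: "real^'n \<Rightarrow> complex"
  assumes r: "r \<in> var_exponents" and B: "B > 0"
    and unit: "\<And>f. f \<in> borel_measurable lebesgue \<Longrightarrow> modular r f \<le> 1 \<Longrightarrow>
      conv_exists K f \<and> conv_fun K f \<in> borel_measurable lebesgue \<and>
      (\<exists>\<Lambda>>0. \<Lambda> \<le> B \<and> modular p (\<lambda>x. conv_fun K f x / complex_of_real \<Lambda>) \<le> 1)"
    and \<phi>: "\<phi> \<in> var_Lp r"
  shows "conv_exists K \<phi> \<and> conv_fun K \<phi> \<in> var_Lp p \<and> var_norm p (conv_fun K \<phi>) \<le> B * var_norm r \<phi>"
proof -
  have [measurable]: "\<phi> \<in> borel_measurable lebesgue"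
    using \<phi> by (simp add: var_Lp_def)
  define U where "U = {l::real. l > 0 \<and> modular r (\<lambda>x. \<phi> x / complex_of_real l) \<le> 1}"
  have "U \<noteq> {}"
    using var_norm_set_nonempty[OF r \<phi>] by (auto simp: U_def)
  have step: "conv_exists K \<phi> \<and> conv_fun K \<phi> \<in> var_Lp p \<and> var_norm p (conv_fun K \<phi>) \<le> B * l"
    if "l \<in> U" for l
  proof -
    have l: "l > 0" using that by (simp add: U_def)
    define f where "f x = \<phi> x / complex_of_real l" for x
    have fm: "f \<in> borel_measurable lebesgue"
      unfolding f_def by measurable
    have \<phi>f: "\<phi> = (\<lambda>x. complex_of_real l * f x)"
      using l by (simp add: f_def fun_eq_iff)
    have "modular r f \<le> 1"
      using that by (simp add: U_def f_def[abs_def])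
    from unit[OF fm this] obtain \<Lambda> where ex: "conv_exists K f" and cm[measurable]: "conv_fun K f \<in> borel_measurable lebesgue"
      and \<Lambda>: "\<Lambda> > 0" "\<Lambda> \<le> B" "modular p (\<lambda>x. conv_fun K f x / complex_of_real \<Lambda>) \<le> 1"
      by blast
    have c: "conv_fun K \<phi> = (\<lambda>x. complex_of_real l * conv_fun K f x)"
      unfolding \<phi>f by (simp add: fun_eq_iff conv_fun_cmult_right)
    have mod: "modular p (\<lambda>x. conv_fun K \<phi> x / complex_of_real (l * \<Lambda>)) \<le> 1"
      using \<Lambda>(3) l by (simp add: c)
    have "conv_exists K \<phi>"
      using ex unfolding conv_exists_def
    proof eventually_elim
      case (elim x)
      from integrable_mult_right[OF elim, of "complex_of_real l"] show ?case
        by (simp add: \<phi>f mult.left_commute)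
    qed
    moreover have "conv_fun K \<phi> \<in> var_Lp p"
      unfolding var_Lp_def
    proof (intro CollectI conjI exI[of _ "inverse (l * \<Lambda>)"])
      show "conv_fun K \<phi> \<in> borel_measurable lebesgue"
        unfolding c by measurable
      show "inverse (l * \<Lambda>) > 0" using l \<Lambda> by simp
      have "(\<lambda>x. complex_of_real (inverse (l * \<Lambda>)) * conv_fun K \<phi> x)
          = (\<lambda>x. conv_fun K \<phi> x / complex_of_real (l * \<Lambda>))"
        by (simp add: fun_eq_iff field_simps)
      with mod show "modular p (\<lambda>x. complex_of_real (inverse (l * \<Lambda>)) * conv_fun K \<phi> x) < \<infinity>"
        by (simp only:) (rule le_less_trans, assumption, simp)
    qed
    moreover have "var_norm p (conv_fun K \<phi>) \<le> l * \<Lambda>"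
      unfolding var_norm_def
      by (rule cInf_lower) (use mod l \<Lambda> in \<open>auto intro!: bdd_belowI[of _ 0]\<close>)
    then have "var_norm p (conv_fun K \<phi>) \<le> B * l"
      using mult_left_mono[OF \<Lambda>(2), of l] l by (simp only: mult.commute[of B]) linarith
    ultimately show ?thesis by blast
  qed
  have "var_norm p (conv_fun K \<phi>) / B \<le> Inf U"
    using \<open>U \<noteq> {}\<close>
  proof (rule cInf_greatest)
    fix l assume "l \<in> U"
    with step[of l] B show "var_norm p (conv_fun K \<phi>) / B \<le> l"
      by (simp add: divide_le_eq mult.commute)
  qed
  then have "var_norm p (conv_fun K \<phi>) \<le> B * var_norm r \<phi>"
    using B by (simp add: var_norm_def U_def divide_le_eq mult.commute)
  then show ?thesis
    using step \<open>U \<noteq> {}\<close> by blast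
qed

theorem theorem4p5:
  fixes \<alpha> \<kappa> :: real and p r :: "real^'n \<Rightarrow> ennreal"
  assumes "\<alpha> > 0" and "\<kappa> > 0"
    and "p \<in> var_exponents" and "r \<in> log_exponents"
    and "exp_infinity r = exp_minus r" and "exp_minus r \<le> exp_minus p"
  shows "\<exists>C>0. \<forall>t>0. \<forall>\<phi>\<in>var_Lp r.
    (conv_exists (frac_heat_kernel \<alpha> t) \<phi> \<and>
     conv_fun (frac_heat_kernel \<alpha> t) \<phi> \<in> var_Lp p \<and>
     var_norm p (conv_fun (frac_heat_kernel \<alpha> t) \<phi>)
       \<le> C * t powr (- (real CARD('n) * decay_psi p r t / (2 * \<alpha>))) * var_norm r \<phi>) \<and>
    (conv_exists (frac_laplacian (\<kappa> / 2) (frac_heat_kernel \<alpha> t)) \<phi> \<and>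
     conv_fun (frac_laplacian (\<kappa> / 2) (frac_heat_kernel \<alpha> t)) \<phi> \<in> var_Lp p \<and>
     var_norm p (conv_fun (frac_laplacian (\<kappa> / 2) (frac_heat_kernel \<alpha> t)) \<phi>)
       \<le> C * t powr (- (\<kappa> / (2 * \<alpha>)) - real CARD('n) * decay_psi p r t / (2 * \<alpha>))
         * var_norm r \<phi>)"
proof -
  let ?n = "real CARD('n)"
  have rv: "r \<in> var_exponents" using assms(4) by (simp add: log_exponents_def)
  obtain J0 J1 :: "real^'n \<Rightarrow> complex"
    where J: "integrable lborel J0" "bounded (range J0)" "integrable lborel J1" "bounded (range J1)"
    and heat: "\<And>t. t > 0 \<Longrightarrow> frac_heat_kernel \<alpha> t = dilate (t powr (1 / (2 * \<alpha>))) J0"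
    and lap: "\<And>t x. t > 0 \<Longrightarrow> frac_laplacian (\<kappa> / 2) (frac_heat_kernel \<alpha> t) x
      = (t powr (- (\<kappa> / (2 * \<alpha>)))) *\<^sub>R dilate (t powr (1 / (2 * \<alpha>))) J1 x"
    using heat_kernels_are_dilates[OF assms(1,2)] by metis
  obtain A0 where A0: "A0 > 0" and bound0: "\<And>\<tau> f. \<tau> > 0 \<Longrightarrow> f \<in> borel_measurable lebesgue \<Longrightarrow> modular r f \<le> 1 \<Longrightarrow>
    conv_exists (dilate \<tau> J0) f \<and> conv_fun (dilate \<tau> J0) f \<in> borel_measurable lebesgue \<and>
    (\<exists>\<Lambda>>0. \<Lambda> \<le> A0 * \<tau> powr (- (?n * decay_psi p r \<tau>)) \<and>
      modular p (\<lambda>x. conv_fun (dilate \<tau> J0) f x / complex_of_real \<Lambda>) \<le> 1)"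
    using dilate_convolution_modular[OF assms(3-6) J(1,2)] by blast
  obtain A1 where A1: "A1 > 0" and bound1: "\<And>\<tau> f. \<tau> > 0 \<Longrightarrow> f \<in> borel_measurable lebesgue \<Longrightarrow> modular r f \<le> 1 \<Longrightarrow>
    conv_exists (dilate \<tau> J1) f \<and> conv_fun (dilate \<tau> J1) f \<in> borel_measurable lebesgue \<and>
    (\<exists>\<Lambda>>0. \<Lambda> \<le> A1 * \<tau> powr (- (?n * decay_psi p r \<tau>)) \<and>
      modular p (\<lambda>x. conv_fun (dilate \<tau> J1) f x / complex_of_real \<Lambda>) \<le> 1)"
    using dilate_convolution_modular[OF assms(3-6) J(3,4)] by blast
  define C where "C = max A0 A1"
  have C: "C > 0" "A0 \<le> C" "A1 \<le> C" using A0 by (auto simp: C_def)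
  show ?thesis
  proof (intro exI[of _ C] conjI[OF C(1)] allI impI ballI)
    fix t :: real and \<phi> :: "real^'n \<Rightarrow> complex"
    assume t: "t > 0" and \<phi>: "\<phi> \<in> var_Lp r"
    define \<tau> where "\<tau> = t powr (1 / (2 * \<alpha>))"
    define s where "s = t powr (- (\<kappa> / (2 * \<alpha>)))"
    have \<tau>: "\<tau> > 0" and s: "s > 0" using t by (auto simp: \<tau>_def s_def)
    \<comment> \<open>\<open>decay_psi\<close> depends on its last argument only through comparison
      with 1, so it does not distinguish \<tau> from t.\<close>
    have "\<tau> \<le> 1 \<longleftrightarrow> t \<le> 1"
    proof (cases "t \<le> 1")
      case True
      then show ?thesis using t assms(1) by (simp add: \<tau>_def powr_le1)
    next
      case False
      have "1 powr (1 / (2 * \<alpha>)) < t powr (1 / (2 * \<alpha>))"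
        by (rule powr_less_mono2) (use False assms(1) in auto)
      then show ?thesis using False by (simp add: \<tau>_def)
    qed
    then have psi: "decay_psi p r \<tau> = decay_psi p r t"
      by (simp add: decay_psi_def)
    define E where "E = t powr (- (?n * decay_psi p r t / (2 * \<alpha>)))"
    have E: "\<tau> powr (- (?n * decay_psi p r \<tau>)) = E"
      unfolding psi by (simp add: \<tau>_def E_def powr_powr)
    have E0: "E > 0" using t by (simp add: E_def)
    have sE: "t powr (- (\<kappa> / (2 * \<alpha>)) - ?n * decay_psi p r t / (2 * \<alpha>)) = s * E"
      by (simp add: s_def E_def powr_add[symmetric])
    have "conv_exists (dilate \<tau> J0) \<phi> \<and> conv_fun (dilate \<tau> J0) \<phi> \<in> var_Lp p \<and>
        var_norm p (conv_fun (dilate \<tau> J0) \<phi>) \<le> (C * E) * var_norm r \<phi>"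
    proof (rule var_norm_convolution_le[OF rv _ _ \<phi>])
      show "C * E > 0" using C E0 by simp
      fix f :: "real^'n \<Rightarrow> complex"
      assume "f \<in> borel_measurable lebesgue" "modular r f \<le> 1"
      from bound0[OF \<tau> this]
      show "conv_exists (dilate \<tau> J0) f \<and> conv_fun (dilate \<tau> J0) f \<in> borel_measurable lebesgue \<and>
        (\<exists>\<Lambda>>0. \<Lambda> \<le> C * E \<and> modular p (\<lambda>x. conv_fun (dilate \<tau> J0) f x / complex_of_real \<Lambda>) \<le> 1)"
        unfolding E using mult_right_mono[OF C(2), of E] E0 by (meson less_imp_le order_trans)
    qed
    moreover
    \<comment> \<open>The factor \<open>s\<close> of the second kernel is passed on to \<Lambda>, so
      the estimate for the bare dilate applies.\<close>
    define L where "L x = complex_of_real s * dilate \<tau> J1 x" for x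
    have "conv_exists L \<phi> \<and> conv_fun L \<phi> \<in> var_Lp p \<and>
        var_norm p (conv_fun L \<phi>) \<le> (C * (s * E)) * var_norm r \<phi>"
    proof (rule var_norm_convolution_le[OF rv _ _ \<phi>])
      show "C * (s * E) > 0" using C E0 s by simp
      fix f :: "real^'n \<Rightarrow> complex"
      assume f: "f \<in> borel_measurable lebesgue" "modular r f \<le> 1"
      obtain \<Lambda> where ex: "conv_exists (dilate \<tau> J1) f"
        and cm[measurable]: "conv_fun (dilate \<tau> J1) f \<in> borel_measurable lebesgue"
        and \<Lambda>: "\<Lambda> > 0" "\<Lambda> \<le> A1 * E" "modular p (\<lambda>x. conv_fun (dilate \<tau> J1) f x / complex_of_real \<Lambda>) \<le> 1"
        using bound1[OF \<tau> f] unfolding E by blast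
      have c: "conv_fun L f = (\<lambda>x. complex_of_real s * conv_fun (dilate \<tau> J1) f x)"
        unfolding L_def by (simp add: fun_eq_iff conv_fun_cmult_left)
      have "conv_exists L f"
        using ex unfolding conv_exists_def
      proof eventually_elim
        case (elim x)
        from integrable_mult_right[OF elim, of "complex_of_real s"] show ?case
          by (simp add: L_def mult.assoc)
      qed
      moreover have "conv_fun L f \<in> borel_measurable lebesgue"
        unfolding c by measurable
      moreover have "s * \<Lambda> > 0" using s \<Lambda> by simp
      moreover have "s * \<Lambda> \<le> C * (s * E)"
      proof -
        have "\<Lambda> \<le> C * E"
          by (rule order_trans[OF \<Lambda>(2) mult_right_mono[OF C(3)]]) (use E0 in simp)
        then show ?thesis
          using mult_left_mono[of \<Lambda> "C * E" s] s by (simp add: mult.left_commute)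
      qed
      moreover have "modular p (\<lambda>x. conv_fun L f x / complex_of_real (s * \<Lambda>)) \<le> 1"
        using \<Lambda>(3) s by (simp add: c)
      ultimately show "conv_exists L f \<and> conv_fun L f \<in> borel_measurable lebesgue \<and>
        (\<exists>\<Lambda>>0. \<Lambda> \<le> C * (s * E) \<and> modular p (\<lambda>x. conv_fun L f x / complex_of_real \<Lambda>) \<le> 1)"
        by blast
    qed
    moreover have "frac_heat_kernel \<alpha> t = dilate \<tau> J0"
      using heat[OF t] by (simp add: \<tau>_def)
    moreover have "frac_laplacian (\<kappa> / 2) (frac_heat_kernel \<alpha> t) = L"
      using lap[OF t] by (simp add: fun_eq_iff L_def s_def \<tau>_def scaleR_conv_of_real)
    ultimately show "(conv_exists (frac_heat_kernel \<alpha> t) \<phi> \<and>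
     conv_fun (frac_heat_kernel \<alpha> t) \<phi> \<in> var_Lp p \<and>
     var_norm p (conv_fun (frac_heat_kernel \<alpha> t) \<phi>)
       \<le> C * t powr (- (?n * decay_psi p r t / (2 * \<alpha>))) * var_norm r \<phi>) \<and>
    (conv_exists (frac_laplacian (\<kappa> / 2) (frac_heat_kernel \<alpha> t)) \<phi> \<and>
     conv_fun (frac_laplacian (\<kappa> / 2) (frac_heat_kernel \<alpha> t)) \<phi> \<in> var_Lp p \<and>
     var_norm p (conv_fun (frac_laplacian (\<kappa> / 2) (frac_heat_kernel \<alpha> t)) \<phi>)
       \<le> C * t powr (- (\<kappa> / (2 * \<alpha>)) - ?n * decay_psi p r t / (2 * \<alpha>)) * var_norm r \<phi>)"
      unfolding sE E_def[symmetric] by (simp only: simp_thms)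
  qed
qed

end
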